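(* Let $E$ be an arbitrary graph and let $K$ be any field. Then every homomorphic image of the Leavitt path algebra $L_K(E)$ is a Zorn ring if and only if $L_K(E)$ is a weakly regular ring.
   Context: Rings are associative and need not have an identity. A homomorphic image of a ring $R$ is a quotient $R/I$ by a two-sided ideal $I$. A ring $R$ is a Zorn ring if for every $a \in R$, either $a$ is nilpotent or there is $b \in R$ such that $ab$ is a non-zero idempotent. A ring $R$ is weakly regular if $I^2 = I$ for every one-sided ideal $I$ of $R$. A (directed) graph $E = (E^0, E^1, r, s)$ consists of two sets $E^0$ (vertices) and $E^1$ (edges) and maps $r, s : E^1 \to E^0$. No restriction is placed on the number of vertices or on the number of edges emitted by a vertex. A vertex $v$ is regular if $s^{-1}(v)$ is finite and non-empty. The Leavitt path algebra $L_K(E)$ is the $K$-algebra generated by a set $\{v : v \in E^0\}$ of pairwise orthogonal idempotents together with a set of variables $\{e, e^* : e \in E^1\}$ subject to the relations: (1) $s(e)e = e = e\,r(e)$ for all $e \in E^1$; (2) $r(e)e^* = e^* = e^* s(e)$ for all $e \in E^1$; (3) for all $e, f \in E^1$, $e^*e = r(e)$ and $e^* f = 0$ if $e \ne f$; (4) $v = \sum_{e \in E^1, s(e) = v} e e^*$ for every regular vertex $v$. *)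

theory Defs
  imports
    "HOL-Algebra.QuotRing"
    "HOL-Algebra.Ideal_Product"
    "HOL-Library.Poly_Mapping"
    "Graph_Theory.Digraph"
begin

section \<open>Rings without identity\<close>

text \<open>
  We use the ring records of HOL-Algebra, but never their field for the identity: it may hold
  an arbitrary value, also outside the carrier. The library's \<open>ring\<close>, \<open>ideal\<close> and
  exponentiation all refer to the identity and hence are not applicable; \<open>abelian_group\<close>,
  \<open>additive_subgroup\<close>, \<open>Quot\<close> (up to its unused identity field) and \<open>ideal_prod\<close> are.
\<close>

locale nonunital_ring = abelian_group R for R (structure) +
  assumes mult_closed: "\<lbrakk>x \<in> carrier R; y \<in> carrier R\<rbrakk> \<Longrightarrow> x \<otimes> y \<in> carrier R"
    and mult_assoc: "\<lbrakk>x \<in> carrier R; y \<in> carrier R; z \<in> carrier R\<rbrakk>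
      \<Longrightarrow> (x \<otimes> y) \<otimes> z = x \<otimes> (y \<otimes> z)"
    and l_distrib: "\<lbrakk>x \<in> carrier R; y \<in> carrier R; z \<in> carrier R\<rbrakk>
      \<Longrightarrow> (x \<oplus> y) \<otimes> z = x \<otimes> z \<oplus> y \<otimes> z"
    and r_distrib: "\<lbrakk>x \<in> carrier R; y \<in> carrier R; z \<in> carrier R\<rbrakk>
      \<Longrightarrow> z \<otimes> (x \<oplus> y) = z \<otimes> x \<oplus> z \<otimes> y"

definition left_ideal :: "'a set \<Rightarrow> ('a, 'b) ring_scheme \<Rightarrow> bool" where
  "left_ideal I R \<longleftrightarrow> additive_subgroup I R \<and> (\<forall>r \<in> carrier R. \<forall>x \<in> I. r \<otimes>\<^bsub>R\<^esub> x \<in> I)"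

definition right_ideal :: "'a set \<Rightarrow> ('a, 'b) ring_scheme \<Rightarrow> bool" where
  "right_ideal I R \<longleftrightarrow> additive_subgroup I R \<and> (\<forall>r \<in> carrier R. \<forall>x \<in> I. x \<otimes>\<^bsub>R\<^esub> r \<in> I)"

definition two_sided_ideal :: "'a set \<Rightarrow> ('a, 'b) ring_scheme \<Rightarrow> bool" where
  "two_sided_ideal I R \<longleftrightarrow> left_ideal I R \<and> right_ideal I R"

text \<open>The \<open>n\<close>-th iterate below is the power of \<open>a\<close> with exponent \<open>n + 1\<close>.\<close>

definition nilpotent :: "('a, 'b) ring_scheme \<Rightarrow> 'a \<Rightarrow> bool" where
  "nilpotent R a \<longleftrightarrow> (\<exists>n :: nat. ((\<lambda>x. x \<otimes>\<^bsub>R\<^esub> a) ^^ n) a = \<zero>\<^bsub>R\<^esub>)"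

definition idempotent :: "('a, 'b) ring_scheme \<Rightarrow> 'a \<Rightarrow> bool" where
  "idempotent R a \<longleftrightarrow> a \<otimes>\<^bsub>R\<^esub> a = a"

locale zorn_ring = nonunital_ring +
  assumes zorn: "a \<in> carrier R \<Longrightarrow>
    nilpotent R a \<or> (\<exists>b \<in> carrier R. a \<otimes> b \<noteq> \<zero> \<and> idempotent R (a \<otimes> b))"

text \<open>
  \<open>ideal_prod R I I\<close> consists of the finite non-empty sums of products of two elements
  of \<open>I\<close>; for a one-sided ideal \<open>I\<close> this is the additive subgroup generated by these products.
\<close>

locale weakly_regular_ring = nonunital_ring +
  assumes weakly_regular: "left_ideal I R \<or> right_ideal I R \<Longrightarrow> ideal_prod R I I = I"

section \<open>Algebras without identity given by generators and relations\<close>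

datatype 'g fword = FWord (letters: "'g list")

instantiation fword :: (type) monoid_add
begin

definition zero_fword :: "'a fword" where
  "0 = FWord []"

definition plus_fword :: "'a fword \<Rightarrow> 'a fword \<Rightarrow> 'a fword" where
  "u + w = FWord (letters u @ letters w)"

instance
  by standard (simp_all add: zero_fword_def plus_fword_def)

end

text \<open>
  As \<open>+\<close> on words is concatenation, the convolution product on \<open>'g fword \<Rightarrow>\<^sub>0 'k\<close> is that
  of non-commutative polynomials. The free algebra without identity on a set \<open>X\<close> of generators
  consists of the polynomials in \<open>X\<close> without constant term.
\<close>

type_synonym ('g, 'k) ncpoly = "'g fword \<Rightarrow>\<^sub>0 'k"

definition free_algebra :: "'g set \<Rightarrow> ('g, 'k :: field) ncpoly ring" where
  "free_algebra X =
    \<lparr>carrier = {p. \<forall>w \<in> Poly_Mapping.keys p. w \<noteq> 0 \<and> set (letters w) \<subseteq> X},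
     mult = (*), one = undefined, zero = 0, add = (+)\<rparr>"

definition scale :: "'k :: field \<Rightarrow> ('g, 'k) ncpoly \<Rightarrow> ('g, 'k) ncpoly" where
  "scale c p = Poly_Mapping.single 0 c * p"

definition algebra_ideal_generated ::
  "'g set \<Rightarrow> ('g, 'k :: field) ncpoly set \<Rightarrow> ('g, 'k) ncpoly set" where
  "algebra_ideal_generated X S =
    \<Inter>{I. two_sided_ideal I (free_algebra X) \<and> (\<forall>c. \<forall>p \<in> I. scale c p \<in> I) \<and> S \<subseteq> I}"

definition presented_algebra ::
  "'g set \<Rightarrow> ('g, 'k :: field) ncpoly set \<Rightarrow> ('g, 'k) ncpoly set ring" where
  "presented_algebra X S = free_algebra X Quot algebra_ideal_generated X S"

section \<open>Leavitt path algebras\<close>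

text \<open>The source and range of an edge \<open>e\<close> of \<open>E\<close> are \<open>tail E e\<close> and \<open>head E e\<close>.\<close>

datatype ('v, 'e) lpa_generator = Vertex 'v | Edge 'e | Ghost 'e

definition lpa_generators :: "('v, 'e) pre_digraph \<Rightarrow> ('v, 'e) lpa_generator set" where
  "lpa_generators E = Vertex ` verts E \<union> Edge ` arcs E \<union> Ghost ` arcs E"

definition regular_vertex :: "('v, 'e) pre_digraph \<Rightarrow> 'v \<Rightarrow> bool" where
  "regular_vertex E v \<longleftrightarrow> v \<in> verts E \<and> finite (out_arcs E v) \<and> out_arcs E v \<noteq> {}"

abbreviation gen :: "'g \<Rightarrow> ('g, 'k :: field) ncpoly" where
  "gen x \<equiv> Poly_Mapping.single (FWord [x]) 1"

text \<open>A relation \<open>p = q\<close> is represented by the element \<open>p - q\<close>.\<close>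

inductive_set lpa_relators ::
  "('v, 'e) pre_digraph \<Rightarrow> (('v, 'e) lpa_generator, 'k :: field) ncpoly set"
  for E :: "('v, 'e) pre_digraph" where
  vertex_idempotent: "v \<in> verts E \<Longrightarrow>
    gen (Vertex v) * gen (Vertex v) - gen (Vertex v) \<in> lpa_relators E"
| vertex_orthogonal: "\<lbrakk>v \<in> verts E; w \<in> verts E; v \<noteq> w\<rbrakk> \<Longrightarrow>
    gen (Vertex v) * gen (Vertex w) \<in> lpa_relators E"
| source_edge: "e \<in> arcs E \<Longrightarrow>
    gen (Vertex (tail E e)) * gen (Edge e) - gen (Edge e) \<in> lpa_relators E"
| edge_range: "e \<in> arcs E \<Longrightarrow>
    gen (Edge e) * gen (Vertex (head E e)) - gen (Edge e) \<in> lpa_relators E"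
| range_ghost: "e \<in> arcs E \<Longrightarrow>
    gen (Vertex (head E e)) * gen (Ghost e) - gen (Ghost e) \<in> lpa_relators E"
| ghost_source: "e \<in> arcs E \<Longrightarrow>
    gen (Ghost e) * gen (Vertex (tail E e)) - gen (Ghost e) \<in> lpa_relators E"
| ghost_edge_same: "e \<in> arcs E \<Longrightarrow>
    gen (Ghost e) * gen (Edge e) - gen (Vertex (head E e)) \<in> lpa_relators E"
| ghost_edge_distinct: "\<lbrakk>e \<in> arcs E; f \<in> arcs E; e \<noteq> f\<rbrakk> \<Longrightarrow>
    gen (Ghost e) * gen (Edge f) \<in> lpa_relators E"
| vertex_sum: "regular_vertex E v \<Longrightarrow>
    gen (Vertex v) - (\<Sum>e \<in> out_arcs E v. gen (Edge e) * gen (Ghost e)) \<in> lpa_relators E"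

definition leavitt_path_algebra ::
  "'k :: field itself \<Rightarrow> ('v, 'e) pre_digraph \<Rightarrow>
    (('v, 'e) lpa_generator, 'k) ncpoly set ring" where
  "leavitt_path_algebra K E = presented_algebra (lpa_generators E) (lpa_relators E)"

section \<open>The Leavitt path algebra is a ring\<close>

lemma (in nonunital_ring) rcoset_mult_coset:
  assumes I: "two_sided_ideal I R" and x: "x \<in> carrier R" and y: "y \<in> carrier R"
  shows "rcoset_mult R I (I +> x) (I +> y) = I +> (x \<otimes> y)"
proof -
  have add_sub: "additive_subgroup I R"
    using I by (simp add: two_sided_ideal_def left_ideal_def)
  interpret abelian_subgroup I R
    using add_sub by (rule abelian_subgroupI3) unfold_locales
  have mem: "x \<in> I +> x" "y \<in> I +> y"
    using x y by (auto intro: a_rcos_self)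
  have eq: "I +> (x' \<otimes> y') = I +> (x \<otimes> y)" if x': "x' \<in> I +> x" and y': "y' \<in> I +> y" for x' y'
  proof -
    obtain i where i: "i \<in> I" "x' = i \<oplus> x" using x' by (auto simp: a_r_coset_def')
    obtain j where j: "j \<in> I" "y' = j \<oplus> y" using y' by (auto simp: a_r_coset_def')
    have c: "i \<in> carrier R" "j \<in> carrier R" using i j by auto
    have "x' \<otimes> y' = i \<otimes> (j \<oplus> y) \<oplus> (x \<otimes> j \<oplus> x \<otimes> y)"
      using c x y l_distrib[of i x "j \<oplus> y"] r_distrib[of j y x] by (simp add: i(2) j(2))
    then have "x' \<otimes> y' = (i \<otimes> (j \<oplus> y) \<oplus> x \<otimes> j) \<oplus> x \<otimes> y"
      using c x y by (simp add: mult_closed a_assoc)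
    moreover have "i \<otimes> (j \<oplus> y) \<oplus> x \<otimes> j \<in> I"
      using I i j c x y by (simp add: two_sided_ideal_def left_ideal_def right_ideal_def)
    ultimately have "x' \<otimes> y' \<in> I +> (x \<otimes> y)" by (auto simp: a_r_coset_def')
    then show ?thesis
      using a_repr_independence'[of "x' \<otimes> y'" "x \<otimes> y"] mult_closed[OF x y] by simp
  qed
  show ?thesis
    unfolding rcoset_mult_def using mem eq by blast
qed

lemma (in nonunital_ring) nonunital_ring_quotient:
  assumes I: "two_sided_ideal I R"
  shows "nonunital_ring (R Quot I)"
proof -
  have add_sub: "additive_subgroup I R"
    using I by (simp add: two_sided_ideal_def left_ideal_def)
  interpret abelian_subgroup I R
    using add_sub by (rule abelian_subgroupI3) unfold_locales
  show ?thesis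
  proof (intro nonunital_ring.intro nonunital_ring_axioms.intro)
    show "abelian_group (R Quot I)"
      by (rule comm_group_abelian_groupI)
        (simp add: FactRing_def a_factorgroup_is_comm_group[unfolded A_FactGroup_def'])
  qed (auto simp: FactRing_simps rcoset_mult_coset[OF I] a_rcos_sum l_distrib r_distrib
      mult_closed mult_assoc)
qed

lemma nonunital_ring_free_algebra: "nonunital_ring (free_algebra X :: ('g, 'k :: field) ncpoly ring)"
proof (intro nonunital_ring.intro nonunital_ring_axioms.intro abelian_groupI)
  fix x assume x: "x \<in> carrier (free_algebra X :: ('g, 'k) ncpoly ring)"
  show "\<exists>y \<in> carrier (free_algebra X). y \<oplus>\<^bsub>free_algebra X\<^esub> x = \<zero>\<^bsub>free_algebra X\<^esub>"
    using x by (intro bexI[of _ "- x"]) (auto simp: free_algebra_def)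
next
  fix x y :: "('g, 'k) ncpoly"
  assume xy: "x \<in> carrier (free_algebra X)" "y \<in> carrier (free_algebra X)"
  have "w \<noteq> 0 \<and> set (letters w) \<subseteq> X" if w: "w \<in> Poly_Mapping.keys (x * y)" for w
  proof -
    obtain u v where "w = u + v" "u \<in> Poly_Mapping.keys x" "v \<in> Poly_Mapping.keys y"
      using keys_mult[of x y] w by blast
    moreover from this have "u \<noteq> 0" "set (letters u) \<subseteq> X" "set (letters v) \<subseteq> X"
      using xy by (simp_all add: free_algebra_def)
    ultimately show ?thesis
      by (cases u) (simp add: plus_fword_def zero_fword_def)
  qed
  then show "x \<otimes>\<^bsub>free_algebra X\<^esub> y \<in> carrier (free_algebra X)"
    by (simp add: free_algebra_def)
next
  fix x y :: "('g, 'k) ncpoly"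
  assume "x \<in> carrier (free_algebra X)" "y \<in> carrier (free_algebra X)"
  then show "x \<oplus>\<^bsub>free_algebra X\<^esub> y \<in> carrier (free_algebra X)"
    using keys_add[of x y] by (auto simp: free_algebra_def)
qed (auto simp: free_algebra_def algebra_simps)

lemma two_sided_ideal_carrier:
  assumes "nonunital_ring R" shows "two_sided_ideal (carrier R) R"
proof -
  interpret nonunital_ring R by fact
  show ?thesis
    by (auto simp: two_sided_ideal_def left_ideal_def right_ideal_def mult_closed
        intro!: additive_subgroup.intro add.subgroup_self)
qed

lemma two_sided_ideal_generated:
  fixes S :: "('g, 'k :: field) ncpoly set"
  assumes S: "S \<subseteq> carrier (free_algebra X)"
  shows "two_sided_ideal (algebra_ideal_generated X S) (free_algebra X)"
proof -
  let ?F = "free_algebra X :: ('g, 'k) ncpoly ring"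
  interpret nonunital_ring ?F by (rule nonunital_ring_free_algebra)
  have sc: "scale c p \<in> carrier ?F" if "p \<in> carrier ?F" for c p
    using that keys_mult[of "Poly_Mapping.single 0 c" p]
    by (fastforce simp: free_algebra_def scale_def split: if_splits)
  define M where "M = {I. two_sided_ideal I ?F \<and> (\<forall>c. \<forall>p \<in> I. scale c p \<in> I) \<and> S \<subseteq> I}"
  have ne: "carrier ?F \<in> M"
    using S sc two_sided_ideal_carrier[OF nonunital_ring_axioms] by (auto simp: M_def)
  have "additive_subgroup (\<Inter>M) ?F"
    unfolding additive_subgroup_def using ne
    by (intro add.subgroups_Inter)
      (auto simp: M_def two_sided_ideal_def left_ideal_def additive_subgroup_def)
  then have "two_sided_ideal (\<Inter>M) ?F"
    by (auto simp: M_def two_sided_ideal_def left_ideal_def right_ideal_def)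
  then show ?thesis by (simp add: M_def algebra_ideal_generated_def)
qed

lemma lpa_relators_subset:
  fixes E :: "('v, 'e) pre_digraph"
  assumes "wf_digraph E"
  shows "lpa_relators E \<subseteq> carrier (free_algebra (lpa_generators E) :: (_, 'k :: field) ncpoly ring)"
proof -
  interpret wf_digraph E by fact
  let ?F = "free_algebra (lpa_generators E) :: (_, 'k :: field) ncpoly ring"
  interpret F: nonunital_ring ?F by (rule nonunital_ring_free_algebra)
  have g: "gen x \<in> carrier ?F" if "x \<in> lpa_generators E" for x
    using that by (auto simp: free_algebra_def zero_fword_def)
  have m: "p * q \<in> carrier ?F" if "p \<in> carrier ?F" "q \<in> carrier ?F" for p q
    using F.mult_closed[OF that] by (simp add: free_algebra_def)
  have d: "p - q \<in> carrier ?F" if "p \<in> carrier ?F" "q \<in> carrier ?F" for p q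
    using that keys_diff[of p q] by (auto simp: free_algebra_def)
  have s: "sum f A \<in> carrier ?F"
    if "\<And>x. x \<in> A \<Longrightarrow> f x \<in> carrier ?F" for A :: "'e set" and f
    using that
  proof (induction A rule: infinite_finite_induct)
    case (insert x A)
    have "f x \<in> carrier ?F" "sum f A \<in> carrier ?F"
      using insert.IH insert.prems by blast+
    then have "f x + sum f A \<in> carrier ?F"
      using F.a_closed[of "f x" "sum f A"] by (simp add: free_algebra_def)
    then show ?case
      using insert.hyps by simp
  qed (simp_all add: free_algebra_def)
  have vertex: "gen (Vertex v) \<in> carrier ?F" if "v \<in> verts E" for v
    using that by (intro g) (simp add: lpa_generators_def)
  have edge: "gen (Edge e) \<in> carrier ?F" "gen (Ghost e) \<in> carrier ?F" if "e \<in> arcs E" for e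
    using that by (intro g; simp add: lpa_generators_def)+
  show ?thesis
  proof
    fix p :: "(('v, 'e) lpa_generator, 'k) ncpoly"
    assume "p \<in> lpa_relators E"
    then show "p \<in> carrier ?F"
    proof cases
      case (vertex_sum v)
      show ?thesis
        unfolding vertex_sum(1)
        by (rule d[OF vertex s]) (use vertex_sum(2) in \<open>auto simp: regular_vertex_def intro: m edge\<close>)
    qed (simp_all add: m d vertex edge)
  qed
qed

lemma nonunital_ring_leavitt_path_algebra:
  assumes "wf_digraph E"
  shows "nonunital_ring (leavitt_path_algebra TYPE('k :: field) E)"
  unfolding leavitt_path_algebra_def presented_algebra_def
  by (intro nonunital_ring.nonunital_ring_quotient nonunital_ring_free_algebra
      two_sided_ideal_generated lpa_relators_subset assms)

end

theory Submission
  imports Defs "Graph_Theory.Arc_Walk" "HOL-Library.Sublist"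
    "HOL-Computational_Algebra.Formal_Power_Series"
begin

text \<open>
  Both sides of the equivalence say that \<open>E\<close> satisfies Condition (K): no vertex is the base of
  exactly one closed walk that returns to the vertex only at its end (a \<open>first return\<close>).

  Suppose Condition (K). Call \<open>v - (\<Sum>e \<in> F. e e\<^sup>*)\<close>, for a finite set \<open>F\<close> of edges leaving
  \<open>v\<close>, a gap projection; \<open>F = {}\<close> gives the vertices. The core is \<open>reduction_to_gap\<close>: for every
  two-sided ideal \<open>J\<close>, graded or not, and every \<open>a \<notin> J\<close>, some \<open>x a y\<close> is congruent modulo \<open>J\<close> to a
  gap projection outside \<open>J\<close>. One multiplies \<open>a\<close> on the right by edges until its ghost edges are
  used up, or until all edges annihilate it modulo \<open>J\<close>. In the first case \<open>a\<close> has become a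
  combination of paths, after a left multiplication \<open>v\<close> plus a combination of closed walks at
  \<open>v\<close>; by Condition (K) there is a closed walk \<open>q\<close> at \<open>v\<close> that is not a beginning of \<open>p q\<close> for
  any of these closed walks \<open>p\<close>, and \<open>q\<^sup>* a q = v\<close>. In the second case \<open>a\<close> is congruent to a
  combination of paths times a gap projection, and a smaller gap projection removes all paths but
  the leading one.

  A nonzero idempotent of the form \<open>x a y\<close> yields a nonzero idempotent \<open>a b\<close>, so all quotients are
  Zorn rings. Applying the reduction to the ideal generated by the gap projections in \<open>J\<close> shows that
  they generate \<open>J\<close>. Then \<open>J\<close> is spanned by the elements \<open>p g q\<^sup>*\<close> with \<open>p\<close>, \<open>q\<close> paths and \<open>g\<close> a gap
  projection in \<open>J\<close>; the idempotents \<open>p g p\<^sup>*\<close> commute, so finitely many of them have a common unit in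
  \<open>J\<close>, and every \<open>a \<in> J\<close> satisfies \<open>a j = a = j a\<close> for some \<open>j \<in> J\<close> (\<open>ideal_locally_unital\<close>). This
  gives \<open>I\<^sup>2 = I\<close> for one-sided ideals \<open>I\<close>.

  Conversely, let \<open>c\<close> be the only first return at \<open>v\<close>. The walks to \<open>v\<close> that avoid \<open>v\<close> before their
  end carry a representation over \<open>K[[X]]\<close> in which \<open>v\<close> is the projection onto the coordinate of
  the empty walk and \<open>c\<close> is \<open>1 + X\<close> times this projection. So \<open>v - c\<close> acts on a line as \<open>- X\<close>,
  neither zero nor a unit in a domain. Hence \<open>v - c\<close> does not act as a nilpotent operator, and no
  \<open>(v - c) b\<close> acts as a nonzero idempotent: the image of the algebra, a quotient, is not a Zorn ring.
  Moreover \<open>v - c\<close> is not in the square of the right ideal that it generates, because the elements of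
  that square have multiples of \<open>X\<^sup>2\<close> as their coefficients on this line.
\<close>

section \<open>Embedding ring records into a type of class ring\<close>

lemma nonunital_ring_closed:
  fixes R (structure)
  assumes "nonunital_ring R"
  shows "\<zero>\<^bsub>R\<^esub> \<in> carrier R"
    and "\<lbrakk>x \<in> carrier R; y \<in> carrier R\<rbrakk> \<Longrightarrow> x \<oplus>\<^bsub>R\<^esub> y \<in> carrier R"
    and "x \<in> carrier R \<Longrightarrow> \<ominus>\<^bsub>R\<^esub> x \<in> carrier R"
    and "\<lbrakk>x \<in> carrier R; y \<in> carrier R\<rbrakk> \<Longrightarrow> x \<otimes>\<^bsub>R\<^esub> y \<in> carrier R"
    and "\<zero>\<^bsub>R\<^esub> \<oplus>\<^bsub>R\<^esub> \<zero>\<^bsub>R\<^esub> = \<zero>\<^bsub>R\<^esub>"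
    and "\<zero>\<^bsub>R\<^esub> \<otimes>\<^bsub>R\<^esub> \<zero>\<^bsub>R\<^esub> = \<zero>\<^bsub>R\<^esub>"
proof -
  interpret nonunital_ring R by fact
  show "\<zero> \<in> carrier R" "\<lbrakk>x \<in> carrier R; y \<in> carrier R\<rbrakk> \<Longrightarrow> x \<oplus> y \<in> carrier R"
    "x \<in> carrier R \<Longrightarrow> \<ominus> x \<in> carrier R" "\<zero> \<oplus> \<zero> = \<zero>"
    "\<lbrakk>x \<in> carrier R; y \<in> carrier R\<rbrakk> \<Longrightarrow> x \<otimes> y \<in> carrier R"
    by (simp_all add: mult_closed)
  have "\<zero> \<otimes> \<zero> \<oplus> \<zero> \<otimes> \<zero> = \<zero> \<otimes> \<zero> \<oplus> \<zero>"
    by (simp add: l_distrib[symmetric] mult_closed)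
  then show "\<zero> \<otimes> \<zero> = \<zero>" by (simp add: mult_closed)
qed

lemma nonunital_ring_laws:
  fixes R (structure)
  assumes "nonunital_ring R" "x \<in> carrier R"
  shows "\<lbrakk>y \<in> carrier R; z \<in> carrier R\<rbrakk> \<Longrightarrow> (x \<oplus>\<^bsub>R\<^esub> y) \<oplus>\<^bsub>R\<^esub> z = x \<oplus>\<^bsub>R\<^esub> (y \<oplus>\<^bsub>R\<^esub> z)"
    and "y \<in> carrier R \<Longrightarrow> x \<oplus>\<^bsub>R\<^esub> y = y \<oplus>\<^bsub>R\<^esub> x"
    and "\<zero>\<^bsub>R\<^esub> \<oplus>\<^bsub>R\<^esub> x = x"
    and "\<ominus>\<^bsub>R\<^esub> x \<oplus>\<^bsub>R\<^esub> x = \<zero>\<^bsub>R\<^esub>"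
    and "\<lbrakk>y \<in> carrier R; z \<in> carrier R\<rbrakk> \<Longrightarrow> (x \<otimes>\<^bsub>R\<^esub> y) \<otimes>\<^bsub>R\<^esub> z = x \<otimes>\<^bsub>R\<^esub> (y \<otimes>\<^bsub>R\<^esub> z)"
    and "\<lbrakk>y \<in> carrier R; z \<in> carrier R\<rbrakk> \<Longrightarrow> (x \<oplus>\<^bsub>R\<^esub> y) \<otimes>\<^bsub>R\<^esub> z = x \<otimes>\<^bsub>R\<^esub> z \<oplus>\<^bsub>R\<^esub> y \<otimes>\<^bsub>R\<^esub> z"
    and "\<lbrakk>y \<in> carrier R; z \<in> carrier R\<rbrakk> \<Longrightarrow> x \<otimes>\<^bsub>R\<^esub> (y \<oplus>\<^bsub>R\<^esub> z) = x \<otimes>\<^bsub>R\<^esub> y \<oplus>\<^bsub>R\<^esub> x \<otimes>\<^bsub>R\<^esub> z"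
proof -
  interpret nonunital_ring R by fact
  show "\<lbrakk>y \<in> carrier R; z \<in> carrier R\<rbrakk> \<Longrightarrow> (x \<oplus> y) \<oplus> z = x \<oplus> (y \<oplus> z)"
    "y \<in> carrier R \<Longrightarrow> x \<oplus> y = y \<oplus> x"
    "\<zero> \<oplus> x = x" "\<ominus> x \<oplus> x = \<zero>"
    "\<lbrakk>y \<in> carrier R; z \<in> carrier R\<rbrakk> \<Longrightarrow> (x \<otimes> y) \<otimes> z = x \<otimes> (y \<otimes> z)"
    "\<lbrakk>y \<in> carrier R; z \<in> carrier R\<rbrakk> \<Longrightarrow> (x \<oplus> y) \<otimes> z = x \<otimes> z \<oplus> y \<otimes> z"
    "\<lbrakk>y \<in> carrier R; z \<in> carrier R\<rbrakk> \<Longrightarrow> x \<otimes> (y \<oplus> z) = x \<otimes> y \<oplus> x \<otimes> z"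
    using \<open>x \<in> carrier R\<close> by (simp_all add: a_ac l_neg r_neg mult_assoc l_distrib r_distrib)
qed

text \<open>
  The product of all rings without identity that are given by records over \<open>'r\<close>. As a fixed type
  it is an instance of the class \<open>ring\<close>, and each of its factors embeds into it. This makes the
  carrier-free calculus of the type class available for computations in an algebra that depends on
  a graph. Outside the rings, the functions are pinned to \<open>undefined\<close> to make them unique.
\<close>
typedef 'r ring_product =
  "{f :: 'r ring \<Rightarrow> 'r. \<forall>R. if nonunital_ring R then f R \<in> carrier R else f R = undefined}"
  by (rule exI[of _ "\<lambda>R. if nonunital_ring R then \<zero>\<^bsub>R\<^esub> else undefined"])
    (simp add: nonunital_ring_closed)

setup_lifting type_definition_ring_product

instantiation ring_product :: (type) ring
begin

lift_definition zero_ring_product :: "'a ring_product"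
  is "\<lambda>R. if nonunital_ring R then \<zero>\<^bsub>R\<^esub> else undefined"
  by (simp add: nonunital_ring_closed)

lift_definition plus_ring_product :: "'a ring_product \<Rightarrow> 'a ring_product \<Rightarrow> 'a ring_product"
  is "\<lambda>f g R. if nonunital_ring R then f R \<oplus>\<^bsub>R\<^esub> g R else undefined"
  by (simp add: nonunital_ring_closed)

lift_definition uminus_ring_product :: "'a ring_product \<Rightarrow> 'a ring_product"
  is "\<lambda>f R. if nonunital_ring R then \<ominus>\<^bsub>R\<^esub> f R else undefined"
  by (simp add: nonunital_ring_closed)

lift_definition minus_ring_product :: "'a ring_product \<Rightarrow> 'a ring_product \<Rightarrow> 'a ring_product"
  is "\<lambda>f g R. if nonunital_ring R then f R \<oplus>\<^bsub>R\<^esub> \<ominus>\<^bsub>R\<^esub> g R else undefined"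
  by (simp add: nonunital_ring_closed)

lift_definition times_ring_product :: "'a ring_product \<Rightarrow> 'a ring_product \<Rightarrow> 'a ring_product"
  is "\<lambda>f g R. if nonunital_ring R then f R \<otimes>\<^bsub>R\<^esub> g R else undefined"
  by (simp add: nonunital_ring_closed)

instance
proof
  fix a b c :: "'a ring_product"
  show "a + b + c = a + (b + c)"
    by transfer (simp add: fun_eq_iff nonunital_ring_laws)
  show "a + b = b + a"
    by transfer (simp add: fun_eq_iff nonunital_ring_laws)
  show "0 + a = a"
  proof transfer
    fix f :: "'a ring \<Rightarrow> 'a"
    assume "\<forall>R. if nonunital_ring R then f R \<in> carrier R else f R = undefined"
    then show "(\<lambda>R. if nonunital_ring R
        then (if nonunital_ring R then \<zero>\<^bsub>R\<^esub> else undefined) \<oplus>\<^bsub>R\<^esub> f R else undefined) = f"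
      by (auto simp: fun_eq_iff nonunital_ring_laws)
  qed
  show "- a + a = 0"
    by transfer (simp add: fun_eq_iff nonunital_ring_laws)
  show "a - b = a + - b"
    by transfer (simp add: fun_eq_iff)
  show "a * b * c = a * (b * c)"
    by transfer (simp add: fun_eq_iff nonunital_ring_laws)
  show "(a + b) * c = a * c + b * c"
    by transfer (simp add: fun_eq_iff nonunital_ring_laws)
  show "a * (b + c) = a * b + a * c"
    by transfer (simp add: fun_eq_iff nonunital_ring_laws)
qed

end

lift_definition into_product :: "'r ring \<Rightarrow> 'r \<Rightarrow> 'r ring_product"
  is "\<lambda>R x R'. if nonunital_ring R' then if R' = R \<and> x \<in> carrier R then x else \<zero>\<^bsub>R'\<^esub>
    else undefined"
  by (simp add: nonunital_ring_closed)

context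
  fixes R :: "'r ring" assumes R: "nonunital_ring R"
begin

interpretation nonunital_ring R by (rule R)

lemma into_product_eq_iff:
  "\<lbrakk>x \<in> carrier R; y \<in> carrier R\<rbrakk> \<Longrightarrow> into_product R x = into_product R y \<longleftrightarrow> x = y"
  using R by transfer (auto simp: fun_eq_iff split: if_splits)

lemma into_product_zero: "into_product R \<zero>\<^bsub>R\<^esub> = 0"
  by transfer (auto simp: fun_eq_iff)

lemma into_product_add:
  assumes "x \<in> carrier R" "y \<in> carrier R"
  shows "into_product R (x \<oplus>\<^bsub>R\<^esub> y) = into_product R x + into_product R y"
proof (transfer fixing: R x y, rule ext, goal_cases)
  case (1 R')
  show ?case
    by (cases "R' = R")
      (use assms R nonunital_ring_closed(2)[OF R assms] nonunital_ring_closed(5,6)[of R'] in auto)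
qed

lemma into_product_mult:
  assumes "x \<in> carrier R" "y \<in> carrier R"
  shows "into_product R (x \<otimes>\<^bsub>R\<^esub> y) = into_product R x * into_product R y"
proof (transfer fixing: R x y, rule ext, goal_cases)
  case (1 R')
  show ?case
    by (cases "R' = R")
      (use assms R nonunital_ring_closed(4)[OF R assms] nonunital_ring_closed(5,6)[of R'] in auto)
qed

lemma into_product_minus:
  assumes "x \<in> carrier R" "y \<in> carrier R"
  shows "into_product R (x \<ominus>\<^bsub>R\<^esub> y) = into_product R x - into_product R y"
proof -
  have "into_product R ((x \<ominus>\<^bsub>R\<^esub> y) \<oplus>\<^bsub>R\<^esub> y) = into_product R (x \<ominus>\<^bsub>R\<^esub> y) + into_product R y"
    using assms by (simp add: into_product_add)
  moreover have "(x \<ominus>\<^bsub>R\<^esub> y) \<oplus>\<^bsub>R\<^esub> y = x"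
    using assms by (simp add: a_minus_def a_assoc l_neg)
  ultimately show ?thesis by simp
qed

end

section \<open>Additive spans and ideals in a subring\<close>

text \<open>
  Orthogonality is usually inherited through a local unit \<open>a\<close> of \<open>x\<close>.
\<close>
lemma annihilate_right: "\<lbrakk>x * a = x; a * b = 0\<rbrakk> \<Longrightarrow> x * b = (0 :: 'a :: ring)"
  by (metis mult.assoc mult_zero_right)

lemma annihilate_left: "\<lbrakk>a * x = x; b * a = 0\<rbrakk> \<Longrightarrow> b * x = (0 :: 'a :: ring)"
  by (metis mult.assoc mult_zero_left)

inductive_set additive_span :: "'a :: comm_monoid_add set \<Rightarrow> 'a set" for B where
  zero: "0 \<in> additive_span B"
| add: "\<lbrakk>b \<in> B; x \<in> additive_span B\<rbrakk> \<Longrightarrow> b + x \<in> additive_span B"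

lemma additive_span_base: "b \<in> B \<Longrightarrow> b \<in> additive_span B"
  using additive_span.add[OF _ additive_span.zero] by fastforce

lemma additive_span_plus:
  "\<lbrakk>x \<in> additive_span B; y \<in> additive_span B\<rbrakk> \<Longrightarrow> x + y \<in> additive_span B"
  by (induction rule: additive_span.induct) (auto simp: add.assoc intro: additive_span.add)

lemma additive_span_into:
  assumes "x \<in> additive_span B" "0 \<in> C" "\<And>x y. \<lbrakk>x \<in> C; y \<in> C\<rbrakk> \<Longrightarrow> x + y \<in> C" "B \<subseteq> C"
  shows "x \<in> C"
  using assms(1) by induction (use assms in auto)

lemma additive_span_map:
  assumes "x \<in> additive_span B" "f 0 = 0" "\<And>x y. f (x + y) = f x + f y"
    and "\<And>b. b \<in> B \<Longrightarrow> f b \<in> additive_span C"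
  shows "f x \<in> additive_span C"
  using assms(1)
  by induction (simp_all add: assms additive_span.zero additive_span_plus)

lemma additive_span_sum:
  "\<lbrakk>\<And>i. i \<in> I \<Longrightarrow> f i \<in> additive_span B\<rbrakk> \<Longrightarrow> sum f I \<in> additive_span B"
  by (induction I rule: infinite_finite_induct) (auto intro: additive_span.zero additive_span_plus)

text \<open>
  The algebra under study may be a proper subset \<open>A\<close> of its ambient type, so its ideals are ideals
  relative to \<open>A\<close>.
\<close>
definition ideal_in :: "'a :: ring set \<Rightarrow> 'a set \<Rightarrow> bool" where
  "ideal_in A J \<longleftrightarrow> J \<subseteq> A \<and> 0 \<in> J \<and> (\<forall>x \<in> J. \<forall>y \<in> J. x + y \<in> J) \<and> (\<forall>x \<in> J. - x \<in> J) \<and>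
    (\<forall>a \<in> A. \<forall>x \<in> J. a * x \<in> J \<and> x * a \<in> J)"

lemma ideal_inD:
  assumes "ideal_in A J"
  shows "J \<subseteq> A" "0 \<in> J" "\<And>x y. \<lbrakk>x \<in> J; y \<in> J\<rbrakk> \<Longrightarrow> x + y \<in> J"
    "\<And>x y. \<lbrakk>x \<in> J; y \<in> J\<rbrakk> \<Longrightarrow> x - y \<in> J"
    "\<And>a x. \<lbrakk>a \<in> A; x \<in> J\<rbrakk> \<Longrightarrow> a * x \<in> J" "\<And>a x. \<lbrakk>a \<in> A; x \<in> J\<rbrakk> \<Longrightarrow> x * a \<in> J"
  using assms unfolding ideal_in_def
  by (auto simp only: diff_conv_add_uminus)

lemma ideal_in_sum:
  "\<lbrakk>ideal_in A J; \<And>i. i \<in> I \<Longrightarrow> f i \<in> J\<rbrakk> \<Longrightarrow> sum f I \<in> J"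
  by (induction I rule: infinite_finite_induct) (auto intro: ideal_inD)

section \<open>First returns and Condition (K)\<close>

context wf_digraph
begin

definition first_return :: "'a \<Rightarrow> 'b list \<Rightarrow> bool" where
  "first_return v c \<longleftrightarrow> awalk v c v \<and> c \<noteq> [] \<and>
    (\<forall>b. strict_prefix b c \<and> b \<noteq> [] \<longrightarrow> \<not> awalk v b v)"

definition condition_K :: bool where
  "condition_K \<longleftrightarrow> (\<forall>v c. first_return v c \<longrightarrow> (\<exists>d. first_return v d \<and> d \<noteq> c))"

lemma awalk_appendE:
  assumes "awalk u (p @ q) w"
  obtains x where "awalk u p x" "awalk x q w"
  using assms by auto

lemma awalk_cancel: "\<lbrakk>awalk u p v; awalk u (p @ q) w\<rbrakk> \<Longrightarrow> awalk v q w"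
  by (metis awalk_append_iff awlast_of_awalk awalkE')

text \<open>
  The first returns at a vertex form a prefix code; this makes the factorization of closed walks
  into first returns unique.
\<close>
lemma first_return_prefix_eq:
  assumes "first_return v c" "first_return v d" "prefix c d" shows "c = d"
  using assms unfolding first_return_def by (metis strict_prefixI)

lemma first_return_exists:
  assumes "awalk v p v" "p \<noteq> []"
  obtains c where "first_return v c"
  using assms
proof (induction "length p" arbitrary: p thesis rule: less_induct)
  case less
  show ?case
  proof (cases "first_return v p")
    case True
    then show ?thesis using less.prems by blast
  next
    case False
    then obtain b where b: "strict_prefix b p" "b \<noteq> []" "awalk v b v"
      using less.prems by (auto simp: first_return_def)
    then show ?thesis
      using less.hyps[of b] less.prems(1) prefix_length_less by blast
  qed
qed

lemma closed_walk_in_power: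
  assumes c: "first_return v c" and p: "awalk v p v" "prefix p (concat (replicate n c))"
  shows "\<exists>j. p = concat (replicate j c)"
  using p
proof (induction n arbitrary: p)
  case 0
  then show ?case by (intro exI[of _ 0]) simp
next
  case (Suc n)
  then consider "prefix p c" | "prefix c p"
    by (metis concat.simps(2) prefixI prefix_same_cases replicate_Suc)
  then show ?case
  proof cases
    case 1
    then consider "p = []" | "p = c"
      using c Suc.prems(1) unfolding first_return_def by (metis strict_prefixI)
    then show ?thesis
      by cases (auto intro: exI[of _ "0 :: nat"] exI[of _ "1 :: nat"])
  next
    case 2
    then obtain q where q: "p = c @ q" by (auto elim: prefixE)
    have "awalk v q v"
      using awalk_cancel[of v c v q v] c Suc.prems(1) unfolding q first_return_def by blast
    moreover have "prefix q (concat (replicate n c))"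
      using Suc.prems(2) q by simp
    ultimately obtain j where "q = concat (replicate j c)" using Suc.IH by blast
    then show ?thesis using q by (intro exI[of _ "Suc j"]) simp
  qed
qed

lemma awalk_power: "awalk v c v \<Longrightarrow> awalk v (concat (replicate n c)) v"
  by (induction n) (auto simp: awalk_Nil_iff intro: awalk_appendI)

lemma power_append_commute:
  "concat (replicate m c) @ concat (replicate n c) = concat (replicate n c) @ concat (replicate m c)"
  by (metis add.commute concat_append replicate_add)

text \<open>
  With two first returns \<open>c\<close>, \<open>d\<close> take \<open>q = c\<^sup>N d\<close>, where \<open>N\<close> bounds the lengths in \<open>T\<close>. If \<open>q\<close> is
  a prefix of \<open>p q\<close>, then \<open>p\<close> is a prefix of \<open>c\<^sup>N\<close> and hence a power of \<open>c\<close>; cancelling \<open>c\<^sup>N\<close> shows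
  that \<open>c\<close> and \<open>d\<close> are comparable. In terms of the algebra, \<open>q\<^sup>* p q = 0\<close> for all \<open>p \<in> T\<close>.
\<close>
lemma aperiodic_closed_walk:
  assumes K: condition_K and v: "v \<in> verts G" and "finite T"
    and T: "\<And>p. p \<in> T \<Longrightarrow> awalk v p v \<and> p \<noteq> []"
  obtains q where "awalk v q v" "\<And>p. p \<in> T \<Longrightarrow> \<not> prefix q (p @ q)"
proof (cases "T = {}")
  case True
  then show ?thesis using that[of "[]"] v by (simp add: awalk_Nil_iff)
next
  case False
  then obtain c where c: "first_return v c" using T first_return_exists by blast
  obtain d where d: "first_return v d" "d \<noteq> c" using K c by (auto simp: condition_K_def)
  have cd: "\<not> prefix c d" "\<not> prefix d c"
    using first_return_prefix_eq c d by blast+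
  define N where "N = Max (length ` T)"
  have N: "length p \<le> N" if "p \<in> T" for p
    using \<open>finite T\<close> that by (simp add: N_def)
  let ?cN = "concat (replicate N c)"
  have len: "N \<le> length ?cN"
    using c by (induction N) (auto simp: first_return_def Suc_le_eq simp flip: length_greater_0_conv)
  show ?thesis
  proof (rule that[of "?cN @ d"])
    show "awalk v (?cN @ d) v"
      using c d awalk_power awalk_appendI by (metis first_return_def)
    show "\<not> prefix (?cN @ d) (p @ ?cN @ d)" if p: "p \<in> T" for p
    proof
      assume *: "prefix (?cN @ d) (p @ ?cN @ d)"
      then have "prefix ?cN (p @ ?cN @ d)" by (rule append_prefixD)
      then have "prefix p ?cN"
        using N[OF p] len by (meson le_trans prefixI prefix_length_prefix)
      then obtain j where j: "p = concat (replicate j c)"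
        using closed_walk_in_power c T[OF p] by blast
      with T[OF p] obtain i where i: "j = Suc i" by (cases j) auto
      have "p @ ?cN @ d = ?cN @ p @ d"
        using power_append_commute[of j c N] by (simp add: j flip: append_assoc)
      with * have "prefix d (p @ d)" by simp
      then have "prefix d (c @ concat (replicate i c) @ d)" by (simp add: j i)
      then show False using cd by (metis prefixI prefix_same_cases)
    qed
  qed
qed

end

section \<open>Paths, ghost paths and gap projections\<close>

text \<open>
  The relations of the Cohn path algebra of \<open>E\<close>, whose quotients include the Leavitt path algebra.
  Writing \<open>P v c\<close> for the scalar multiple \<open>c v\<close> records the action of the field inside the ring, so
  that all statements can be made about ideals of a ring.
\<close>
locale cohn_family = wf_digraph E for E :: "('v, 'e) pre_digraph" +
  fixes P :: "'v \<Rightarrow> 'k :: field \<Rightarrow> 'a :: ring" and s t :: "'e \<Rightarrow> 'a"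
  assumes P_add: "v \<in> verts E \<Longrightarrow> P v (c + d) = P v c + P v d"
    and P_mult: "v \<in> verts E \<Longrightarrow> P v c * P v d = P v (c * d)"
    and P_orth: "\<lbrakk>v \<in> verts E; w \<in> verts E; v \<noteq> w\<rbrakk> \<Longrightarrow> P v c * P w d = 0"
    and P_s: "e \<in> arcs E \<Longrightarrow> P (tail E e) c * s e = s e * P (head E e) c"
    and s_P1: "e \<in> arcs E \<Longrightarrow> s e * P (head E e) 1 = s e"
    and P_t: "e \<in> arcs E \<Longrightarrow> P (head E e) c * t e = t e * P (tail E e) c"
    and P1_t: "e \<in> arcs E \<Longrightarrow> P (head E e) 1 * t e = t e"
    and t_s: "e \<in> arcs E \<Longrightarrow> t e * s e = P (head E e) 1"
    and t_s_ne: "\<lbrakk>e \<in> arcs E; f \<in> arcs E; e \<noteq> f\<rbrakk> \<Longrightarrow> t e * s f = 0"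
begin

lemma P_zero: "v \<in> verts E \<Longrightarrow> P v 0 = 0"
  using P_add[of v 0 0] by simp

lemma P_uminus: "v \<in> verts E \<Longrightarrow> P v (- c) = - P v c"
  using P_add[of v "- c" c] by (simp add: P_zero eq_neg_iff_add_eq_0)

lemma s_orth:
  assumes "e \<in> arcs E" "v \<in> verts E"
  shows "v \<noteq> head E e \<Longrightarrow> s e * P v c = 0" and "v \<noteq> head E e \<Longrightarrow> P v c * t e = 0"
    and "v \<noteq> tail E e \<Longrightarrow> P v c * s e = 0" and "v \<noteq> tail E e \<Longrightarrow> t e * P v c = 0"
proof -
  have h: "head E e \<in> verts E" "tail E e \<in> verts E" using assms by auto
  have s1: "P (tail E e) 1 * s e = s e" and t1: "t e * P (tail E e) 1 = t e"
    using assms P_s[of e 1] P_t[of e 1] s_P1 P1_t by simp_all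
  show "v \<noteq> head E e \<Longrightarrow> s e * P v c = 0"
    using assms h s_P1 P_orth by (intro annihilate_right[of "s e"]) auto
  show "v \<noteq> head E e \<Longrightarrow> P v c * t e = 0"
    using assms h P1_t P_orth by (intro annihilate_left[of _ "t e"]) auto
  show "v \<noteq> tail E e \<Longrightarrow> P v c * s e = 0"
    using assms h s1 P_orth by (intro annihilate_left[of _ "s e"]) auto
  show "v \<noteq> tail E e \<Longrightarrow> t e * P v c = 0"
    using assms h t1 P_orth by (intro annihilate_right[of "t e"]) auto
qed

text \<open>
  The starting vertex is an argument because the empty walk at \<open>v\<close> stands for the vertex \<open>v\<close>.
\<close>
primrec path_elem :: "'v \<Rightarrow> 'e list \<Rightarrow> 'a" where
  "path_elem v [] = P v 1"
| "path_elem v (e # p) = s e * path_elem (head E e) p"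

primrec ghost_elem :: "'v \<Rightarrow> 'e list \<Rightarrow> 'a" where
  "ghost_elem v [] = P v 1"
| "ghost_elem v (e # p) = ghost_elem (head E e) p * t e"

lemma P_path: "awalk u p w \<Longrightarrow> P u c * path_elem u p = path_elem u p * P w c"
proof (induction p arbitrary: u)
  case Nil
  then show ?case by (auto simp: awalk_Nil_iff P_mult)
next
  case (Cons e p)
  then have e: "e \<in> arcs E" "u = tail E e" "awalk (head E e) p w" by (auto simp: awalk_Cons_iff)
  have "P u c * path_elem u (e # p) = s e * (P (head E e) c * path_elem (head E e) p)"
    using P_s[OF e(1), of c] e(2) by (simp flip: mult.assoc)
  then show ?case using Cons.IH[OF e(3)] by (simp add: mult.assoc)
qed

lemma P1_path: "awalk u p w \<Longrightarrow> P u 1 * path_elem u p = path_elem u p"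
proof (induction p)
  case Nil then show ?case by (auto simp: awalk_Nil_iff P_mult)
next
  case (Cons e p)
  then have "e \<in> arcs E" "u = tail E e" by (auto simp: awalk_Cons_iff)
  then show ?case by (simp add: P_s s_P1 flip: mult.assoc)
qed

lemma path_P1: "awalk u p w \<Longrightarrow> path_elem u p * P w 1 = path_elem u p"
  using P_path[of u p w 1] P1_path by simp

lemma P_ghost: "awalk u p w \<Longrightarrow> P w c * ghost_elem u p = ghost_elem u p * P u c"
proof (induction p arbitrary: u)
  case Nil
  then show ?case by (auto simp: awalk_Nil_iff P_mult)
next
  case (Cons e p)
  then have e: "e \<in> arcs E" "u = tail E e" "awalk (head E e) p w" by (auto simp: awalk_Cons_iff)
  have "P w c * ghost_elem u (e # p) = ghost_elem (head E e) p * (P (head E e) c * t e)"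
    using Cons.IH[OF e(3)] by (simp flip: mult.assoc)
  then show ?case using P_t[OF e(1), of c] e(2) by (simp add: mult.assoc)
qed

lemma ghost_P1: "awalk u p w \<Longrightarrow> ghost_elem u p * P u 1 = ghost_elem u p"
proof (induction p)
  case Nil then show ?case by (auto simp: awalk_Nil_iff P_mult)
next
  case (Cons e p)
  then have "e \<in> arcs E" "u = tail E e" by (auto simp: awalk_Cons_iff)
  then show ?case using P_t[of e 1] P1_t[of e] by (simp add: mult.assoc)
qed

lemma P1_ghost: "awalk u p w \<Longrightarrow> P w 1 * ghost_elem u p = ghost_elem u p"
  using P_ghost[of u p w 1] ghost_P1 by simp

lemma P_path_orth: "\<lbrakk>awalk u p w; v \<in> verts E; v \<noteq> u\<rbrakk> \<Longrightarrow> P v c * path_elem u p = 0"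
  by (rule annihilate_left[OF P1_path P_orth]) auto

lemma ghost_P_orth: "\<lbrakk>awalk u p w; v \<in> verts E; v \<noteq> u\<rbrakk> \<Longrightarrow> ghost_elem u p * P v c = 0"
  by (rule annihilate_right[OF ghost_P1 P_orth]) auto

lemma path_append: "\<lbrakk>awalk u p w; awalk w q x\<rbrakk>
    \<Longrightarrow> path_elem u (p @ q) = path_elem u p * path_elem w q"
  by (induction p arbitrary: u) (auto simp: awalk_simps P1_path mult.assoc)

lemma ghost_append: "\<lbrakk>awalk u p w; awalk w q x\<rbrakk>
    \<Longrightarrow> ghost_elem u (p @ q) = ghost_elem w q * ghost_elem u p"
  by (induction p arbitrary: u) (auto simp: awalk_simps ghost_P1 mult.assoc)

lemma ghost_path_same: "awalk u p w \<Longrightarrow> ghost_elem u p * path_elem u p = P w 1"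
proof (induction p arbitrary: u)
  case Nil
  then show ?case by (auto simp: awalk_Nil_iff P_mult)
next
  case (Cons e p)
  then have e: "e \<in> arcs E" "awalk (head E e) p w" by (auto simp: awalk_Cons_iff)
  have "ghost_elem u (e # p) * path_elem u (e # p) =
      ghost_elem (head E e) p * ((t e * s e) * path_elem (head E e) p)"
    by (simp add: mult.assoc)
  then show ?case using Cons.IH[OF e(2)] e t_s P1_path by simp
qed

lemma ghost_path_longer:
  "\<lbrakk>awalk u p w; awalk w q x\<rbrakk> \<Longrightarrow> ghost_elem u p * path_elem u (p @ q) = path_elem w q"
  using ghost_path_same[of u p w] P1_path[of w q x]
  by (simp add: path_append flip: mult.assoc)

lemma ghost_longer_path:
  "\<lbrakk>awalk u p w; awalk w q x\<rbrakk> \<Longrightarrow> ghost_elem u (p @ q) * path_elem u p = ghost_elem w q"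
  using ghost_path_same[of u p w] ghost_P1[of w q x]
  by (simp add: ghost_append mult.assoc)

text \<open>
  At the first place where the walks differ, a product \<open>e\<^sup>* f\<close> of distinct edges occurs.
\<close>
lemma ghost_path_incomparable:
  "\<lbrakk>awalk u p w; awalk u q x; \<not> prefix p q; \<not> prefix q p\<rbrakk> \<Longrightarrow> ghost_elem u p * path_elem u q = 0"
proof (induction p arbitrary: u q)
  case (Cons e p)
  then obtain f q' where q: "q = f # q'" by (cases q) auto
  have e: "e \<in> arcs E" "f \<in> arcs E" "awalk (head E e) p w" "awalk (head E f) q' x"
    using Cons.prems q by (auto simp: awalk_Cons_iff)
  have *: "ghost_elem u (e # p) * path_elem u q =
      ghost_elem (head E e) p * ((t e * s f) * path_elem (head E f) q')"
    by (simp add: mult.assoc q)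
  show ?case
  proof (cases "e = f")
    case True
    then show ?thesis
      using * Cons.IH[of "head E e" q'] Cons.prems(3,4) q e
      by (simp add: t_s P1_path[OF e(4)])
  next
    case False
    then show ?thesis using * t_s_ne e by simp
  qed
qed simp

lemma ghost_path_orth: "\<lbrakk>awalk u p w; awalk v q x; u \<noteq> v\<rbrakk> \<Longrightarrow> ghost_elem u p * path_elem v q = 0"
  by (rule annihilate_left[OF P1_path ghost_P_orth]) auto

definition gap :: "'v \<Rightarrow> 'e set \<Rightarrow> 'a" where
  "gap v F = P v 1 - (\<Sum>e \<in> F. s e * t e)"

text \<open>
  The pairs for which \<open>gap\<close> is a projection below \<open>v\<close>. In a Leavitt path algebra, the
  gap at the set of all edges leaving a regular vertex is zero.
\<close>
definition gap_index :: "('v \<times> 'e set) set" where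
  "gap_index = {(v, F). v \<in> verts E \<and> finite F \<and> F \<subseteq> out_arcs E v}"

lemma gap_indexD:
  assumes "(v, F) \<in> gap_index"
  shows "v \<in> verts E" "finite F" "\<And>e. e \<in> F \<Longrightarrow> e \<in> arcs E" "\<And>e. e \<in> F \<Longrightarrow> tail E e = v"
  using assms by (auto simp: gap_index_def)

lemma gap_empty: "gap v {} = P v 1"
  by (simp add: gap_def)

lemma gap_s:
  assumes "(v, F) \<in> gap_index" "e \<in> arcs E" "tail E e = v"
  shows "gap v F * s e = (if e \<in> F then 0 else s e)"
proof -
  have "(\<Sum>f \<in> F. s f * t f) * s e = (\<Sum>f \<in> F. if f = e then s e else 0)"
    unfolding sum_distrib_right using assms gap_indexD[OF assms(1)]
    by (intro sum.cong) (auto simp: mult.assoc t_s s_P1 t_s_ne)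
  then show ?thesis
    using assms gap_indexD[OF assms(1)] P_s[of e 1] s_P1[of e] by (simp add: gap_def left_diff_distrib)
qed

lemma t_gap:
  assumes "(v, F) \<in> gap_index" "e \<in> arcs E" "tail E e = v"
  shows "t e * gap v F = (if e \<in> F then 0 else t e)"
proof -
  have "t e * (\<Sum>f \<in> F. s f * t f) = (\<Sum>f \<in> F. if f = e then t e else 0)"
    unfolding sum_distrib_left using assms gap_indexD[OF assms(1)]
    by (intro sum.cong) (auto simp: t_s P1_t t_s_ne simp flip: mult.assoc)
  then show ?thesis
    using assms gap_indexD[OF assms(1)] P_t[of e 1] P1_t[of e] by (simp add: gap_def right_diff_distrib)
qed

lemma P_gap:
  assumes "(v, F) \<in> gap_index"
  shows "P v c * gap v F = gap v F * P v c"
proof -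
  have "P v c * (s e * t e) = (s e * t e) * P v c" if "e \<in> F" for e
  proof -
    have e: "e \<in> arcs E" "tail E e = v" using that gap_indexD[OF assms] by auto
    have "P v c * (s e * t e) = s e * (P (head E e) c * t e)"
      using P_s[OF e(1), of c] e(2) by (simp flip: mult.assoc)
    then show ?thesis using P_t[OF e(1), of c] e(2) by (simp add: mult.assoc)
  qed
  then show ?thesis
    using gap_indexD[OF assms]
    by (simp add: gap_def left_diff_distrib right_diff_distrib P_mult sum_distrib_left sum_distrib_right)
qed

lemma gap_P1:
  assumes "(v, F) \<in> gap_index"
  shows "gap v F * P v 1 = gap v F"
proof -
  have "t e * P v 1 = t e" if "e \<in> F" for e
    using that gap_indexD[OF assms] P_t[of e 1] P1_t[of e] by auto
  then show ?thesis
    using gap_indexD[OF assms] by (simp add: gap_def left_diff_distrib P_mult sum_distrib_right mult.assoc)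
qed

lemma P1_gap: "(v, F) \<in> gap_index \<Longrightarrow> P v 1 * gap v F = gap v F"
  using P_gap gap_P1 by simp

lemma gap_mult_subset:
  assumes "(v, F) \<in> gap_index" "(v, F') \<in> gap_index" "F \<subseteq> F'"
  shows "gap v F' * gap v F = gap v F'"
proof -
  have "gap v F' * (s e * t e) = 0" if "e \<in> F" for e
    using that assms gap_s[OF assms(2), of e] gap_indexD[OF assms(1)] by (auto simp flip: mult.assoc)
  then show ?thesis
    by (simp add: gap_def[of v F] right_diff_distrib sum_distrib_left gap_P1[OF assms(2)])
qed

lemma gap_idem: "(v, F) \<in> gap_index \<Longrightarrow> gap v F * gap v F = gap v F"
  by (rule gap_mult_subset) auto

end

context cohn_family begin

section \<open>Spans of sandwiched gap projections\<close>

definition sandwiches :: "('v \<times> 'e set) set \<Rightarrow> 'a set" where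
  "sandwiches \<Gamma> = {path_elem u p * P w c * gap w F * ghost_elem v q | u p w c F v q.
    awalk u p w \<and> awalk v q w \<and> (w, F) \<in> \<Gamma>}"

abbreviation sandwich_span :: "('v \<times> 'e set) set \<Rightarrow> 'a set" where
  "sandwich_span \<Gamma> \<equiv> additive_span (sandwiches \<Gamma>)"

text \<open>
  What is needed for \<open>sandwich_span \<Gamma>\<close> to be an ideal: for an edge \<open>e\<close> not in \<open>F\<close>, the product
  \<open>e\<^sup>* (gap w F) e\<close> is the vertex \<open>head E e\<close>, whose index must then be in \<open>\<Gamma>\<close> as well.
\<close>
definition hereditary :: "('v \<times> 'e set) set \<Rightarrow> bool" where
  "hereditary \<Gamma> \<longleftrightarrow> \<Gamma> \<subseteq> gap_index \<and>
    (\<forall>w F e. (w, F) \<in> \<Gamma> \<and> e \<in> out_arcs E w - F \<longrightarrow> (head E e, {}) \<in> \<Gamma>)"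

text \<open>
  Every element of the algebra is a combination of products of a path and a ghost path.
\<close>
definition algebra :: "'a set" where
  "algebra = sandwich_span ((\<lambda>w. (w, {})) ` verts E)"

lemma hereditary_vertices: "hereditary ((\<lambda>w. (w, {})) ` verts E)"
  by (auto simp: hereditary_def gap_index_def)

lemma sandwichI: "\<lbrakk>awalk u p w; awalk v q w; (w, F) \<in> \<Gamma>\<rbrakk>
    \<Longrightarrow> path_elem u p * P w c * gap w F * ghost_elem v q \<in> sandwich_span \<Gamma>"
  by (rule additive_span_base, unfold sandwiches_def) blast

lemma sandwichE:
  assumes "x \<in> sandwiches \<Gamma>"
  obtains u p w c F v q where "x = path_elem u p * P w c * gap w F * ghost_elem v q"
    and "awalk u p w" "awalk v q w" "(w, F) \<in> \<Gamma>"
  using assms unfolding sandwiches_def by blast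

lemma P_mult': "w \<in> verts E \<Longrightarrow> x * P w c * P w d = x * P w (c * d)"
  by (simp add: mult.assoc P_mult)

text \<open>
  Unless the product is zero, an edge lengthens the path \<open>p\<close> and a ghost edge \<open>e\<^sup>*\<close> shortens it.
  For empty \<open>p\<close> the ghost edge meets the gap projection; it is annihilated if \<open>e \<in> F\<close>, and otherwise passes through and becomes part
  of the ghost path, with the vertex \<open>head E e\<close> as the new middle factor.
\<close>
lemma sandwich_generator_left:
  assumes \<Gamma>: "hereditary \<Gamma>" and x: "x \<in> sandwiches \<Gamma>"
  shows "y \<in> verts E \<Longrightarrow> P y a * x \<in> sandwich_span \<Gamma>"
    and "e \<in> arcs E \<Longrightarrow> s e * x \<in> sandwich_span \<Gamma>"
    and "e \<in> arcs E \<Longrightarrow> t e * x \<in> sandwich_span \<Gamma>"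
proof -
  obtain u p w c F v q where x: "x = path_elem u p * P w c * gap w F * ghost_elem v q"
    and pq: "awalk u p w" "awalk v q w" and wF: "(w, F) \<in> \<Gamma>"
    using x by (rule sandwichE)
  have w: "w \<in> verts E" "u \<in> verts E" using pq by auto
  have idx: "(w, F) \<in> gap_index" using \<Gamma> wF by (auto simp: hereditary_def)
  show "P y a * x \<in> sandwich_span \<Gamma>" if y: "y \<in> verts E"
  proof (cases "y = u")
    case True
    have "P u a * x = path_elem u p * P w a * P w c * gap w F * ghost_elem v q"
      using P_path[OF pq(1), of a] by (simp add: x flip: mult.assoc)
    then show ?thesis using True sandwichI[OF pq wF, of "a * c"] by (simp add: P_mult' w)
  next
    case False
    then have "P y a * x = 0"
      using P_path_orth[OF pq(1) y False, of a] by (simp add: x flip: mult.assoc)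
    then show ?thesis by (simp add: additive_span.zero)
  qed
  show "s e * x \<in> sandwich_span \<Gamma>" if e: "e \<in> arcs E"
  proof (cases "head E e = u")
    case True
    then have "awalk (tail E e) (e # p) w" using pq e by (simp add: awalk_Cons_iff)
    from sandwichI[OF this pq(2) wF, of c] show ?thesis
      using True by (simp add: x flip: mult.assoc)
  next
    case False
    then have "s e * path_elem u p = 0"
      using e w by (intro annihilate_left[OF P1_path[OF pq(1)]] s_orth) auto
    then have "s e * x = 0" by (simp add: x flip: mult.assoc)
    then show ?thesis by (simp add: additive_span.zero)
  qed
  show "t e * x \<in> sandwich_span \<Gamma>" if e: "e \<in> arcs E"
  proof (cases p)
    case Nil
    then have u: "u = w" using pq by (simp add: awalk_Nil_iff)
    have x': "t e * x = t e * P w c * gap w F * ghost_elem v q"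
      using w by (simp add: x Nil u P_mult flip: mult.assoc)
    show ?thesis
    proof (cases "tail E e = w")
      case True
      have "t e * P w c * gap w F = P (head E e) c * (t e * gap w F)"
        using P_t[OF e, of c] True by (simp flip: mult.assoc)
      then have eq: "t e * x = (if e \<in> F then 0 else P (head E e) c * t e * ghost_elem v q)"
        using t_gap[OF idx e True] by (simp add: x')
      have qe: "awalk (head E e) [] (head E e)" "awalk w [e] (head E e)"
        using e True by (auto simp: awalk_simps)
      show ?thesis
      proof (cases "e \<in> F")
        case True
        then show ?thesis by (simp add: eq additive_span.zero)
      next
        case False
        then have "(head E e, {}) \<in> \<Gamma>"
          using \<Gamma> wF e True by (auto simp: hereditary_def out_arcs_def)
        from sandwichI[OF qe(1) awalk_appendI[OF pq(2) qe(2)] this, of c]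
        show ?thesis
          using False e P1_t[OF e]
          by (simp add: eq ghost_append[OF pq(2) qe(2)] gap_empty P_mult P_mult' flip: mult.assoc)
      qed
    next
      case False
      then have "t e * x = 0" using s_orth(4)[OF e w(1)] by (simp add: x')
      then show ?thesis by (simp add: additive_span.zero)
    qed
  next
    case (Cons f p')
    then have f: "f \<in> arcs E" "awalk (head E f) p' w" using pq by (auto simp: awalk_Cons_iff)
    have eq: "t e * x = (t e * s f) * path_elem (head E f) p' * P w c * gap w F * ghost_elem v q"
      by (simp add: x Cons mult.assoc)
    show ?thesis
    proof (cases "e = f")
      case True
      then have "t e * x = path_elem (head E f) p' * P w c * gap w F * ghost_elem v q"
        using f eq by (simp add: t_s P1_path[OF f(2)])
      then show ?thesis
        using sandwichI[OF f(2) pq(2) wF, of c] by simp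
    next
      case False
      then show ?thesis using e f by (simp add: eq t_s_ne additive_span.zero)
    qed
  qed
qed

text \<open>
  The mirror image of the previous lemma.
\<close>
lemma sandwich_generator_right:
  assumes \<Gamma>: "hereditary \<Gamma>" and x: "x \<in> sandwiches \<Gamma>"
  shows "y \<in> verts E \<Longrightarrow> x * P y a \<in> sandwich_span \<Gamma>"
    and "e \<in> arcs E \<Longrightarrow> x * s e \<in> sandwich_span \<Gamma>"
    and "e \<in> arcs E \<Longrightarrow> x * t e \<in> sandwich_span \<Gamma>"
proof -
  obtain u p w c F v q where x: "x = path_elem u p * P w c * gap w F * ghost_elem v q"
    and pq: "awalk u p w" "awalk v q w" and wF: "(w, F) \<in> \<Gamma>"
    using x by (rule sandwichE)
  have w: "w \<in> verts E" "v \<in> verts E" using pq by auto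
  have idx: "(w, F) \<in> gap_index" using \<Gamma> wF by (auto simp: hereditary_def)
  show "x * P y a \<in> sandwich_span \<Gamma>" if y: "y \<in> verts E"
  proof (cases "y = v")
    case True
    have "x * P v a = path_elem u p * P w c * (gap w F * P w a) * ghost_elem v q"
      using P_ghost[OF pq(2), of a] by (simp add: x mult.assoc)
    also have "\<dots> = path_elem u p * P w (c * a) * gap w F * ghost_elem v q"
      by (simp add: P_gap[OF idx, of a, symmetric] P_mult' w flip: mult.assoc)
    finally show ?thesis using True sandwichI[OF pq wF, of "c * a"] by simp
  next
    case False
    then have "x * P y a = 0"
      using ghost_P_orth[OF pq(2) y False, of a] by (simp add: x mult.assoc)
    then show ?thesis by (simp add: additive_span.zero)
  qed
  show "x * t e \<in> sandwich_span \<Gamma>" if e: "e \<in> arcs E"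
  proof (cases "head E e = v")
    case True
    then have "awalk (tail E e) (e # q) w" using pq e by (simp add: awalk_Cons_iff)
    from sandwichI[OF pq(1) this wF, of c] show ?thesis
      using True by (simp add: x mult.assoc)
  next
    case False
    then have "ghost_elem v q * t e = 0"
      using e w by (intro annihilate_right[OF ghost_P1[OF pq(2)]] s_orth) auto
    then have "x * t e = 0" by (simp add: x mult.assoc)
    then show ?thesis by (simp add: additive_span.zero)
  qed
  show "x * s e \<in> sandwich_span \<Gamma>" if e: "e \<in> arcs E"
  proof (cases q)
    case Nil
    then have v: "v = w" using pq by (simp add: awalk_Nil_iff)
    have x': "x * s e = path_elem u p * P w c * (gap w F * s e)"
      by (simp add: x Nil v mult.assoc) (simp add: gap_P1[OF idx] flip: mult.assoc)
    show ?thesis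
    proof (cases "tail E e = w")
      case True
      have qe: "awalk (head E e) [] (head E e)" "awalk w [e] (head E e)"
        using e True by (auto simp: awalk_simps)
      have eq: "x * s e = (if e \<in> F then 0 else path_elem u p * s e * P (head E e) c)"
        using gap_s[OF idx e True] P_s[OF e, of c] True by (simp add: x' mult.assoc)
      show ?thesis
      proof (cases "e \<in> F")
        case True
        then show ?thesis by (simp add: eq additive_span.zero)
      next
        case False
        then have "(head E e, {}) \<in> \<Gamma>"
          using \<Gamma> wF e True by (auto simp: hereditary_def out_arcs_def)
        from sandwichI[OF awalk_appendI[OF pq(1) qe(2)] qe(1) this, of c]
        show ?thesis
          using False e s_P1[OF e]
          by (simp add: eq path_append[OF pq(1) qe(2)] gap_empty P_mult P_mult' mult.assoc)
      qed
    next
      case False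
      then have "gap w F * s e = 0"
        using e w by (intro annihilate_right[OF gap_P1[OF idx]] s_orth) auto
      then show ?thesis by (simp add: x' additive_span.zero)
    qed
  next
    case (Cons f q')
    then have f: "f \<in> arcs E" "awalk (head E f) q' w" using pq by (auto simp: awalk_Cons_iff)
    have eq: "x * s e = path_elem u p * P w c * gap w F * (ghost_elem (head E f) q' * (t f * s e))"
      by (simp add: x Cons mult.assoc)
    show ?thesis
    proof (cases "e = f")
      case True
      then have "x * s e = path_elem u p * P w c * gap w F * ghost_elem (head E f) q'"
        using f eq by (simp add: t_s ghost_P1[OF f(2)])
      then show ?thesis
        using sandwichI[OF pq(1) f(2) wF, of c] by simp
    next
      case False
      then show ?thesis using e f by (simp add: eq t_s_ne additive_span.zero)
    qed
  qed
qed

lemma span_generator: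
  assumes "hereditary \<Gamma>" "x \<in> sandwich_span \<Gamma>"
  shows "y \<in> verts E \<Longrightarrow> P y a * x \<in> sandwich_span \<Gamma>" "y \<in> verts E \<Longrightarrow> x * P y a \<in> sandwich_span \<Gamma>"
    and "e \<in> arcs E \<Longrightarrow> s e * x \<in> sandwich_span \<Gamma>" "e \<in> arcs E \<Longrightarrow> x * s e \<in> sandwich_span \<Gamma>"
    and "e \<in> arcs E \<Longrightarrow> t e * x \<in> sandwich_span \<Gamma>" "e \<in> arcs E \<Longrightarrow> x * t e \<in> sandwich_span \<Gamma>"
  by (rule additive_span_map[OF assms(2), where f = "\<lambda>x. _ * x"]
        additive_span_map[OF assms(2), where f = "\<lambda>x. x * _"];
      simp add: distrib_left distrib_right sandwich_generator_left sandwich_generator_right assms(1))+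

lemma span_path:
  assumes \<Gamma>: "hereditary \<Gamma>" and y: "y \<in> sandwich_span \<Gamma>" and p: "awalk u p w"
  shows "path_elem u p * y \<in> sandwich_span \<Gamma>" "y * path_elem u p \<in> sandwich_span \<Gamma>"
    "ghost_elem u p * y \<in> sandwich_span \<Gamma>" "y * ghost_elem u p \<in> sandwich_span \<Gamma>"
proof -
  have "path_elem u p * y \<in> sandwich_span \<Gamma> \<and> y * path_elem u p \<in> sandwich_span \<Gamma> \<and>
      ghost_elem u p * y \<in> sandwich_span \<Gamma> \<and> y * ghost_elem u p \<in> sandwich_span \<Gamma>"
    using p y
  proof (induction p arbitrary: u y)
    case Nil
    then show ?case by (auto simp: awalk_Nil_iff span_generator \<Gamma>)
  next
    case (Cons e p)
    then have e: "e \<in> arcs E" "awalk (head E e) p w" by (auto simp: awalk_Cons_iff)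
    note IH = Cons.IH[OF e(2)] and g = span_generator[OF \<Gamma>]
    have "s e * (path_elem (head E e) p * y) \<in> sandwich_span \<Gamma>"
      "(y * s e) * path_elem (head E e) p \<in> sandwich_span \<Gamma>"
      "ghost_elem (head E e) p * (t e * y) \<in> sandwich_span \<Gamma>"
      "(y * ghost_elem (head E e) p) * t e \<in> sandwich_span \<Gamma>"
      using e(1) Cons.prems(2) by (simp_all add: IH g)
    then show ?case by (simp add: mult.assoc)
  qed
  then show "path_elem u p * y \<in> sandwich_span \<Gamma>" "y * path_elem u p \<in> sandwich_span \<Gamma>"
    "ghost_elem u p * y \<in> sandwich_span \<Gamma>" "y * ghost_elem u p \<in> sandwich_span \<Gamma>" by blast+
qed

lemma algebraI:
  assumes "awalk u p w"
  shows "path_elem u p \<in> algebra" "ghost_elem u p \<in> algebra"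
proof -
  have w: "awalk w [] w" "(w, {}) \<in> (\<lambda>w. (w, {})) ` verts E"
    using assms by (auto simp: awalk_Nil_iff)
  show "path_elem u p \<in> algebra"
    using sandwichI[OF assms w, of 1] by (simp add: algebra_def gap_empty path_P1[OF assms])
  show "ghost_elem u p \<in> algebra"
    using sandwichI[OF w(1) assms w(2), of 1] assms
    by (simp add: algebra_def gap_empty P_mult awalk_last_in_verts P1_ghost[OF assms])
qed

lemma algebra_generators:
  shows "v \<in> verts E \<Longrightarrow> P v c \<in> algebra" "e \<in> arcs E \<Longrightarrow> s e \<in> algebra" "e \<in> arcs E \<Longrightarrow> t e \<in> algebra"
proof -
  show "P v c \<in> algebra" if "v \<in> verts E"
    using sandwichI[of v "[]" v v "[]" "{}" _ c] that
    by (auto simp: algebra_def awalk_Nil_iff gap_empty P_mult)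
  show "s e \<in> algebra" if "e \<in> arcs E"
    using algebraI(1)[OF arc_implies_awalk[OF that]] s_P1 that by simp
  show "t e \<in> algebra" if "e \<in> arcs E"
    using algebraI(2)[OF arc_implies_awalk[OF that]] P1_t that by simp
qed

lemma span_algebra:
  assumes \<Gamma>: "hereditary \<Gamma>" and y: "y \<in> sandwich_span \<Gamma>" and a: "a \<in> algebra"
  shows "a * y \<in> sandwich_span \<Gamma>" "y * a \<in> sandwich_span \<Gamma>"
proof -
  have mono: "b * y \<in> sandwich_span \<Gamma> \<and> y * b \<in> sandwich_span \<Gamma>"
    if b: "b \<in> sandwiches ((\<lambda>w. (w, {})) ` verts E)" for b
  proof -
    obtain u p w c v q where b: "b = path_elem u p * P w c * P w 1 * ghost_elem v q"
      and pq: "awalk u p w" "awalk v q w"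
      using b by (rule sandwichE) (auto simp: gap_empty)
    have w: "w \<in> verts E" using pq by auto
    note g = span_path[OF \<Gamma> _ pq(1)] span_path[OF \<Gamma> _ pq(2)] span_generator[OF \<Gamma>]
    have "path_elem u p * (P w c * (P w 1 * (ghost_elem v q * y))) \<in> sandwich_span \<Gamma>"
      "(((y * path_elem u p) * P w c) * P w 1) * ghost_elem v q \<in> sandwich_span \<Gamma>"
      using y w by (simp_all add: g)
    then show ?thesis by (simp add: b mult.assoc)
  qed
  show "a * y \<in> sandwich_span \<Gamma>"
    by (rule additive_span_map[OF a[unfolded algebra_def], where f = "\<lambda>x. x * y"])
      (use mono in \<open>auto simp: distrib_right\<close>)
  show "y * a \<in> sandwich_span \<Gamma>"
    by (rule additive_span_map[OF a[unfolded algebra_def], where f = "\<lambda>x. y * x"])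
      (use mono in \<open>auto simp: distrib_left\<close>)
qed

lemma algebra_mult: "\<lbrakk>a \<in> algebra; b \<in> algebra\<rbrakk> \<Longrightarrow> a * b \<in> algebra"
  using span_algebra(1)[OF hereditary_vertices] by (simp add: algebra_def)

lemma span_uminus:
  assumes "\<Gamma> \<subseteq> gap_index" "x \<in> sandwich_span \<Gamma>"
  shows "- x \<in> sandwich_span \<Gamma>"
proof (rule additive_span_map[OF assms(2), where f = uminus])
  fix b assume "b \<in> sandwiches \<Gamma>"
  then obtain u p w c F v q where b: "b = path_elem u p * P w c * gap w F * ghost_elem v q"
    and pq: "awalk u p w" "awalk v q w" "(w, F) \<in> \<Gamma>"
    by (rule sandwichE)
  then have "w \<in> verts E" by auto
  then show "- b \<in> sandwich_span \<Gamma>"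
    using sandwichI[OF pq, of "- c"] by (simp add: b P_uminus)
qed simp_all

lemma algebra_add: "\<lbrakk>a \<in> algebra; b \<in> algebra\<rbrakk> \<Longrightarrow> a + b \<in> algebra"
  by (simp add: algebra_def additive_span_plus)

lemma algebra_uminus: "a \<in> algebra \<Longrightarrow> - a \<in> algebra"
  unfolding algebra_def by (rule span_uminus) (use hereditary_vertices in \<open>auto simp: hereditary_def\<close>)

lemma algebra_diff: "\<lbrakk>a \<in> algebra; b \<in> algebra\<rbrakk> \<Longrightarrow> a - b \<in> algebra"
  using algebra_add[of a "- b"] algebra_uminus by simp

lemma algebra_zero: "0 \<in> algebra"
  by (simp add: algebra_def additive_span.zero)

lemma gap_algebra:
  assumes "(w, F) \<in> gap_index" shows "gap w F \<in> algebra"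
proof -
  have "(\<Sum>e \<in> F. s e * t e) \<in> algebra"
    unfolding algebra_def
    by (rule additive_span_sum, fold algebra_def) (use gap_indexD[OF assms] in \<open>auto intro: algebra_mult algebra_generators\<close>)
  then show ?thesis
    using gap_indexD[OF assms] by (simp add: gap_def algebra_diff algebra_generators)
qed

lemma ideal_in_algebra: "ideal_in algebra algebra"
  by (auto simp: ideal_in_def intro: algebra_mult algebra_add algebra_uminus algebra_zero)

lemma sandwiches_into_ideal:
  assumes J: "ideal_in algebra J" and "\<Gamma> \<subseteq> gap_index" and \<Gamma>: "\<And>w F. (w, F) \<in> \<Gamma> \<Longrightarrow> gap w F \<in> J"
  shows "sandwich_span \<Gamma> \<subseteq> J"
proof -
  have "sandwiches \<Gamma> \<subseteq> J"
  proof
    fix b assume "b \<in> sandwiches \<Gamma>"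
    then obtain u p w c F v q where b: "b = path_elem u p * P w c * gap w F * ghost_elem v q"
      and pq: "awalk u p w" "awalk v q w" and wF: "(w, F) \<in> \<Gamma>"
      by (rule sandwichE)
    have "w \<in> verts E" using pq by auto
    then have "path_elem u p * P w c \<in> algebra" "ghost_elem v q \<in> algebra"
      using pq by (auto intro: algebra_mult algebraI algebra_generators)
    then show "b \<in> J" using \<Gamma>[OF wF] ideal_inD(5,6)[OF J] by (simp add: b)
  qed
  then show ?thesis
    using additive_span_into[of _ "sandwiches \<Gamma>" J] ideal_inD[OF J] by blast
qed

lemma ideal_in_span: "hereditary \<Gamma> \<Longrightarrow> ideal_in algebra (sandwich_span \<Gamma>)"
  using sandwiches_into_ideal[OF ideal_in_algebra, of \<Gamma>] span_algebra span_uminus[of \<Gamma>]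
  by (auto simp: ideal_in_def hereditary_def gap_algebra additive_span.zero additive_span_plus subset_iff)

end

context cohn_family begin

section \<open>Removing ghost edges\<close>

definition real_span :: "'v \<Rightarrow> 'a set" where
  "real_span w = additive_span {path_elem u p * P w c | u p c. awalk u p w}"

text \<open>
  The number of ghost edges measures the progress of the reduction.
\<close>
definition ghost_bounded_span :: "nat \<Rightarrow> 'v \<Rightarrow> 'a set" where
  "ghost_bounded_span m v = additive_span
    {path_elem u p * P w c * ghost_elem v q | u p w c q. awalk u p w \<and> awalk v q w \<and> length q \<le> m}"

lemma real_span_P1: "x \<in> real_span w \<Longrightarrow> x * P w 1 = x"
  unfolding real_span_def
  by (induction rule: additive_span.induct)
    (auto simp: distrib_right mult.assoc awalk_last_in_verts P_mult)

lemma real_span_algebra: "x \<in> real_span w \<Longrightarrow> x \<in> algebra"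
  unfolding real_span_def
  by (induction rule: additive_span.induct)
    (auto intro!: algebra_zero algebra_add algebra_mult algebraI algebra_generators awalk_last_in_verts)

lemma ghost_bounded_P1: "x \<in> ghost_bounded_span m v \<Longrightarrow> x * P v 1 = x"
  unfolding ghost_bounded_span_def
  by (induction rule: additive_span.induct) (auto simp: distrib_right mult.assoc ghost_P1)

lemma ghost_bounded_algebra: "x \<in> ghost_bounded_span m v \<Longrightarrow> x \<in> algebra"
  unfolding ghost_bounded_span_def
  by (induction rule: additive_span.induct)
    (auto intro!: algebra_zero algebra_add algebra_mult algebraI algebra_generators awalk_last_in_verts)

lemma ghost_boundedI: "\<lbrakk>awalk u p w; awalk v q w; length q \<le> m\<rbrakk>
    \<Longrightarrow> path_elem u p * P w c * ghost_elem v q \<in> ghost_bounded_span m v"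
  unfolding ghost_bounded_span_def by (rule additive_span_base) blast

lemma ghost_bounded_add: "0 \<in> ghost_bounded_span m v"
    "\<lbrakk>x \<in> ghost_bounded_span m v; y \<in> ghost_bounded_span m v\<rbrakk> \<Longrightarrow> x + y \<in> ghost_bounded_span m v"
  by (simp_all add: ghost_bounded_span_def additive_span.zero additive_span_plus)

lemma ghost_bounded_mono:
  assumes "x \<in> ghost_bounded_span m v" "m \<le> n"
  shows "x \<in> ghost_bounded_span n v"
proof (rule additive_span_into[OF assms(1)[unfolded ghost_bounded_span_def]])
  show "{path_elem u p * P w c * ghost_elem v q | u p w c q. awalk u p w \<and> awalk v q w \<and> length q \<le> m}
      \<subseteq> ghost_bounded_span n v"
    using assms(2) by (auto intro!: ghost_boundedI)
qed (auto intro: ghost_bounded_add)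

lemma ghost_bounded_zero: "x \<in> ghost_bounded_span 0 v \<Longrightarrow> x \<in> real_span v"
  unfolding ghost_bounded_span_def
proof (induction rule: additive_span.induct)
  case zero
  then show ?case by (simp add: real_span_def additive_span.zero)
next
  case (add b x)
  then obtain u p c where "b = path_elem u p * P v c * P v 1" "awalk u p v"
    by (auto simp: awalk_Nil_iff)
  moreover from this have "b = path_elem u p * P v c" by (simp add: P_mult' awalk_last_in_verts)
  ultimately show ?case using add.IH unfolding real_span_def by (blast intro: additive_span.add)
qed

lemma real_span_s:
  assumes "x \<in> real_span v" and e: "e \<in> arcs E" "tail E e = v"
  shows "x * s e \<in> ghost_bounded_span m (head E e)"
  unfolding ghost_bounded_span_def
proof (rule additive_span_map[OF assms(1)[unfolded real_span_def], where f = "\<lambda>x. x * s e"],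
    fold ghost_bounded_span_def)
  fix b assume "b \<in> {path_elem u p * P v c |u p c. awalk u p v}"
  then obtain u p c where b: "b = path_elem u p * P v c" and p: "awalk u p v" by blast
  have q: "awalk v [e] (head E e)" using e by (auto simp: awalk_simps)
  have "b * s e = path_elem u p * s e * P (head E e) c"
    using P_s[OF e(1), of c] e(2) by (simp add: b mult.assoc)
  then have "b * s e = path_elem u (p @ [e]) * P (head E e) c * ghost_elem (head E e) []"
    using e s_P1[OF e(1)] by (simp add: path_append[OF p q] P_mult')
  moreover have "path_elem u (p @ [e]) * P (head E e) c * ghost_elem (head E e) []
      \<in> ghost_bounded_span m (head E e)"
    using e by (intro ghost_boundedI awalk_appendI[OF p q]) (auto simp: awalk_Nil_iff)
  ultimately show "b * s e \<in> ghost_bounded_span m (head E e)" by simp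
qed (simp_all add: distrib_right)

text \<open>
  Grouping by the ghost edge that is the last factor of a term. The coefficients vanish outside \<open>F\<close>,
  so that \<open>F\<close> can be enlarged in the induction.
\<close>
lemma ghost_bounded_split:
  assumes x: "x \<in> ghost_bounded_span (Suc m) v"
  shows "\<exists>F z b. finite F \<and> F \<subseteq> out_arcs E v \<and> z \<in> real_span v \<and>
    (\<forall>e. b e \<in> ghost_bounded_span m (head E e)) \<and> (\<forall>e. e \<notin> F \<longrightarrow> b e = 0) \<and>
    x = z + (\<Sum>e \<in> F. b e * t e)"
  using x unfolding ghost_bounded_span_def[of "Suc m"]
proof (induction rule: additive_span.induct)
  case zero
  show ?case
    by (rule exI[of _ "{}"], rule exI[of _ 0], rule exI[of _ "\<lambda>_. 0"])
      (simp add: real_span_def ghost_bounded_span_def additive_span.zero)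
next
  case (add a x)
  then obtain u p w c q where a: "a = path_elem u p * P w c * ghost_elem v q"
    and pq: "awalk u p w" "awalk v q w" "length q \<le> Suc m" by blast
  obtain F z b where F: "finite F" "F \<subseteq> out_arcs E v" and z: "z \<in> real_span v"
    and b: "\<And>e. b e \<in> ghost_bounded_span m (head E e)" "\<And>e. e \<notin> F \<Longrightarrow> b e = 0"
    and x: "x = z + (\<Sum>e \<in> F. b e * t e)"
    using add.IH by blast
  show ?case
  proof (cases q)
    case Nil
    then have "w = v" "v \<in> verts E" using pq by (auto simp: awalk_Nil_iff)
    then have "a = path_elem u p * P v c" "awalk u p v"
      using a Nil pq by (auto simp: P_mult')
    then have "a + z \<in> real_span v"
      using z unfolding real_span_def by (blast intro: additive_span.add)
    moreover have "a + x = (a + z) + (\<Sum>e \<in> F. b e * t e)" by (simp add: x add.assoc)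
    ultimately show ?thesis using F b by blast
  next
    case (Cons e q')
    then have e: "e \<in> arcs E" "tail E e = v" "awalk (head E e) q' w"
      using pq by (auto simp: awalk_Cons_iff)
    define a0 where "a0 = path_elem u p * P w c * ghost_elem (head E e) q'"
    define b' where "b' f = (if f = e then a0 else 0) + b f" for f
    have a0: "a0 \<in> ghost_bounded_span m (head E e)"
      unfolding a0_def using pq Cons by (intro ghost_boundedI e(3)) auto
    have "b' f \<in> ghost_bounded_span m (head E f)" for f
      using b(1)[of f] a0 by (cases "f = e") (simp_all add: b'_def ghost_bounded_add)
    moreover have "b' f = 0" if "f \<notin> insert e F" for f
      using that b(2) by (simp add: b'_def)
    moreover have "a + x = z + (\<Sum>f \<in> insert e F. b' f * t f)"
    proof -
      have "(\<Sum>f \<in> insert e F. b' f * t f) =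
          (\<Sum>f \<in> insert e F. if f = e then a0 * t e else 0) + (\<Sum>f \<in> insert e F. b f * t f)"
        unfolding sum.distrib[symmetric] by (rule sum.cong) (auto simp: b'_def distrib_right)
      also have "(\<Sum>f \<in> insert e F. b f * t f) = (\<Sum>f \<in> F. b f * t f)"
        using F b(2) by (intro sum.mono_neutral_right) auto
      also have "(\<Sum>f \<in> insert e F. if f = e then a0 * t e else 0) = a"
        using F by (simp add: a a0_def Cons mult.assoc)
      finally show ?thesis by (simp add: x)
    qed
    moreover have "finite (insert e F)" "insert e F \<subseteq> out_arcs E v" using F e by auto
    ultimately show ?thesis using z by blast
  qed
qed

text \<open>
  If some \<open>x e\<close> is outside \<open>J\<close>, it has shorter ghost paths and the induction proceeds. Otherwise write
  \<open>x = z + (\<Sum>e \<in> F. b e e\<^sup>*)\<close> with \<open>z\<close> a combination of paths. Then \<open>x - z (gap v F)\<close> is the sum of the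
  \<open>x e e\<^sup>*\<close> over \<open>e \<in> F\<close>, hence in \<open>J\<close>. The disjunction in the conclusion keeps the two ways in
  which the process can stop apart: no ghost edges left, or annihilation by all edges.
\<close>
lemma reduce_to_real:
  assumes J: "ideal_in algebra J" and "x \<in> ghost_bounded_span m v" "v \<in> verts E" "x \<notin> J"
  shows "\<exists>y \<in> algebra. \<exists>w F z. (w, F) \<in> gap_index \<and> z \<in> real_span w \<and> x * y \<notin> J \<and>
    x * y - z * gap w F \<in> J \<and> (F = {} \<or> (\<forall>e \<in> out_arcs E w. z * gap w F * s e \<in> J))"
  using assms(2-)
proof (induction m arbitrary: v x)
  case 0
  then have "x \<in> real_span v" by (simp add: ghost_bounded_zero)
  moreover from this have "x * P v 1 = x" by (rule real_span_P1)
  moreover have "(v, {}) \<in> gap_index" "P v 1 \<in> algebra"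
    using 0 by (auto simp: gap_index_def algebra_generators)
  ultimately show ?case
    using 0 ideal_inD(2)[OF J]
    by (intro bexI[of _ "P v 1"] exI[of _ v] exI[of _ "{}"] exI[of _ x]) (auto simp: gap_empty)
next
  case (Suc m)
  obtain F z b where F: "finite F" "F \<subseteq> out_arcs E v" and z: "z \<in> real_span v"
    and b: "\<And>e. b e \<in> ghost_bounded_span m (head E e)" "\<And>e. e \<notin> F \<Longrightarrow> b e = 0"
    and x: "x = z + (\<Sum>e \<in> F. b e * t e)"
    using ghost_bounded_split[OF Suc.prems(1)] by blast
  have idx: "(v, F) \<in> gap_index" using F Suc.prems by (auto simp: gap_index_def)
  have xs: "x * s e = z * s e + b e" if e: "e \<in> out_arcs E v" for e
  proof -
    have "(\<Sum>f \<in> F. b f * t f) * s e = (\<Sum>f \<in> F. if f = e then b e else 0)"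
      unfolding sum_distrib_right using F e ghost_bounded_P1[OF b(1)[of e]]
      by (intro sum.cong) (auto simp: mult.assoc t_s t_s_ne)
    then show ?thesis using F b(2) by (auto simp: x distrib_right)
  qed
  show ?case
  proof (cases "\<exists>e \<in> out_arcs E v. x * s e \<notin> J")
    case True
    then obtain e where e: "e \<in> arcs E" "tail E e = v" "x * s e \<notin> J" by auto
    have "x * s e \<in> ghost_bounded_span m (head E e)"
      using real_span_s[OF z e(1,2), of m] b(1)[of e] xs[of e] e by (simp add: ghost_bounded_add)
    from Suc.IH[OF this _ e(3)] e(1) obtain y w G z' where y: "y \<in> algebra"
      and *: "(w, G) \<in> gap_index" "z' \<in> real_span w" "x * s e * y \<notin> J" "x * s e * y - z' * gap w G \<in> J"
        "G = {} \<or> (\<forall>e \<in> out_arcs E w. z' * gap w G * s e \<in> J)"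
      by auto
    have "s e * y \<in> algebra" using y e by (intro algebra_mult algebra_generators)
    then show ?thesis
      by (rule bexI[rotated], intro exI[of _ w] exI[of _ G] exI[of _ z'] conjI)
        (use * in \<open>simp_all add: mult.assoc\<close>)
  next
    case False
    have xA: "x \<in> algebra" using Suc.prems(1) by (rule ghost_bounded_algebra)
    have "x - z * gap v F = (\<Sum>e \<in> F. (x * s e) * t e)"
    proof -
      have "z * gap v F = z - z * (\<Sum>e \<in> F. s e * t e)"
        using real_span_P1[OF z] by (simp add: gap_def right_diff_distrib)
      then have "x - z * gap v F = (\<Sum>e \<in> F. (z * s e + b e) * t e)"
        by (simp add: x sum_distrib_left distrib_right sum.distrib mult.assoc)
      also have "\<dots> = (\<Sum>e \<in> F. (x * s e) * t e)"
        using xs F by (intro sum.cong) auto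
      finally show ?thesis .
    qed
    moreover have "(\<Sum>e \<in> F. (x * s e) * t e) \<in> J"
    proof (rule ideal_in_sum[OF J])
      fix e assume "e \<in> F"
      then have "e \<in> arcs E" "x * s e \<in> J" using False F by auto
      then show "x * s e * t e \<in> J" by (intro ideal_inD(6)[OF J algebra_generators(3)])
    qed
    ultimately have d: "x - z * gap v F \<in> J" by simp
    have "z * gap v F * s e \<in> J" if e: "e \<in> out_arcs E v" for e
    proof -
      have "z * gap v F * s e = x * s e - (x - z * gap v F) * s e" by (simp add: left_diff_distrib)
      moreover have "(x - z * gap v F) * s e \<in> J"
        using e d by (intro ideal_inD(6)[OF J] algebra_generators) auto
      ultimately show ?thesis using False e ideal_inD(4)[OF J] by simp
    qed
    moreover have "x * P v 1 = x" using Suc.prems(1) by (rule ghost_bounded_P1)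
    moreover have "P v 1 \<in> algebra" using Suc.prems by (simp add: algebra_generators)
    ultimately show ?thesis
      using idx z d Suc.prems
      by (intro bexI[of _ "P v 1"] exI[of _ v] exI[of _ F] exI[of _ z]) auto
  qed
qed

lemma algebra_local_unit:
  assumes "x \<in> algebra"
  shows "\<exists>V. finite V \<and> V \<subseteq> verts E \<and>
    (\<forall>W. finite W \<and> V \<subseteq> W \<and> W \<subseteq> verts E \<longrightarrow> (\<Sum>v \<in> W. x * P v 1) = x)"
  using assms unfolding algebra_def
proof (induction rule: additive_span.induct)
  case zero
  then show ?case by (intro exI[of _ "{}"]) simp
next
  case (add b x)
  from add.IH obtain V where V: "finite V \<and> V \<subseteq> verts E \<and>
    (\<forall>W. finite W \<and> V \<subseteq> W \<and> W \<subseteq> verts E \<longrightarrow> (\<Sum>v \<in> W. x * P v 1) = x)"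
    by (rule exE)
  obtain u p w c F v q where b: "b = path_elem u p * P w c * gap w F * ghost_elem v q"
    and pq: "awalk u p w" "awalk v q w"
    using add.hyps(1) by (rule sandwichE)
  have "b * P v' 1 = (if v' = v then b else 0)" if "v' \<in> verts E" for v'
    using ghost_P1[OF pq(2)] ghost_P_orth[OF pq(2) that] by (simp add: b mult.assoc)
  then have "(\<Sum>v' \<in> W. b * P v' 1) = b" if "finite W" "v \<in> W" "W \<subseteq> verts E" for W
    using that by (subst sum.cong[OF refl, of _ _ "\<lambda>v'. if v' = v then b else 0"]) auto
  moreover have "v \<in> verts E" using pq by auto
  ultimately show ?case
    using V by (intro exI[of _ "insert v V"]) (auto simp: distrib_right sum.distrib)
qed

lemma algebra_P1_bounded:
  assumes "x \<in> algebra" "v \<in> verts E"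
  shows "\<exists>m. x * P v 1 \<in> ghost_bounded_span m v"
  using assms(1) unfolding algebra_def
proof (induction rule: additive_span.induct)
  case zero
  then show ?case by (simp add: ghost_bounded_span_def additive_span.zero)
next
  case (add b x)
  then obtain m where m: "x * P v 1 \<in> ghost_bounded_span m v" by blast
  obtain u p w c F v' q where b: "b = path_elem u p * P w c * gap w F * ghost_elem v' q"
    and pq: "awalk u p w" "awalk v' q w" and F: "(w, F) \<in> (\<lambda>w. (w, {})) ` verts E"
    using add.hyps(1) by (rule sandwichE)
  have b': "b = path_elem u p * P w c * ghost_elem v' q"
    using F by (auto simp: b gap_empty P_mult')
  have "b * P v 1 \<in> ghost_bounded_span (length q) v"
  proof (cases "v = v'")
    case True
    then have "b * P v 1 = b" using ghost_P1[OF pq(2)] by (simp add: b' mult.assoc)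
    then show ?thesis
      using ghost_boundedI[OF pq(1), of v' q "length q" c] pq True by (simp add: b')
  next
    case False
    then have "b * P v 1 = 0" using ghost_P_orth[OF pq(2) assms(2)] by (simp add: b mult.assoc)
    then show ?thesis by (simp add: ghost_bounded_add)
  qed
  then have "(b + x) * P v 1 \<in> ghost_bounded_span (max m (length q)) v"
    using ghost_bounded_mono[of _ "length q" v "max m (length q)"]
      ghost_bounded_mono[OF m, of "max m (length q)"]
    by (simp add: distrib_right ghost_bounded_add)
  then show ?case by blast
qed

section \<open>Reduction to a gap projection\<close>

text \<open>
  The walks to \<open>w\<close>, as lists of edges, determine their starting vertices, so a combination of paths
  has coefficients indexed by lists.
\<close>
lemma real_span_normal_form:
  assumes "x \<in> real_span w"
  shows "\<exists>D c. finite D \<and> (\<forall>p \<in> D. awalk (awhd w p) p w) \<and> (\<forall>p. p \<notin> D \<longrightarrow> c p = 0) \<and>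
    x = (\<Sum>p \<in> D. path_elem (awhd w p) p * P w (c p))"
  using assms unfolding real_span_def
proof (induction rule: additive_span.induct)
  case zero
  show ?case by (rule exI[of _ "{}"], rule exI[of _ "\<lambda>_. 0"]) simp
next
  case (add b x)
  then obtain u p0 c0 where b: "b = path_elem u p0 * P w c0" and p0: "awalk u p0 w" by blast
  obtain D c where D: "finite D" "\<forall>p \<in> D. awalk (awhd w p) p w" "\<forall>p. p \<notin> D \<longrightarrow> c p = 0"
    and x: "x = (\<Sum>p \<in> D. path_elem (awhd w p) p * P w (c p))"
    using add.IH by blast
  have w: "w \<in> verts E" using p0 by auto
  have u: "awhd w p0 = u"
    using p0 by (cases p0) (auto simp: awalk_simps)
  define c' where "c' p = (if p = p0 then c0 else 0) + c p" for p
  have "(\<Sum>p \<in> insert p0 D. path_elem (awhd w p) p * P w (c' p)) =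
      (\<Sum>p \<in> insert p0 D. if p = p0 then b else 0) +
      (\<Sum>p \<in> insert p0 D. path_elem (awhd w p) p * P w (c p))"
    unfolding sum.distrib[symmetric]
    by (rule sum.cong) (auto simp: c'_def P_add w b u distrib_left P_zero)
  also have "(\<Sum>p \<in> insert p0 D. path_elem (awhd w p) p * P w (c p)) = x"
    unfolding x using D by (intro sum.mono_neutral_right) (auto simp: P_zero w)
  finally have "b + x = (\<Sum>p \<in> insert p0 D. path_elem (awhd w p) p * P w (c' p))"
    using D by simp
  moreover have "\<forall>p. p \<notin> insert p0 D \<longrightarrow> c' p = 0" using D by (auto simp: c'_def)
  moreover have "\<forall>p \<in> insert p0 D. awalk (awhd w p) p w" using D p0 u by auto
  moreover have "finite (insert p0 D)" using D by simp
  ultimately show ?case by blast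
qed

end

context cohn_family begin

(* Classical search with this elimination rule would unfold every walk into its vertices. *)
declare awalkE' [rule del]

lemma ghost_path_cases:
  assumes "awalk u p w" "awalk v q w" "length p \<le> length q" "p \<noteq> q"
  obtains r where "q = p @ r" "r \<noteq> []" "awalk w r w" "ghost_elem u p * path_elem v q = path_elem w r"
  | "\<And>r. q \<noteq> p @ r \<or> \<not> awalk w r w" "ghost_elem u p * path_elem v q = 0"
proof (cases "u = v \<and> prefix p q")
  case True
  then obtain r where r: "q = p @ r" by (auto elim: prefixE)
  then have "awalk w r w" using awalk_cancel[of u p w r w] assms True by blast
  then show ?thesis
    using that(1)[of r] r True assms ghost_path_longer[OF assms(1), of r w] by auto
next
  case False
  have "ghost_elem u p * path_elem v q = 0"
  proof (cases "u = v")
    case True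
    then have "\<not> prefix p q" using False by simp
    moreover have "\<not> prefix q p"
    proof
      assume "prefix q p"
      then obtain r where "p = q @ r" by (rule prefixE)
      then show False using assms(3,4) by simp
    qed
    ultimately show ?thesis using ghost_path_incomparable[OF assms(1), of q w] assms(2) True by simp
  next
    case False
    then show ?thesis by (rule ghost_path_orth[OF assms(1,2)])
  qed
  moreover have "q \<noteq> p @ r \<or> \<not> awalk w r w" for r
  proof -
    have "u = v" if "q = p @ r" "awalk w r w"
    proof -
      have "awalk u q w" using awalk_appendI[OF assms(1) that(2)] that by simp
      then show ?thesis
        using awalk_ends[OF _ assms(2)] assms(3,4) by auto
    qed
    then show ?thesis using False by auto
  qed
  ultimately show ?thesis using that(2) by blast
qed

text \<open>
  Multiply by the ghost of a shortest path \<open>p\<close> in the support: this turns \<open>p\<close> into its end vertex,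
  the extensions \<open>p r\<close> of \<open>p\<close> into the closed walks \<open>r\<close>, and all other paths into zero.
\<close>
lemma leading_term:
  assumes z: "z \<in> real_span w" "z \<noteq> 0"
  obtains x T d where "x \<in> algebra" "finite T" "\<And>r. r \<in> T \<Longrightarrow> awalk w r w \<and> r \<noteq> []"
    "x * z = P w 1 + (\<Sum>r \<in> T. path_elem w r * P w (d r))"
proof -
  obtain D0 c where D0: "finite D0" "\<forall>p \<in> D0. awalk (awhd w p) p w" "\<forall>p. p \<notin> D0 \<longrightarrow> c p = 0"
    and z0: "z = (\<Sum>p \<in> D0. path_elem (awhd w p) p * P w (c p))"
    using real_span_normal_form[OF z(1)] by blast
  have w: "w \<in> verts E"
  proof -
    obtain p where "p \<in> D0" using z(2) z0 by (cases "D0 = {}") auto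
    then show ?thesis using D0 by (blast intro: awalk_last_in_verts)
  qed
  define D where "D = {p \<in> D0. c p \<noteq> 0}"
  have fin: "finite D" and D: "\<And>p. p \<in> D \<Longrightarrow> awalk (awhd w p) p w" using D0 by (auto simp: D_def)
  have zD: "z = (\<Sum>p \<in> D. path_elem (awhd w p) p * P w (c p))"
    unfolding z0 using D0 by (intro sum.mono_neutral_right) (auto simp: D_def P_zero w)
  then have "D \<noteq> {}" using z(2) by auto
  then obtain p where p: "p \<in> D" "\<And>q. q \<in> D \<Longrightarrow> length p \<le> length q"
    using fin ex_is_arg_min_if_finite[OF fin, of length] by (auto simp: is_arg_min_linorder)
  let ?u = "awhd w p"
  define x where "x = P w (inverse (c p)) * ghost_elem ?u p"
  define T where "T = {r. r \<noteq> [] \<and> awalk w r w \<and> p @ r \<in> D}"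
  define d where "d r = inverse (c p) * c (p @ r)" for r
  have cp: "c p \<noteq> 0" using p by (simp add: D_def)
  have "finite ((\<lambda>r. p @ r) -` D)" using fin by (intro finite_vimageI) (auto intro: injI)
  then have "finite T" by (rule rev_finite_subset) (auto simp: T_def)
  have closed: "P w a * path_elem w r * P w b = path_elem w r * P w (a * b)" if "awalk w r w" for r a b
    using P_path[OF that, of a] by (simp add: P_mult' w)
  have "x * z = (\<Sum>q \<in> D. x * path_elem (awhd w q) q * P w (c q))"
    by (simp add: zD sum_distrib_left mult.assoc)
  also have "\<dots> = x * path_elem ?u p * P w (c p) +
      (\<Sum>q \<in> D - {p}. x * path_elem (awhd w q) q * P w (c q))"
    using fin p(1) by (rule sum.remove)
  also have "x * path_elem ?u p * P w (c p) = P w 1"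
    using ghost_path_same[OF D[OF p(1)]] cp w by (simp add: x_def mult.assoc P_mult)
  also have "(\<Sum>q \<in> D - {p}. x * path_elem (awhd w q) q * P w (c q)) =
      (\<Sum>q \<in> (\<lambda>r. p @ r) ` T. x * path_elem (awhd w q) q * P w (c q))"
  proof (rule sum.mono_neutral_right)
    show "\<forall>q \<in> D - {p} - (\<lambda>r. p @ r) ` T. x * path_elem (awhd w q) q * P w (c q) = 0"
    proof
      fix q assume q: "q \<in> D - {p} - (\<lambda>r. p @ r) ` T"
      then have q': "q \<in> D" "p \<noteq> q" by auto
      from D[OF p(1)] D[OF q'(1)] p(2)[OF q'(1)] q'(2)
      show "x * path_elem (awhd w q) q * P w (c q) = 0"
      proof (cases rule: ghost_path_cases)
        case (1 r)
        then show ?thesis using q q' by (auto simp: T_def)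
      next
        case 2
        then show ?thesis by (simp add: x_def mult.assoc)
      qed
    qed
  qed (use fin in \<open>auto simp: T_def\<close>)
  also have "\<dots> = (\<Sum>r \<in> T. x * path_elem (awhd w (p @ r)) (p @ r) * P w (c (p @ r)))"
    by (subst sum.reindex) (auto intro: inj_onI)
  also have "\<dots> = (\<Sum>r \<in> T. path_elem w r * P w (d r))"
  proof (rule sum.cong[OF refl])
    fix r assume "r \<in> T"
    then have r: "r \<noteq> []" "awalk w r w" "p @ r \<in> D" "p \<noteq> p @ r" by (auto simp: T_def)
    from D[OF p(1)] D[OF r(3)] p(2)[OF r(3)] r(4)
    show "x * path_elem (awhd w (p @ r)) (p @ r) * P w (c (p @ r)) = path_elem w r * P w (d r)"
    proof (cases rule: ghost_path_cases)
      case (1 r')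
      then show ?thesis using closed[OF r(2)] by (simp add: x_def d_def mult.assoc)
    next
      case 2
      then show ?thesis using r by blast
    qed
  qed
  finally have "x * z = P w 1 + (\<Sum>r \<in> T. path_elem w r * P w (d r))" .
  moreover have "x \<in> algebra"
    unfolding x_def using w D[OF p(1)] by (intro algebra_mult algebra_generators algebraI)
  ultimately show ?thesis using that \<open>finite T\<close> by (auto simp: T_def)
qed

text \<open>
  This replaces the graded structure theory of ideals: \<open>J\<close> is arbitrary, and Condition (K) enters
  only through the walk \<open>q\<close> of \<open>aperiodic_closed_walk\<close>.
\<close>
theorem reduction_to_gap:
  assumes K: condition_K and J: "ideal_in algebra J" and a: "a \<in> algebra" "a \<notin> J"
  obtains x y w F where "x \<in> algebra" "y \<in> algebra" "(w, F) \<in> gap_index" "gap w F \<notin> J"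
    "x * a * y - gap w F \<in> J"
proof -
  note I = ideal_inD[OF J]
  obtain v where v: "v \<in> verts E" "a * P v 1 \<notin> J"
  proof -
    obtain V where V: "finite V \<and> V \<subseteq> verts E \<and>
        (\<forall>W. finite W \<and> V \<subseteq> W \<and> W \<subseteq> verts E \<longrightarrow> (\<Sum>v \<in> W. a * P v 1) = a)"
      using algebra_local_unit[OF a(1)] by (rule exE)
    then have "(\<Sum>v \<in> V. a * P v 1) = a" by simp
    then show ?thesis using that V a(2) ideal_in_sum[OF J, of V "\<lambda>v. a * P v 1"] by auto
  qed
  obtain m where m: "a * P v 1 \<in> ghost_bounded_span m v"
    using algebra_P1_bounded[OF a(1) v(1)] by blast
  obtain y0 w F z where y0: "y0 \<in> algebra" and wF: "(w, F) \<in> gap_index" and z: "z \<in> real_span w"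
    and ay0: "a * P v 1 * y0 \<notin> J" "a * P v 1 * y0 - z * gap w F \<in> J"
    and F: "F = {} \<or> (\<forall>e \<in> out_arcs E w. z * gap w F * s e \<in> J)"
    using reduce_to_real[OF J m v] by blast
  define y where "y = P v 1 * y0"
  have y: "y \<in> algebra" unfolding y_def using v y0 by (intro algebra_mult algebra_generators)
  have ay: "a * y - z * gap w F \<in> J" using ay0 by (simp add: y_def mult.assoc)
  have zJ: "z * gap w F \<notin> J"
  proof
    assume "z * gap w F \<in> J"
    from I(3)[OF ay this] show False using ay0 by (simp add: y_def mult.assoc)
  qed
  then have "z \<noteq> 0" using I(2) by auto
  then obtain x0 T d where x0: "x0 \<in> algebra" and T: "finite T" "\<And>r. r \<in> T \<Longrightarrow> awalk w r w \<and> r \<noteq> []"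
    and x0z: "x0 * z = P w 1 + (\<Sum>r \<in> T. path_elem w r * P w (d r))"
    using leading_term[OF z] by blast
  have w: "w \<in> verts E" using wF by (rule gap_indexD)
  show ?thesis
  proof (cases "F = {}")
    case True
    have zw: "z * gap w F = z" using True real_span_P1[OF z] by (simp add: gap_empty)
    obtain q where q: "awalk w q w" "\<And>r. r \<in> T \<Longrightarrow> \<not> prefix q (r @ q)"
      using aperiodic_closed_walk[OF K w T] by blast
    have "ghost_elem w q * (path_elem w r * P w (d r)) * path_elem w q = 0" if r: "r \<in> T" for r
    proof -
      have rq: "awalk w (r @ q) w" using awalk_appendI T(2)[OF r] q(1) by blast
      have "\<not> prefix (r @ q) q" using T(2)[OF r] prefix_length_le[of "r @ q" q] by auto
      then have "ghost_elem w q * path_elem w (r @ q) = 0"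
        using ghost_path_incomparable[OF q(1) rq q(2)[OF r]] by simp
      moreover have "ghost_elem w q * (path_elem w r * P w (d r)) * path_elem w q =
          (ghost_elem w q * path_elem w (r @ q)) * P w (d r)"
        using P_path[OF q(1), of "d r"] T(2)[OF r] q(1)
        by (simp add: path_append[of w r w q w] mult.assoc)
      ultimately show ?thesis by simp
    qed
    then have eq: "ghost_elem w q * (x0 * z) * path_elem w q = P w 1"
      using ghost_path_same[OF q(1)] ghost_P1[OF q(1)]
      by (simp add: x0z distrib_left distrib_right sum_distrib_left sum_distrib_right)
    have x: "ghost_elem w q * x0 \<in> algebra" "y * path_elem w q \<in> algebra"
      using x0 y algebraI[OF q(1)] by (auto intro: algebra_mult)
    have "(ghost_elem w q * x0) * a * (y * path_elem w q) - gap w F =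
        (ghost_elem w q * x0) * (a * y - z * gap w F) * path_elem w q"
      using eq True P1_path[OF q(1)] by (simp add: zw gap_empty left_diff_distrib right_diff_distrib mult.assoc)
    also have "\<dots> \<in> J" by (rule I(6)[OF algebraI(1)[OF q(1)] I(5)[OF x(1) ay]])
    finally have "(ghost_elem w q * x0) * a * (y * path_elem w q) - gap w F \<in> J" .
    moreover have "gap w F \<notin> J"
      using I(5)[OF real_span_algebra[OF z], of "gap w F"] zJ by blast
    ultimately show ?thesis using that x wF by blast
  next
    case False
    \<comment> \<open>With the initial edges of the closed walks in T added to F, the gap annihilates these walks.\<close>
    define F' where "F' = F \<union> hd ` T"
    have hd: "hd r \<in> arcs E" "tail E (hd r) = w" if "r \<in> T" for r
      using T(2)[OF that] by (cases r; auto simp: awalk_Cons_iff)+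
    have wF': "(w, F') \<in> gap_index"
      using wF T(1) hd by (auto simp: F'_def gap_index_def)
    have g: "gap w F' * (path_elem w r * P w (d r)) = 0" if r: "r \<in> T" for r
    proof -
      obtain e r' where r': "r = e # r'" using T(2)[OF r] by (cases r) auto
      then have "e \<in> F'" using r by (force simp: F'_def)
      then have "gap w F' * s e = 0" using gap_s[OF wF', of e] hd[OF r] r' by simp
      then show ?thesis by (simp add: r' flip: mult.assoc)
    qed
    have x: "gap w F' * x0 \<in> algebra" using x0 wF' by (intro algebra_mult gap_algebra)
    have "gap w F' * (x0 * z) = gap w F'"
      using g gap_P1[OF wF'] by (simp add: x0z distrib_left sum_distrib_left)
    then have "gap w F' * (x0 * z) * gap w F = gap w F'"
      using gap_mult_subset[OF wF wF'] by (simp add: F'_def)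
    then have "(gap w F' * x0) * a * y - gap w F' = (gap w F' * x0) * (a * y - z * gap w F)"
      by (simp add: right_diff_distrib mult.assoc)
    also have "\<dots> \<in> J" by (rule I(5)[OF x ay])
    finally have 1: "(gap w F' * x0) * a * y - gap w F' \<in> J" .
    \<comment> \<open>If the smaller gap were in J, then w would be the sum of the e e* over F' modulo J; but z g e is in J for all e, and z g w = z g is not.\<close>
    have "gap w F' \<notin> J"
    proof
      assume gJ: "gap w F' \<in> J"
      have zA: "z * gap w F \<in> algebra"
        using z wF by (intro algebra_mult gap_algebra real_span_algebra)
      have "P w 1 = gap w F' + (\<Sum>e \<in> F'. s e * t e)" by (simp add: gap_def)
      then have "z * gap w F * P w 1 = z * gap w F * (gap w F' + (\<Sum>e \<in> F'. s e * t e))" by simp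
      also have "z * gap w F * P w 1 = z * gap w F" using gap_P1[OF wF] by (simp add: mult.assoc)
      finally have "z * gap w F = z * gap w F * gap w F' + (\<Sum>e \<in> F'. (z * gap w F * s e) * t e)"
        unfolding distrib_left sum_distrib_left mult.assoc .
      moreover have "(\<Sum>e \<in> F'. (z * gap w F * s e) * t e) \<in> J"
      proof (rule ideal_in_sum[OF J])
        fix e assume "e \<in> F'"
        then have "e \<in> arcs E" "tail E e = w" using gap_indexD[OF wF'] by auto
        moreover from this have "z * gap w F * s e \<in> J" using F False by auto
        ultimately show "z * gap w F * s e * t e \<in> J" by (intro I(6)[OF algebra_generators(3)])
      qed
      ultimately show False using zJ I(3) I(5)[OF zA gJ] by metis
    qed
    then show ?thesis using that x y wF' 1 by blast
  qed
qed

section \<open>Ideals are locally unital\<close>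

text \<open>
  Let \<open>J'\<close> be the span on the right-hand side, an ideal. An element of \<open>J\<close> outside \<open>J'\<close> would
  reduce modulo \<open>J'\<close> to a gap projection outside \<open>J'\<close>. But this gap projection is in \<open>J\<close>, thus in \<open>J'\<close> by construction.
\<close>
lemma ideal_generated_by_gaps:
  assumes K: condition_K and J: "ideal_in algebra J"
  shows "J = sandwich_span {(w, F) \<in> gap_index. gap w F \<in> J}"
proof
  let ?\<Gamma> = "{(w, F) \<in> gap_index. gap w F \<in> J}"
  have "hereditary ?\<Gamma>"
    unfolding hereditary_def
  proof (intro conjI allI impI)
    fix w F e assume "(w, F) \<in> ?\<Gamma> \<and> e \<in> out_arcs E w - F"
    then have wF: "(w, F) \<in> gap_index" "gap w F \<in> J" and e: "e \<in> arcs E" "tail E e = w" "e \<notin> F"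
      by auto
    have "t e * (gap w F * s e) \<in> J"
      using wF e by (intro ideal_inD(5,6)[OF J] algebra_generators)
    then show "(head E e, {}) \<in> ?\<Gamma>"
      using gap_s[OF wF(1) e(1,2)] e t_s by (simp add: gap_empty gap_index_def)
  qed auto
  then have J0: "ideal_in algebra (sandwich_span ?\<Gamma>)" by (rule ideal_in_span)
  show J0J: "sandwich_span ?\<Gamma> \<subseteq> J" by (rule sandwiches_into_ideal[OF J]) auto
  show "J \<subseteq> sandwich_span ?\<Gamma>"
  proof (rule subsetI, rule ccontr)
    fix a assume a: "a \<in> J" "a \<notin> sandwich_span ?\<Gamma>"
    then have "a \<in> algebra" using ideal_inD(1)[OF J] by blast
    from reduction_to_gap[OF K J0 this a(2)] obtain x y w F
      where xy: "x \<in> algebra" "y \<in> algebra" and wF: "(w, F) \<in> gap_index" "gap w F \<notin> sandwich_span ?\<Gamma>"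
      and d: "x * a * y - gap w F \<in> sandwich_span ?\<Gamma>" by blast
    have "x * a * y \<in> J" by (rule ideal_inD(6)[OF J xy(2) ideal_inD(5)[OF J xy(1) a(1)]])
    then have "x * a * y - (x * a * y - gap w F) \<in> J" by (rule ideal_inD(4)[OF J]) (use d J0J in blast)
    then have "(w, F) \<in> ?\<Gamma>" using wF by simp
    moreover have w: "awalk w [] w" "w \<in> verts E"
      using gap_indexD(1)[OF wF(1)] by (auto simp: awalk_Nil_iff)
    ultimately have "path_elem w [] * P w 1 * gap w F * ghost_elem w [] \<in> sandwich_span ?\<Gamma>"
      by (intro sandwichI)
    then show False using wF gap_P1[OF wF(1)] P1_gap[OF wF(1)] w(2) by (simp add: P_mult)
  qed
qed

text \<open>
  These idempotents are one-sided units for the sandwiches: \<open>p g q\<^sup>*\<close> is fixed by \<open>p g p\<^sup>*\<close> from the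
  left and by \<open>q g q\<^sup>*\<close> from the right.
\<close>
definition corners :: "('v \<times> 'e set) set \<Rightarrow> 'a set" where
  "corners \<Gamma> = {path_elem u p * gap w F * ghost_elem u p | u p w F. awalk u p w \<and> (w, F) \<in> \<Gamma>}"

lemma cornerI: "\<lbrakk>awalk u p w; (w, F) \<in> \<Gamma>\<rbrakk> \<Longrightarrow> path_elem u p * gap w F * ghost_elem u p \<in> corners \<Gamma>"
  unfolding corners_def by blast

lemma cornerE:
  assumes "h \<in> corners \<Gamma>"
  obtains u p w F where "h = path_elem u p * gap w F * ghost_elem u p" "awalk u p w" "(w, F) \<in> \<Gamma>"
  using assms unfolding corners_def by blast

text \<open>
  If one walk is a prefix of the other, the projections are comparable; otherwise they are
  orthogonal.
\<close>
lemma range_projections_commute: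
  assumes "awalk u p w" "awalk v q x"
  shows "(path_elem u p * ghost_elem u p) * (path_elem v q * ghost_elem v q) =
    (path_elem v q * ghost_elem v q) * (path_elem u p * ghost_elem u p)"
proof -
  have longer: "(path_elem u p * ghost_elem u p) * (path_elem u (p @ r) * ghost_elem u (p @ r)) =
        path_elem u (p @ r) * ghost_elem u (p @ r) \<and>
      (path_elem u (p @ r) * ghost_elem u (p @ r)) * (path_elem u p * ghost_elem u p) =
        path_elem u (p @ r) * ghost_elem u (p @ r)"
    if p: "awalk u p w" and pr: "awalk u (p @ r) x" for p r w x
  proof -
    have r: "awalk w r x" using awalk_cancel p pr by blast
    have "(path_elem u p * ghost_elem u p) * (path_elem u (p @ r) * ghost_elem u (p @ r)) =
        path_elem u p * (ghost_elem u p * path_elem u (p @ r)) * ghost_elem u (p @ r)"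
      by (simp add: mult.assoc)
    moreover have "(path_elem u (p @ r) * ghost_elem u (p @ r)) * (path_elem u p * ghost_elem u p) =
        path_elem u (p @ r) * ((ghost_elem u (p @ r) * path_elem u p) * ghost_elem u p)"
      by (simp add: mult.assoc)
    ultimately show ?thesis
      using ghost_path_longer[OF p r] ghost_longer_path[OF p r] path_append[OF p r] ghost_append[OF p r]
      by simp
  qed
  consider "u = v" "prefix p q" | "u = v" "prefix q p" | "u = v" "\<not> prefix p q" "\<not> prefix q p" | "u \<noteq> v"
    by blast
  then show ?thesis
  proof cases
    case 1
    then obtain r where "q = p @ r" by (auto elim: prefixE)
    then show ?thesis using longer[of p w r x] assms 1 by simp
  next
    case 2
    then obtain r where "p = q @ r" by (auto elim: prefixE)
    then show ?thesis using longer[of q x r w] assms 2 by simp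
  next
    case 3
    then have "ghost_elem u p * path_elem v q = 0" "ghost_elem v q * path_elem u p = 0"
      using ghost_path_incomparable[OF assms(1)] ghost_path_incomparable[OF assms(2)] assms by simp_all
    then show ?thesis by (simp add: mult.assoc) (simp flip: mult.assoc)
  next
    case 4
    then have "ghost_elem u p * path_elem v q = 0" "ghost_elem v q * path_elem u p = 0"
      using ghost_path_orth[OF assms] ghost_path_orth[OF assms(2,1)] by simp_all
    then show ?thesis by (simp add: mult.assoc) (simp flip: mult.assoc)
  qed
qed

lemma commute_diff_sum:
  fixes x y :: "'b :: ring"
  assumes "x * y = y * x" "\<And>i. i \<in> I \<Longrightarrow> f i * y = y * f i"
  shows "(x - sum f I) * y = y * (x - sum f I)"
  using assms by (simp add: left_diff_distrib right_diff_distrib sum_distrib_left sum_distrib_right)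

lemma corner_diff:
  assumes p: "awalk u p w" and wF: "(w, F) \<in> gap_index"
  shows "path_elem u p * gap w F * ghost_elem u p = path_elem u p * ghost_elem u p -
    (\<Sum>e \<in> F. path_elem u (p @ [e]) * ghost_elem u (p @ [e]))"
proof -
  have "path_elem u (p @ [e]) * ghost_elem u (p @ [e]) = path_elem u p * (s e * t e) * ghost_elem u p"
    if "e \<in> F" for e
  proof -
    have e: "e \<in> arcs E" "awalk w [e] (head E e)"
      using gap_indexD[OF wF] that by (auto simp: awalk_simps)
    then have "path_elem w [e] * ghost_elem w [e] = s e * t e"
      using s_P1 P1_t by (simp add: mult.assoc)
    then show ?thesis
      by (simp add: path_append[OF p e(2)] ghost_append[OF p e(2)] mult.assoc del: path_elem.simps ghost_elem.simps)
        (simp add: mult.assoc[symmetric] del: path_elem.simps ghost_elem.simps)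
  qed
  then show ?thesis
    using path_P1[OF p]
    by (simp add: gap_def right_diff_distrib left_diff_distrib sum_distrib_left sum_distrib_right)
qed

lemma corners_commute:
  assumes "h \<in> corners gap_index" "k \<in> corners gap_index"
  shows "h * k = k * h"
proof -
  obtain u p w F where h: "h = path_elem u p * gap w F * ghost_elem u p"
    and p: "awalk u p w" "(w, F) \<in> gap_index" using assms(1) by (rule cornerE)
  obtain v q x G where k: "k = path_elem v q * gap x G * ghost_elem v q"
    and q: "awalk v q x" "(x, G) \<in> gap_index" using assms(2) by (rule cornerE)
  have ext: "awalk u (p @ [e]) (head E e)" if "awalk u p w" "(w, F) \<in> gap_index" "e \<in> F" for u p w F e
    using that gap_indexD[OF that(2)] by (intro awalk_appendI[OF that(1)]) (auto simp: awalk_simps)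
  have "(path_elem v' q' * ghost_elem v' q') * k = k * (path_elem v' q' * ghost_elem v' q')"
    if "awalk v' q' x'" for v' q' x'
    unfolding k corner_diff[OF q]
    by (rule commute_diff_sum[symmetric]; rule range_projections_commute[OF _ that]; rule q ext[OF q]; assumption?)
  then show ?thesis
    unfolding h corner_diff[OF p] using p(1) ext[OF p] by (intro commute_diff_sum) blast+
qed

lemma corner_idem:
  assumes "h \<in> corners gap_index" shows "h * h = h"
proof -
  obtain u p w F where h: "h = path_elem u p * gap w F * ghost_elem u p"
    and p: "awalk u p w" "(w, F) \<in> gap_index" using assms(1) by (rule cornerE)
  have "h * h = path_elem u p * gap w F * (ghost_elem u p * path_elem u p) * gap w F * ghost_elem u p"
    by (simp add: h mult.assoc)
  also have "\<dots> = path_elem u p * (gap w F * gap w F) * ghost_elem u p"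
    using ghost_path_same[OF p(1)] P1_gap[OF p(2)] by (simp add: mult.assoc)
  finally show ?thesis using gap_idem[OF p(2)] by (simp add: h)
qed

lemma corner_support:
  assumes "x \<in> sandwich_span \<Gamma>" "\<Gamma> \<subseteq> gap_index"
  shows "\<exists>H. finite H \<and> H \<subseteq> corners \<Gamma> \<and> (\<forall>j. (\<forall>h \<in> H. h * j = h \<and> j * h = h) \<longrightarrow> x * j = x \<and> j * x = x)"
  using assms(1)
proof (induction rule: additive_span.induct)
  case zero
  then show ?case by (intro exI[of _ "{}"]) simp
next
  case (add b x)
  from add.IH obtain H where H: "finite H \<and> H \<subseteq> corners \<Gamma> \<and>
    (\<forall>j. (\<forall>h \<in> H. h * j = h \<and> j * h = h) \<longrightarrow> x * j = x \<and> j * x = x)" by (rule exE)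
  obtain u p w c F v q where b: "b = path_elem u p * P w c * gap w F * ghost_elem v q"
    and pq: "awalk u p w" "awalk v q w" and wF: "(w, F) \<in> \<Gamma>"
    using add.hyps(1) by (rule sandwichE)
  have idx: "(w, F) \<in> gap_index" using wF assms(2) by blast
  define h k where "h = path_elem u p * gap w F * ghost_elem u p"
    and "k = path_elem v q * gap w F * ghost_elem v q"
  have "b * k = path_elem u p * P w c * gap w F * (ghost_elem v q * path_elem v q) * gap w F * ghost_elem v q"
    by (simp add: b k_def mult.assoc)
  also have "\<dots> = path_elem u p * P w c * (gap w F * gap w F) * ghost_elem v q"
    using ghost_path_same[OF pq(2)] P1_gap[OF idx] by (simp add: mult.assoc)
  finally have bk: "b * k = b" using gap_idem[OF idx] by (simp add: b)
  have "h * b = path_elem u p * gap w F * (ghost_elem u p * path_elem u p) * P w c * gap w F * ghost_elem v q"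
    by (simp add: b h_def mult.assoc)
  also have "\<dots> = path_elem u p * (gap w F * P w c) * gap w F * ghost_elem v q"
    using ghost_path_same[OF pq(1)] gap_P1[OF idx] by (simp add: mult.assoc)
  also have "\<dots> = path_elem u p * P w c * (gap w F * gap w F) * ghost_elem v q"
    unfolding P_gap[OF idx, of c, symmetric] by (simp add: mult.assoc)
  finally have hb: "h * b = b" using gap_idem[OF idx] by (simp add: b)
  have "b * j = b \<and> j * b = b" if "h * j = h \<and> j * h = h" "k * j = k \<and> j * k = k" for j
    using that bk hb by (metis mult.assoc)
  moreover have "h \<in> corners \<Gamma>" "k \<in> corners \<Gamma>"
    unfolding h_def k_def using pq wF by (auto intro: cornerI)
  ultimately show ?case
    using H by (intro exI[of _ "insert h (insert k H)"]) (simp add: distrib_left distrib_right)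
qed

end

text \<open>
  The join \<open>j + h - j h\<close> adds one idempotent \<open>h\<close> at a time. The induction also carries that \<open>j\<close>
  commutes with everything that commutes with \<open>H\<close>, as \<open>h\<close> has to commute with \<open>j\<close>.
\<close>
lemma commuting_idempotents_join:
  fixes J :: "'a :: ring set"
  assumes J: "ideal_in A J" and "finite H" "H \<subseteq> J"
    and comm: "\<And>h k. \<lbrakk>h \<in> H; k \<in> H\<rbrakk> \<Longrightarrow> h * k = k * h" and idem: "\<And>h. h \<in> H \<Longrightarrow> h * h = h"
  shows "\<exists>j \<in> J. \<forall>h \<in> H. h * j = h \<and> j * h = h"
proof -
  have "\<exists>j \<in> J. (\<forall>h \<in> H. h * j = h \<and> j * h = h) \<and> (\<forall>c. (\<forall>h \<in> H. c * h = h * c) \<longrightarrow> c * j = j * c)"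
    using assms(2-)
  proof (induction H rule: finite_induct)
    case empty
    then show ?case using ideal_inD(2)[OF J] by (intro bexI[of _ 0]) auto
  next
    case (insert h H)
    then obtain j where j: "j \<in> J" "\<And>k. k \<in> H \<Longrightarrow> k * j = k" "\<And>k. k \<in> H \<Longrightarrow> j * k = k"
      and jc: "\<And>c. (\<And>k. k \<in> H \<Longrightarrow> c * k = k * c) \<Longrightarrow> c * j = j * c"
      by (metis insert_iff insert_subset)
    have h: "h \<in> J" "h * h = h" and hk: "\<And>k. k \<in> H \<Longrightarrow> h * k = k * h"
      using insert.prems by auto
    have hj: "h * j = j * h" using jc hk by blast
    define j' where "j' = j + h - j * h"
    have j'J: "j' \<in> J"
      unfolding j'_def using j(1) h(1) ideal_inD(1)[OF J] by (intro ideal_inD(3,4,5)[OF J]) auto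
    have 1: "k * j' = k \<and> j' * k = k" if "k \<in> insert h H" for k
    proof (cases "k = h")
      case True
      have "h * (j * h) = j * h" using hj h(2) by (simp flip: mult.assoc) (simp add: mult.assoc)
      then show ?thesis using True h(2) hj by (simp add: j'_def algebra_simps)
    next
      case False
      then have k: "k \<in> H" using that by simp
      have "k * (j * h) = k * h" using j(2)[OF k] by (simp flip: mult.assoc)
      moreover have "(j * h) * k = h * k" using hk[OF k] j(3)[OF k] by (simp add: mult.assoc) (simp flip: mult.assoc)
      ultimately show ?thesis using j(2,3)[OF k] by (simp add: j'_def distrib_left distrib_right left_diff_distrib right_diff_distrib)
    qed
    have 2: "c * j' = j' * c" if c: "\<And>k. k \<in> insert h H \<Longrightarrow> c * k = k * c" for c
    proof -
      have "c * j = j * c" using jc c by blast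
      moreover have "c * h = h * c" using c by blast
      ultimately have "c * (j * h) = (j * h) * c" by (metis mult.assoc)
      then show ?thesis using \<open>c * j = j * c\<close> \<open>c * h = h * c\<close>
        by (simp add: j'_def distrib_left distrib_right left_diff_distrib right_diff_distrib)
    qed
    show ?case using j'J 1 2 by blast
  qed
  then show ?thesis by blast
qed

theorem (in cohn_family) ideal_locally_unital:
  assumes K: condition_K and J: "ideal_in algebra J" and a: "a \<in> J"
  shows "\<exists>j \<in> J. a * j = a \<and> j * a = a"
proof -
  let ?\<Gamma> = "{(w, F) \<in> gap_index. gap w F \<in> J}"
  have "a \<in> sandwich_span ?\<Gamma>" using ideal_generated_by_gaps[OF K J] a by simp
  then obtain H where H: "finite H" "H \<subseteq> corners ?\<Gamma>"
    "\<And>j. (\<forall>h \<in> H. h * j = h \<and> j * h = h) \<Longrightarrow> a * j = a \<and> j * a = a"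
    using corner_support[of a ?\<Gamma>] by blast
  have "corners ?\<Gamma> \<subseteq> corners gap_index" unfolding corners_def by blast
  then have sub: "H \<subseteq> corners gap_index" using H by blast
  have "corners ?\<Gamma> \<subseteq> J"
  proof
    fix h assume "h \<in> corners ?\<Gamma>"
    then obtain u p w F where h: "h = path_elem u p * gap w F * ghost_elem u p"
      and p: "awalk u p w" "(w, F) \<in> ?\<Gamma>" by (rule cornerE)
    then show "h \<in> J" 
      unfolding h using p by (intro ideal_inD(5,6)[OF J] algebraI[OF p(1)]) simp
  qed
  then have "H \<subseteq> J" using H(2) by simp
  have "\<exists>j \<in> J. \<forall>h \<in> H. h * j = h \<and> j * h = h"
    by (rule commuting_idempotents_join[OF J H(1) \<open>H \<subseteq> J\<close>])
      (use sub corners_commute corner_idem in \<open>simp_all add: subset_iff\<close>)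
  then show ?thesis using H(3) by blast
qed

section \<open>Criteria for weakly regular rings and Zorn rings\<close>

context nonunital_ring
begin

lemma mult_zero: "x \<in> carrier R \<Longrightarrow> \<zero> \<otimes> x = \<zero>" "x \<in> carrier R \<Longrightarrow> x \<otimes> \<zero> = \<zero>"
proof -
  assume x: "x \<in> carrier R"
  have "\<zero> \<otimes> x \<oplus> \<zero> \<otimes> x = \<zero> \<otimes> x \<oplus> \<zero>"
    using x l_distrib[of \<zero> \<zero> x, symmetric] by (simp add: mult_closed)
  moreover have "x \<otimes> \<zero> \<oplus> x \<otimes> \<zero> = x \<otimes> \<zero> \<oplus> \<zero>"
    using x r_distrib[of \<zero> \<zero> x, symmetric] by (simp add: mult_closed)
  ultimately show "\<zero> \<otimes> x = \<zero>" "x \<otimes> \<zero> = \<zero>" using x by (simp_all add: mult_closed)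
qed

lemma mult_minus:
  assumes "x \<in> carrier R" "y \<in> carrier R"
  shows "(\<ominus> x) \<otimes> y = \<ominus> (x \<otimes> y)" "x \<otimes> (\<ominus> y) = \<ominus> (x \<otimes> y)"
proof -
  have "\<ominus> (x \<otimes> y) = (\<ominus> x) \<otimes> y"
    using assms l_distrib[of "\<ominus> x" x y, symmetric]
    by (intro minus_equality) (simp_all add: l_neg mult_zero mult_closed)
  moreover have "\<ominus> (x \<otimes> y) = x \<otimes> (\<ominus> y)"
    using assms r_distrib[of "\<ominus> y" y x, symmetric]
    by (intro minus_equality) (simp_all add: l_neg mult_zero mult_closed)
  ultimately show "(\<ominus> x) \<otimes> y = \<ominus> (x \<otimes> y)" "x \<otimes> (\<ominus> y) = \<ominus> (x \<otimes> y)" by simp_all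
qed

lemma additive_subgroup_of_closed:
  assumes "W \<subseteq> carrier R" "\<zero> \<in> W" "\<And>x y. \<lbrakk>x \<in> W; y \<in> W\<rbrakk> \<Longrightarrow> x \<oplus> y \<in> W"
    and "\<And>x. x \<in> W \<Longrightarrow> \<ominus> x \<in> W"
  shows "additive_subgroup W R"
  by (intro additive_subgroupI add.subgroupI) (use assms in auto)

lemma ideal_prod_closed:
  assumes "I \<subseteq> carrier R"
  shows "x \<in> ideal_prod R I I \<Longrightarrow> x \<in> carrier R"
  by (induction rule: ideal_prod.induct) (use assms mult_closed in auto)

lemma ideal_prod_additive_subgroup:
  assumes I: "additive_subgroup I R"
  shows "additive_subgroup (ideal_prod R I I) R"
proof (rule additive_subgroup_of_closed)
  have sub: "I \<subseteq> carrier R" and z: "\<zero> \<in> I"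
    using I by (auto simp: additive_subgroup.a_subset additive_subgroup.zero_closed)
  show "ideal_prod R I I \<subseteq> carrier R" using ideal_prod_closed[OF sub] by blast
  show "\<zero> \<in> ideal_prod R I I"
    using ideal_prod.prod[OF z z, of R] by (simp add: mult_zero)
  show "\<ominus> x \<in> ideal_prod R I I" if "x \<in> ideal_prod R I I" for x
    using that
  proof (induction rule: ideal_prod.induct)
    case (prod i j)
    then have "(\<ominus> i) \<otimes> j \<in> ideal_prod R I I"
      using additive_subgroup.a_inv_closed[OF I] by (intro ideal_prod.prod)
    moreover have "i \<in> carrier R" "j \<in> carrier R" using prod sub by auto
    ultimately show ?case by (simp add: mult_minus)
  next
    case (sum x y)
    then show ?case
      using ideal_prod_closed[OF sub] by (simp add: minus_add ideal_prod.sum)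
  qed
qed (rule ideal_prod.sum)

lemma ideal_prod_mult:
  assumes I: "I \<subseteq> carrier R" and r: "r \<in> carrier R"
  shows "(\<And>i. i \<in> I \<Longrightarrow> i \<otimes> r \<in> I) \<Longrightarrow> x \<in> ideal_prod R I I \<Longrightarrow> x \<otimes> r \<in> ideal_prod R I I"
    and "(\<And>i. i \<in> I \<Longrightarrow> r \<otimes> i \<in> I) \<Longrightarrow> x \<in> ideal_prod R I I \<Longrightarrow> r \<otimes> x \<in> ideal_prod R I I"
proof -
  show "x \<otimes> r \<in> ideal_prod R I I" if c: "\<And>i. i \<in> I \<Longrightarrow> i \<otimes> r \<in> I" and x: "x \<in> ideal_prod R I I"
    using x
  proof (induction rule: ideal_prod.induct)
    case (prod i j)
    moreover have "i \<in> carrier R" "j \<in> carrier R" using prod I by auto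
    ultimately show ?case using r c by (simp add: mult_assoc ideal_prod.prod)
  qed (use ideal_prod_closed[OF I] r in \<open>simp add: l_distrib ideal_prod.sum\<close>)
  show "r \<otimes> x \<in> ideal_prod R I I" if c: "\<And>i. i \<in> I \<Longrightarrow> r \<otimes> i \<in> I" and x: "x \<in> ideal_prod R I I"
    using x
  proof (induction rule: ideal_prod.induct)
    case (prod i j)
    moreover have "i \<in> carrier R" "j \<in> carrier R" using prod I by auto
    ultimately show ?case using r c by (simp add: mult_assoc[symmetric] ideal_prod.prod)
  qed (use ideal_prod_closed[OF I] r in \<open>simp add: r_distrib ideal_prod.sum\<close>)
qed

text \<open>
  Let \<open>a\<close> be in a right ideal \<open>I\<close>. The set \<open>W\<close> of all \<open>j\<close> with \<open>a R j \<subseteq> I\<^sup>2\<close> is a two-sided ideal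
  that contains \<open>a\<close>, so \<open>a = a j\<close> for some \<open>j \<in> W\<close>, and then \<open>a = a j j \<in> I\<^sup>2\<close>. Left ideals are
  treated symmetrically.
\<close>
lemma weakly_regular_of_locally_unital_ideals:
  assumes unit: "\<And>J a. \<lbrakk>two_sided_ideal J R; a \<in> J\<rbrakk> \<Longrightarrow> \<exists>j \<in> J. a \<otimes> j = a \<and> j \<otimes> a = a"
  shows "weakly_regular_ring R"
proof (intro weakly_regular_ring.intro weakly_regular_ring_axioms.intro nonunital_ring_axioms)
  fix I assume I: "left_ideal I R \<or> right_ideal I R"
  then have add: "additive_subgroup I R" by (auto simp: left_ideal_def right_ideal_def)
  then have sub: "I \<subseteq> carrier R" by (rule additive_subgroup.a_subset)
  let ?II = "ideal_prod R I I"
  have II: "additive_subgroup ?II R" using add by (rule ideal_prod_additive_subgroup)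
  note II_closed = additive_subgroup.zero_closed[OF II] additive_subgroup.a_closed[OF II]
    additive_subgroup.a_inv_closed[OF II]
  show "?II = I"
  proof
    show "?II \<subseteq> I"
    proof
      fix x assume "x \<in> ?II"
      then show "x \<in> I"
      proof (induction rule: ideal_prod.induct)
        case (prod i j)
        then show ?case using I sub by (auto simp: left_ideal_def right_ideal_def)
      qed (use add in \<open>simp add: additive_subgroup.a_closed\<close>)
    qed
    show "I \<subseteq> ?II"
    proof
      fix a assume a: "a \<in> I"
      then have aR: "a \<in> carrier R" using sub by blast
      show "a \<in> ?II"
        using I
      proof
        assume "right_ideal I R"
        then have r: "\<And>i x. \<lbrakk>i \<in> I; x \<in> carrier R\<rbrakk> \<Longrightarrow> i \<otimes> x \<in> I" by (simp add: right_ideal_def)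
        define W where "W = {j \<in> carrier R. \<forall>x \<in> carrier R. a \<otimes> x \<otimes> j \<in> ?II}"
        have ax: "a \<otimes> x \<in> carrier R" if "x \<in> carrier R" for x using aR that by (rule mult_closed)
        have "additive_subgroup W R"
          by (rule additive_subgroup_of_closed)
            (auto simp: W_def ax mult_zero mult_minus r_distrib II_closed)
        moreover have "x \<otimes> j \<in> W" "j \<otimes> x \<in> W" if "x \<in> carrier R" "j \<in> W" for x j
        proof -
          have j: "j \<in> carrier R" "\<And>y. y \<in> carrier R \<Longrightarrow> a \<otimes> y \<otimes> j \<in> ?II"
            using that by (auto simp: W_def)
          have "a \<otimes> y \<otimes> (x \<otimes> j) \<in> ?II" "a \<otimes> y \<otimes> (j \<otimes> x) \<in> ?II" if y: "y \<in> carrier R" for y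
          proof -
            have "a \<otimes> y \<otimes> (x \<otimes> j) = a \<otimes> (y \<otimes> x) \<otimes> j" "a \<otimes> y \<otimes> (j \<otimes> x) = a \<otimes> y \<otimes> j \<otimes> x"
              using aR y j \<open>x \<in> carrier R\<close> by (simp_all add: mult_assoc mult_closed)
            then show "a \<otimes> y \<otimes> (x \<otimes> j) \<in> ?II" "a \<otimes> y \<otimes> (j \<otimes> x) \<in> ?II"
              using j(2) y \<open>x \<in> carrier R\<close> ideal_prod_mult(1)[OF sub \<open>x \<in> carrier R\<close> r] mult_closed
              by simp_all
          qed
          then show "x \<otimes> j \<in> W" "j \<otimes> x \<in> W" using j(1) that(1) by (simp_all add: W_def mult_closed)
        qed
        ultimately have W: "two_sided_ideal W R"
          by (auto simp: two_sided_ideal_def left_ideal_def right_ideal_def)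
        have "a \<in> W" using aR r[OF a] a by (auto simp: W_def intro: ideal_prod.prod)
        then obtain j where j: "j \<in> W" "a \<otimes> j = a" using unit[OF W] by blast
        then have "a \<otimes> j \<otimes> j \<in> ?II" unfolding W_def by blast
        then show "a \<in> ?II" by (simp add: j)
      next
        assume "left_ideal I R"
        then have r: "\<And>i x. \<lbrakk>i \<in> I; x \<in> carrier R\<rbrakk> \<Longrightarrow> x \<otimes> i \<in> I" by (simp add: left_ideal_def)
        define W where "W = {j \<in> carrier R. \<forall>x \<in> carrier R. j \<otimes> (x \<otimes> a) \<in> ?II}"
        have ax: "x \<otimes> a \<in> carrier R" if "x \<in> carrier R" for x using that aR by (rule mult_closed)
        have "additive_subgroup W R"
          by (rule additive_subgroup_of_closed)
            (auto simp: W_def ax mult_zero mult_minus l_distrib II_closed)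
        moreover have "x \<otimes> j \<in> W" "j \<otimes> x \<in> W" if "x \<in> carrier R" "j \<in> W" for x j
        proof -
          have j: "j \<in> carrier R" "\<And>y. y \<in> carrier R \<Longrightarrow> j \<otimes> (y \<otimes> a) \<in> ?II"
            using that by (auto simp: W_def)
          have "(x \<otimes> j) \<otimes> (y \<otimes> a) \<in> ?II" "(j \<otimes> x) \<otimes> (y \<otimes> a) \<in> ?II" if y: "y \<in> carrier R" for y
          proof -
            have "(x \<otimes> j) \<otimes> (y \<otimes> a) = x \<otimes> (j \<otimes> (y \<otimes> a))" "(j \<otimes> x) \<otimes> (y \<otimes> a) = j \<otimes> ((x \<otimes> y) \<otimes> a)"
              using aR y j \<open>x \<in> carrier R\<close> by (simp_all add: mult_assoc mult_closed)
            then show "(x \<otimes> j) \<otimes> (y \<otimes> a) \<in> ?II" "(j \<otimes> x) \<otimes> (y \<otimes> a) \<in> ?II"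
              using j(2) y \<open>x \<in> carrier R\<close> ideal_prod_mult(2)[OF sub \<open>x \<in> carrier R\<close> r] mult_closed
              by simp_all
          qed
          then show "x \<otimes> j \<in> W" "j \<otimes> x \<in> W" using j(1) that(1) by (simp_all add: W_def mult_closed)
        qed
        ultimately have W: "two_sided_ideal W R"
          by (auto simp: two_sided_ideal_def left_ideal_def right_ideal_def)
        have "a \<in> W" using aR r[OF a] a by (auto simp: W_def intro: ideal_prod.prod)
        then obtain j where j: "j \<in> W" "j \<otimes> a = a" using unit[OF W] by blast
        then have "j \<otimes> (j \<otimes> a) \<in> ?II" unfolding W_def by blast
        then show "a \<in> ?II" by (simp add: j)
      qed
    qed
  qed
qed

text \<open>
  With \<open>g = x a y\<close> idempotent, \<open>b = y g x\<close> makes \<open>a b\<close> idempotent, and \<open>x (a b) (a y) = g\<close>.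
\<close>
lemma zorn_ring_of_reduction:
  assumes red: "\<And>a. \<lbrakk>a \<in> carrier R; a \<noteq> \<zero>\<rbrakk> \<Longrightarrow>
    \<exists>x \<in> carrier R. \<exists>y \<in> carrier R. x \<otimes> a \<otimes> y \<noteq> \<zero> \<and> idempotent R (x \<otimes> a \<otimes> y)"
  shows "zorn_ring R"
proof (intro zorn_ring.intro zorn_ring_axioms.intro nonunital_ring_axioms)
  fix a assume a: "a \<in> carrier R"
  show "nilpotent R a \<or> (\<exists>b \<in> carrier R. a \<otimes> b \<noteq> \<zero> \<and> idempotent R (a \<otimes> b))"
  proof (cases "a = \<zero>")
    case True
    then show ?thesis by (auto simp: nilpotent_def intro: exI[of _ "0 :: nat"])
  next
    case False
    then obtain x y where xy: "x \<in> carrier R" "y \<in> carrier R"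
      and g0: "x \<otimes> a \<otimes> y \<noteq> \<zero>" "idempotent R (x \<otimes> a \<otimes> y)"
      using red[OF a] by blast
    define g where "g = x \<otimes> a \<otimes> y"
    have g: "g \<in> carrier R" "g \<otimes> g = g" "g \<noteq> \<zero>" "x \<otimes> (a \<otimes> y) = g"
      using g0 xy a by (auto simp: g_def idempotent_def mult_closed mult_assoc)
    note c = mult_closed
    define b where "b = y \<otimes> g \<otimes> x"
    have b: "b \<in> carrier R" using xy g by (simp add: b_def c)
    have "(a \<otimes> b) \<otimes> (a \<otimes> b) = a \<otimes> y \<otimes> g \<otimes> (x \<otimes> (a \<otimes> y)) \<otimes> g \<otimes> x"
      using a xy g(1) by (simp add: b_def mult_assoc c)
    also have "\<dots> = a \<otimes> y \<otimes> (g \<otimes> g \<otimes> g) \<otimes> x"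
      using a xy g(1) by (simp add: g(4) mult_assoc c)
    also have "\<dots> = a \<otimes> b"
      using a xy g(1) by (simp add: g(2) b_def mult_assoc c)
    finally have "idempotent R (a \<otimes> b)" by (simp add: idempotent_def)
    moreover have "a \<otimes> b \<noteq> \<zero>"
    proof
      assume "a \<otimes> b = \<zero>"
      then have "x \<otimes> (a \<otimes> b) \<otimes> (a \<otimes> y) = \<zero>" using a xy by (simp add: mult_zero c)
      moreover have "x \<otimes> (a \<otimes> b) \<otimes> (a \<otimes> y) = (x \<otimes> (a \<otimes> y)) \<otimes> g \<otimes> (x \<otimes> (a \<otimes> y))"
        using a xy g(1) by (simp add: b_def mult_assoc c)
      ultimately show False using g by simp
    qed
    ultimately show ?thesis using b by blast
  qed
qed

context
  fixes I assumes I: "two_sided_ideal I R"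
begin

interpretation abelian_subgroup I R
  by (rule abelian_subgroupI3) (use I abelian_group_axioms in \<open>auto simp: two_sided_ideal_def left_ideal_def\<close>)

lemma ideal_coset_eq_iff:
  assumes "x \<in> carrier R" "y \<in> carrier R"
  shows "I +> x = I +> y \<longleftrightarrow> x \<ominus> y \<in> I"
proof -
  have "I +> x = I +> y \<longleftrightarrow> x \<in> I +> y"
    using a_repr_independence'[of x y] a_rcos_self assms by auto
  then show ?thesis using a_rcos_module[of y x] assms by (simp add: a_minus_def)
qed

lemma quotient_coset:
  shows "x \<in> carrier R \<Longrightarrow> I +> x \<in> carrier (R Quot I)"
    and "X \<in> carrier (R Quot I) \<Longrightarrow> \<exists>x \<in> carrier R. X = I +> x"
    and "\<lbrakk>x \<in> carrier R; y \<in> carrier R\<rbrakk> \<Longrightarrow> (I +> x) \<otimes>\<^bsub>R Quot I\<^esub> (I +> y) = I +> (x \<otimes> y)"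
    and "\<lbrakk>x \<in> carrier R; y \<in> carrier R\<rbrakk> \<Longrightarrow> (I +> x) \<oplus>\<^bsub>R Quot I\<^esub> (I +> y) = I +> (x \<oplus> y)"
    and "x \<in> carrier R \<Longrightarrow> I +> x = \<zero>\<^bsub>R Quot I\<^esub> \<longleftrightarrow> x \<in> I"
    and "I +> \<zero> = \<zero>\<^bsub>R Quot I\<^esub>"
proof -
  show "x \<in> carrier R \<Longrightarrow> I +> x = \<zero>\<^bsub>R Quot I\<^esub> \<longleftrightarrow> x \<in> I"
    using a_rcos_const[of x] a_rcos_self[of x] by (auto simp: FactRing_def)
  show "I +> \<zero> = \<zero>\<^bsub>R Quot I\<^esub>" using a_rcos_const[of \<zero>] by (simp add: FactRing_def)
qed (auto simp: FactRing_simps rcoset_mult_coset[OF I] a_rcos_sum)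

lemma zorn_quotient_of_reduction:
  assumes red: "\<And>a. \<lbrakk>a \<in> carrier R; a \<notin> I\<rbrakk> \<Longrightarrow>
    \<exists>x \<in> carrier R. \<exists>y \<in> carrier R. \<exists>g \<in> carrier R. idempotent R g \<and> g \<notin> I \<and> x \<otimes> a \<otimes> y \<ominus> g \<in> I"
  shows "zorn_ring (R Quot I)"
proof (rule nonunital_ring.zorn_ring_of_reduction[OF nonunital_ring_quotient[OF I]])
  fix A assume A: "A \<in> carrier (R Quot I)" "A \<noteq> \<zero>\<^bsub>R Quot I\<^esub>"
  then obtain a where a: "a \<in> carrier R" "A = I +> a" using quotient_coset(2) by blast
  then have "a \<notin> I" using A quotient_coset(5) by blast
  then obtain x y g where xyg: "x \<in> carrier R" "y \<in> carrier R" "g \<in> carrier R"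
    and g: "idempotent R g" "g \<notin> I" "x \<otimes> a \<otimes> y \<ominus> g \<in> I"
    using red[OF a(1)] by blast
  have eq: "(I +> x) \<otimes>\<^bsub>R Quot I\<^esub> A \<otimes>\<^bsub>R Quot I\<^esub> (I +> y) = I +> g"
    using xyg a g(3) by (simp add: quotient_coset mult_closed ideal_coset_eq_iff)
  show "\<exists>x \<in> carrier (R Quot I). \<exists>y \<in> carrier (R Quot I).
      x \<otimes>\<^bsub>R Quot I\<^esub> A \<otimes>\<^bsub>R Quot I\<^esub> y \<noteq> \<zero>\<^bsub>R Quot I\<^esub> \<and> idempotent (R Quot I) (x \<otimes>\<^bsub>R Quot I\<^esub> A \<otimes>\<^bsub>R Quot I\<^esub> y)"
    by (intro bexI[of _ "I +> x"] bexI[of _ "I +> y"])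
      (use g xyg in \<open>simp_all add: eq quotient_coset idempotent_def\<close>)
qed

end

end

section \<open>Leavitt path algebras as Cohn families\<close>

lemma poly_mapping_sum_singles:
  "(\<Sum>w \<in> Poly_Mapping.keys p. Poly_Mapping.single w (Poly_Mapping.lookup p w)) = p"
  by (rule poly_mapping_eqI)
    (simp add: lookup_sum lookup_single when_def sum.delta not_in_keys_iff_lookup_eq_zero)

locale leavitt = wf_digraph E for E :: "('v, 'e) pre_digraph" +
  fixes K :: "'k :: field itself"
begin

abbreviation F :: "(('v, 'e) lpa_generator, 'k) ncpoly ring" where
  "F \<equiv> free_algebra (lpa_generators E)"

abbreviation N :: "(('v, 'e) lpa_generator, 'k) ncpoly set" where
  "N \<equiv> algebra_ideal_generated (lpa_generators E) (lpa_relators E)"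

abbreviation L :: "(('v, 'e) lpa_generator, 'k) ncpoly set ring" where
  "L \<equiv> leavitt_path_algebra TYPE('k) E"

definition rel_class :: "(('v, 'e) lpa_generator, 'k) ncpoly \<Rightarrow> (('v, 'e) lpa_generator, 'k) ncpoly set"
  where "rel_class p = a_r_coset F N p"

definition word_elem :: "('v, 'e) lpa_generator list \<Rightarrow> 'k \<Rightarrow> (('v, 'e) lpa_generator, 'k) ncpoly" where
  "word_elem w c = Poly_Mapping.single (FWord w) c"

definition embed :: "(('v, 'e) lpa_generator, 'k) ncpoly \<Rightarrow> (('v, 'e) lpa_generator, 'k) ncpoly set ring_product"
  where "embed p = into_product L (rel_class p)"

definition vertex :: "'v \<Rightarrow> 'k \<Rightarrow> (('v, 'e) lpa_generator, 'k) ncpoly set ring_product" where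
  "vertex v c = embed (word_elem [Vertex v] c)"
definition edge :: "'e \<Rightarrow> (('v, 'e) lpa_generator, 'k) ncpoly set ring_product" where
  "edge e = embed (word_elem [Edge e] 1)"
definition ghost :: "'e \<Rightarrow> (('v, 'e) lpa_generator, 'k) ncpoly set ring_product" where
  "ghost e = embed (word_elem [Ghost e] 1)"

sublocale F: nonunital_ring F by (rule nonunital_ring_free_algebra)

lemma L_def: "L = F Quot N"
  by (simp add: leavitt_path_algebra_def presented_algebra_def)

lemma N_ideal: "two_sided_ideal N F"
  by (intro two_sided_ideal_generated lpa_relators_subset wf_digraph_axioms)

sublocale L: nonunital_ring L
  by (rule nonunital_ring_leavitt_path_algebra) (rule wf_digraph_axioms)

lemma N_scale: "p \<in> N \<Longrightarrow> scale c p \<in> N"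
  by (auto simp: algebra_ideal_generated_def)

lemma relator_N: "p \<in> lpa_relators E \<Longrightarrow> p \<in> N"
  by (auto simp: algebra_ideal_generated_def)

lemma F_simps:
  "p \<otimes>\<^bsub>F\<^esub> q = p * q" "p \<oplus>\<^bsub>F\<^esub> q = p + q" "\<zero>\<^bsub>F\<^esub> = 0"
  by (simp_all add: free_algebra_def)

lemma F_uminus: "p \<in> carrier F \<Longrightarrow> \<ominus>\<^bsub>F\<^esub> p = - p"
  using F.minus_equality[of "- p" p] by (simp add: F_simps) (simp add: free_algebra_def)

lemma F_minus: "\<lbrakk>p \<in> carrier F; q \<in> carrier F\<rbrakk> \<Longrightarrow> p \<ominus>\<^bsub>F\<^esub> q = p - q"
  by (simp add: a_minus_def F_uminus F_simps)

lemma rel_class: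
  shows "p \<in> carrier F \<Longrightarrow> rel_class p \<in> carrier L"
    and "X \<in> carrier L \<Longrightarrow> \<exists>p \<in> carrier F. X = rel_class p"
    and "\<lbrakk>p \<in> carrier F; q \<in> carrier F\<rbrakk> \<Longrightarrow> rel_class p \<otimes>\<^bsub>L\<^esub> rel_class q = rel_class (p * q)"
    and "\<lbrakk>p \<in> carrier F; q \<in> carrier F\<rbrakk> \<Longrightarrow> rel_class p \<oplus>\<^bsub>L\<^esub> rel_class q = rel_class (p + q)"
    and "rel_class 0 = \<zero>\<^bsub>L\<^esub>"
    and "\<lbrakk>p \<in> carrier F; q \<in> carrier F\<rbrakk> \<Longrightarrow> rel_class p = rel_class q \<longleftrightarrow> p - q \<in> N"
  using F.quotient_coset[OF N_ideal] F.ideal_coset_eq_iff[OF N_ideal]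
  by (simp_all add: L_def rel_class_def F_simps F_minus)

lemma word_elem_F: "\<lbrakk>w \<noteq> []; set w \<subseteq> lpa_generators E\<rbrakk> \<Longrightarrow> word_elem w c \<in> carrier F"
  by (auto simp: free_algebra_def word_elem_def zero_fword_def)

lemma word_elem_simps:
  "word_elem v c * word_elem w d = word_elem (v @ w) (c * d)"
  "word_elem w (c + d) = word_elem w c + word_elem w d"
  "scale c (word_elem w d) = word_elem w (c * d)"
  by (simp_all add: word_elem_def mult_single plus_fword_def single_add scale_def zero_fword_def)

lemma scale_diff: "scale c (p - q) = scale c p - scale c q"
  by (simp add: scale_def right_diff_distrib)

lemma embed:
  shows "\<lbrakk>p \<in> carrier F; q \<in> carrier F\<rbrakk> \<Longrightarrow> embed (p + q) = embed p + embed q"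
    and "\<lbrakk>p \<in> carrier F; q \<in> carrier F\<rbrakk> \<Longrightarrow> embed (p * q) = embed p * embed q"
    and "\<lbrakk>p \<in> carrier F; q \<in> carrier F\<rbrakk> \<Longrightarrow> embed p = embed q \<longleftrightarrow> p - q \<in> N"
    and "embed 0 = 0"
  using into_product_add[OF L.nonunital_ring_axioms] into_product_mult[OF L.nonunital_ring_axioms]
    into_product_eq_iff[OF L.nonunital_ring_axioms] into_product_zero[OF L.nonunital_ring_axioms]
    rel_class
  by (simp_all add: embed_def flip: rel_class(3,4))

lemma generators: "v \<in> verts E \<Longrightarrow> Vertex v \<in> lpa_generators E"
  "e \<in> arcs E \<Longrightarrow> Edge e \<in> lpa_generators E" "e \<in> arcs E \<Longrightarrow> Ghost e \<in> lpa_generators E"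
  by (simp_all add: lpa_generators_def)

lemma embed_word_relation:
  assumes rel: "word_elem v 1 - word_elem w 1 \<in> lpa_relators E"
    and "v \<noteq> []" "w \<noteq> []" "set v \<subseteq> lpa_generators E" "set w \<subseteq> lpa_generators E"
  shows "embed (word_elem v c) = embed (word_elem w c)"
proof -
  have "scale c (word_elem v 1 - word_elem w 1) \<in> N" using rel by (intro N_scale relator_N)
  then show ?thesis using assms by (simp add: embed(3) word_elem_F scale_diff word_elem_simps)
qed

lemma embed_word_zero:
  assumes rel: "word_elem v 1 \<in> lpa_relators E" and "v \<noteq> []" "set v \<subseteq> lpa_generators E"
  shows "embed (word_elem v c) = 0"
proof -
  have "scale c (word_elem v 1) \<in> N" using rel by (intro N_scale relator_N)
  moreover have "0 \<in> carrier F" by (simp add: free_algebra_def)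
  ultimately show ?thesis using assms embed(3)[of "word_elem v c" 0] by (simp add: embed(4) word_elem_F word_elem_simps)
qed

lemma embed_word_mult:
  "\<lbrakk>v \<noteq> []; w \<noteq> []; set v \<subseteq> lpa_generators E; set w \<subseteq> lpa_generators E\<rbrakk> \<Longrightarrow>
    embed (word_elem v c) * embed (word_elem w d) = embed (word_elem (v @ w) (c * d))"
  by (simp add: embed(2)[symmetric] word_elem_F word_elem_simps)

end

context leavitt
begin

lemma relator_words:
  shows "v \<in> verts E \<Longrightarrow> word_elem [Vertex v, Vertex v] 1 - word_elem [Vertex v] 1 \<in> lpa_relators E"
    and "\<lbrakk>v \<in> verts E; w \<in> verts E; v \<noteq> w\<rbrakk> \<Longrightarrow> word_elem [Vertex v, Vertex w] 1 \<in> lpa_relators E"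
    and "e \<in> arcs E \<Longrightarrow> word_elem [Vertex (tail E e), Edge e] 1 - word_elem [Edge e] 1 \<in> lpa_relators E"
    and "e \<in> arcs E \<Longrightarrow> word_elem [Edge e, Vertex (head E e)] 1 - word_elem [Edge e] 1 \<in> lpa_relators E"
    and "e \<in> arcs E \<Longrightarrow> word_elem [Vertex (head E e), Ghost e] 1 - word_elem [Ghost e] 1 \<in> lpa_relators E"
    and "e \<in> arcs E \<Longrightarrow> word_elem [Ghost e, Vertex (tail E e)] 1 - word_elem [Ghost e] 1 \<in> lpa_relators E"
    and "e \<in> arcs E \<Longrightarrow> word_elem [Ghost e, Edge e] 1 - word_elem [Vertex (head E e)] 1 \<in> lpa_relators E"
    and "\<lbrakk>e \<in> arcs E; f \<in> arcs E; e \<noteq> f\<rbrakk> \<Longrightarrow> word_elem [Ghost e, Edge f] 1 \<in> lpa_relators E"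
  using lpa_relators.intros(1-8)[where E = E]
  by (simp_all add: word_elem_def mult_single plus_fword_def)

lemma embed_word_relations:
  shows "v \<in> verts E \<Longrightarrow> embed (word_elem [Vertex v, Vertex v] c) = embed (word_elem [Vertex v] c)"
    and "\<lbrakk>v \<in> verts E; w \<in> verts E; v \<noteq> w\<rbrakk> \<Longrightarrow> embed (word_elem [Vertex v, Vertex w] c) = 0"
    and "e \<in> arcs E \<Longrightarrow> embed (word_elem [Vertex (tail E e), Edge e] c) = embed (word_elem [Edge e] c)"
    and "e \<in> arcs E \<Longrightarrow> embed (word_elem [Edge e, Vertex (head E e)] c) = embed (word_elem [Edge e] c)"
    and "e \<in> arcs E \<Longrightarrow> embed (word_elem [Vertex (head E e), Ghost e] c) = embed (word_elem [Ghost e] c)"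
    and "e \<in> arcs E \<Longrightarrow> embed (word_elem [Ghost e, Vertex (tail E e)] c) = embed (word_elem [Ghost e] c)"
    and "e \<in> arcs E \<Longrightarrow> embed (word_elem [Ghost e, Edge e] c) = embed (word_elem [Vertex (head E e)] c)"
    and "\<lbrakk>e \<in> arcs E; f \<in> arcs E; e \<noteq> f\<rbrakk> \<Longrightarrow> embed (word_elem [Ghost e, Edge f] c) = 0"
  by (intro embed_word_relation embed_word_zero relator_words; simp add: generators)+

sublocale cohn_family E vertex edge ghost
proof
  fix v w :: 'v and e f :: 'e and c d :: 'k
  note g = generators vertex_def edge_def ghost_def embed_word_mult embed_word_relations
  show "v \<in> verts E \<Longrightarrow> vertex v (c + d) = vertex v c + vertex v d"
    by (simp add: vertex_def word_elem_simps embed(1) word_elem_F generators)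
  show "v \<in> verts E \<Longrightarrow> vertex v c * vertex v d = vertex v (c * d)" by (simp add: g)
  show "\<lbrakk>v \<in> verts E; w \<in> verts E; v \<noteq> w\<rbrakk> \<Longrightarrow> vertex v c * vertex w d = 0" by (simp add: g)
  show "e \<in> arcs E \<Longrightarrow> vertex (tail E e) c * edge e = edge e * vertex (head E e) c" by (simp add: g)
  show "e \<in> arcs E \<Longrightarrow> edge e * vertex (head E e) 1 = edge e" by (simp add: g)
  show "e \<in> arcs E \<Longrightarrow> vertex (head E e) c * ghost e = ghost e * vertex (tail E e) c" by (simp add: g)
  show "e \<in> arcs E \<Longrightarrow> vertex (head E e) 1 * ghost e = ghost e" by (simp add: g)
  show "e \<in> arcs E \<Longrightarrow> ghost e * edge e = vertex (head E e) 1" by (simp add: g)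
  show "\<lbrakk>e \<in> arcs E; f \<in> arcs E; e \<noteq> f\<rbrakk> \<Longrightarrow> ghost e * edge f = 0" by (simp add: g)
qed

lemma embed_letter_algebra:
  assumes "x \<in> lpa_generators E" shows "embed (word_elem [x] c) \<in> algebra"
proof -
  from assms consider v where "x = Vertex v" "v \<in> verts E" | e where "x = Edge e" "e \<in> arcs E"
    | e where "x = Ghost e" "e \<in> arcs E" by (auto simp: lpa_generators_def)
  then show ?thesis
  proof cases
    case 1
    then show ?thesis using algebra_generators(1)[of v c] by (simp only: vertex_def[of v c])
  next
    case 2
    then have "vertex (tail E e) c * edge e \<in> algebra"
      by (intro algebra_mult algebra_generators) auto
    moreover have "vertex (tail E e) c * edge e = embed (word_elem [Edge e] c)"
      using 2 by (simp add: vertex_def edge_def embed_word_mult generators embed_word_relations)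
    ultimately show ?thesis using 2 by simp
  next
    case 3
    then have "vertex (head E e) c * ghost e \<in> algebra"
      by (intro algebra_mult algebra_generators) auto
    moreover have "vertex (head E e) c * ghost e = embed (word_elem [Ghost e] c)"
      using 3 by (simp add: vertex_def ghost_def embed_word_mult generators embed_word_relations)
    ultimately show ?thesis using 3 by simp
  qed
qed

lemma embed_word_algebra:
  "\<lbrakk>w \<noteq> []; set w \<subseteq> lpa_generators E\<rbrakk> \<Longrightarrow> embed (word_elem w c) \<in> algebra"
proof (induction w arbitrary: c rule: list_nonempty_induct)
  case (single x)
  then show ?case by (simp add: embed_letter_algebra)
next
  case (cons x w)
  then have "embed (word_elem [x] 1) * embed (word_elem w c) \<in> algebra"
    by (intro algebra_mult embed_letter_algebra) auto
  then show ?case using cons by (simp add: embed_word_mult)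
qed

lemma embed_algebra:
  assumes "p \<in> carrier F" shows "embed p \<in> algebra"
proof -
  have "embed (\<Sum>w \<in> W. Poly_Mapping.single w (Poly_Mapping.lookup p w)) \<in> algebra \<and>
      (\<Sum>w \<in> W. Poly_Mapping.single w (Poly_Mapping.lookup p w)) \<in> carrier F"
    if "finite W" "W \<subseteq> Poly_Mapping.keys p" for W
    using that
  proof (induction W rule: finite_induct)
    case empty
    then show ?case by (simp add: embed(4) algebra_zero) (simp add: free_algebra_def)
  next
    case (insert w W)
    let ?s = "Poly_Mapping.single w (Poly_Mapping.lookup p w)"
    obtain l where l: "w = FWord l" by (cases w)
    have "w \<in> Poly_Mapping.keys p" using insert.prems by simp
    then have "w \<noteq> 0 \<and> set (letters w) \<subseteq> lpa_generators E"
      using assms by (simp add: free_algebra_def)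
    then have "l \<noteq> []" "set l \<subseteq> lpa_generators E"
      by (auto simp: l zero_fword_def)
    then have "?s \<in> carrier F" "embed ?s \<in> algebra"
      using word_elem_F embed_word_algebra by (simp_all add: l word_elem_def)
    moreover have "?s + (\<Sum>w \<in> W. Poly_Mapping.single w (Poly_Mapping.lookup p w)) \<in> carrier F"
      using calculation(1) insert F.a_closed by (simp add: F_simps)
    ultimately show ?case
      using insert by (simp add: embed(1) algebra_add)
  qed
  from this[OF finite_keys subset_refl] show ?thesis by (simp add: poly_mapping_sum_singles)
qed

text \<open>
  Both sides are generated by the same elements: a word in the generators is mapped to a product of
  vertices, edges and ghost edges, and its coefficient is absorbed by a vertex.
\<close>
lemma algebra_eq_image: "algebra = into_product L ` carrier L"
proof
  let ?A = "into_product L ` carrier L"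
  note P = into_product_add[OF L.nonunital_ring_axioms] into_product_mult[OF L.nonunital_ring_axioms]
    into_product_zero[OF L.nonunital_ring_axioms]
  have emb: "embed p \<in> ?A" if "p \<in> carrier F" for p
    using that rel_class(1) by (auto simp: embed_def)
  have add: "x + y \<in> ?A" if "x \<in> ?A" "y \<in> ?A" for x y
    using that by (auto simp: P(1)[symmetric] intro!: imageI)
  have mult: "x * y \<in> ?A" if "x \<in> ?A" "y \<in> ?A" for x y
    using that by (auto simp: P(2)[symmetric] intro!: imageI L.mult_closed)
  have gens: "vertex v c \<in> ?A" if "v \<in> verts E" for v c
    using that by (auto simp: vertex_def generators intro!: emb word_elem_F)
  have gense: "edge e \<in> ?A" "ghost e \<in> ?A" if "e \<in> arcs E" for e
    using that by (auto simp: edge_def ghost_def generators intro!: emb word_elem_F)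
  have path: "path_elem u p \<in> ?A \<and> ghost_elem u p \<in> ?A" if "awalk u p w" for u p w
    using that by (induction p arbitrary: u) (simp_all add: awalk_simps gens gense mult)
  show "algebra \<subseteq> ?A"
  proof
    fix x assume "x \<in> algebra"
    then show "x \<in> ?A"
      unfolding algebra_def
    proof (rule additive_span_into)
      show "0 \<in> ?A" using P(3) by (metis L.zero_closed imageI)
      show "sandwiches ((\<lambda>w. (w, {})) ` verts E) \<subseteq> ?A"
      proof
        fix b assume "b \<in> sandwiches ((\<lambda>w. (w, {})) ` verts E)"
        then obtain u p w c F v q where b: "b = path_elem u p * vertex w c * gap w F * ghost_elem v q"
          and pq: "awalk u p w" "awalk v q w" and F: "(w, F) \<in> (\<lambda>w. (w, {})) ` verts E"
          by (rule sandwichE)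
        have "gap w F = vertex w 1" "w \<in> verts E" using F by (auto simp: gap_empty)
        then show "b \<in> ?A" unfolding b by (intro mult gens) (use path[OF pq(1)] path[OF pq(2)] gens in auto)
      qed
    qed (rule add)
  qed
  show "?A \<subseteq> algebra"
    using rel_class(2) embed_algebra by (fastforce simp: embed_def)
qed

lemma ideal_in_image:
  assumes J: "two_sided_ideal J L"
  shows "ideal_in algebra (into_product L ` J)"
proof -
  note P = into_product_add[OF L.nonunital_ring_axioms] into_product_mult[OF L.nonunital_ring_axioms]
    into_product_zero[OF L.nonunital_ring_axioms] into_product_minus[OF L.nonunital_ring_axioms]
  have sub: "additive_subgroup J L" using J by (simp add: two_sided_ideal_def left_ideal_def)
  have JL: "J \<subseteq> carrier L" using sub by (rule additive_subgroup.a_subset)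
  have c: "\<And>a x. \<lbrakk>a \<in> carrier L; x \<in> J\<rbrakk> \<Longrightarrow> a \<otimes>\<^bsub>L\<^esub> x \<in> J" "\<And>a x. \<lbrakk>a \<in> carrier L; x \<in> J\<rbrakk> \<Longrightarrow> x \<otimes>\<^bsub>L\<^esub> a \<in> J"
    using J by (auto simp: two_sided_ideal_def left_ideal_def right_ideal_def)
  show ?thesis
    unfolding ideal_in_def algebra_eq_image
  proof (intro conjI ballI)
    show "into_product L ` J \<subseteq> into_product L ` carrier L" using JL by blast
    show "0 \<in> into_product L ` J"
      using P(3) additive_subgroup.zero_closed[OF sub] by (metis imageI)
    show "x + y \<in> into_product L ` J" if xy: "x \<in> into_product L ` J" "y \<in> into_product L ` J" for x y
    proof -
      obtain a where a: "x = into_product L a" "a \<in> J" using xy(1) by (rule imageE)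
      obtain b where b: "y = into_product L b" "b \<in> J" using xy(2) by (rule imageE)
      have "a \<in> carrier L" "b \<in> carrier L" using a b JL by auto
      moreover note a b
      ultimately show ?thesis
        using additive_subgroup.a_closed[OF sub] by (simp flip: P(1))
    qed
    show "- x \<in> into_product L ` J" if x: "x \<in> into_product L ` J" for x
    proof -
      obtain a where a: "a \<in> J" "x = into_product L a" using x by blast
      then have "a \<in> carrier L" using JL by auto
      then have "into_product L (\<zero>\<^bsub>L\<^esub> \<ominus>\<^bsub>L\<^esub> a) = - x" by (simp add: P(3,4) a)
      moreover have "\<zero>\<^bsub>L\<^esub> \<ominus>\<^bsub>L\<^esub> a \<in> J"
        using a(1) additive_subgroup.a_inv_closed[OF sub] additive_subgroup.a_closed[OF sub]
          additive_subgroup.zero_closed[OF sub] by (simp add: a_minus_def)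
      ultimately show ?thesis by (metis imageI)
    qed
    fix a x assume "a \<in> into_product L ` carrier L" "x \<in> into_product L ` J"
    then obtain b y where bw: "b \<in> carrier L" "a = into_product L b" "y \<in> J" "x = into_product L y" by blast
    moreover have "y \<in> carrier L" using bw JL by auto
    ultimately show "a * x \<in> into_product L ` J" "x * a \<in> into_product L ` J"
      using c by (simp_all flip: P(2))
  qed
qed

theorem weakly_regular_of_condition_K:
  assumes condition_K
  shows "weakly_regular_ring L"
proof (rule L.weakly_regular_of_locally_unital_ideals)
  fix J a assume J: "two_sided_ideal J L" and a: "a \<in> J"
  have JL: "J \<subseteq> carrier L"
    using J by (simp add: two_sided_ideal_def left_ideal_def additive_subgroup.a_subset)
  obtain j where j: "j \<in> J" "into_product L a * into_product L j = into_product L a"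
    "into_product L j * into_product L a = into_product L a"
    using ideal_locally_unital[OF assms ideal_in_image[OF J], of "into_product L a"] a by blast
  have "a \<in> carrier L" "j \<in> carrier L" using a j JL by auto
  then have "a \<otimes>\<^bsub>L\<^esub> j = a" "j \<otimes>\<^bsub>L\<^esub> a = a"
    using j by (simp_all add: L.mult_closed
        flip: into_product_mult[OF L.nonunital_ring_axioms] into_product_eq_iff[OF L.nonunital_ring_axioms])
  then show "\<exists>j \<in> J. a \<otimes>\<^bsub>L\<^esub> j = a \<and> j \<otimes>\<^bsub>L\<^esub> a = a" using j by blast
qed

theorem zorn_quotients_of_condition_K:
  assumes condition_K and I: "two_sided_ideal I L"
  shows "zorn_ring (L Quot I)"
proof (rule L.zorn_quotient_of_reduction[OF I])
  note P = into_product_mult[OF L.nonunital_ring_axioms] into_product_minus[OF L.nonunital_ring_axioms]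
    into_product_eq_iff[OF L.nonunital_ring_axioms]
  have IL: "I \<subseteq> carrier L"
    using I by (simp add: two_sided_ideal_def left_ideal_def additive_subgroup.a_subset)
  have mem: "into_product L x \<in> into_product L ` I \<longleftrightarrow> x \<in> I" if "x \<in> carrier L" for x
  proof
    assume "into_product L x \<in> into_product L ` I"
    then obtain y where y: "into_product L x = into_product L y" "y \<in> I" by (rule imageE)
    moreover have "y \<in> carrier L" using IL y(2) by blast
    ultimately show "x \<in> I" using that by (simp add: P(3))
  qed (rule imageI)
  fix a assume a: "a \<in> carrier L" "a \<notin> I"
  then have "into_product L a \<in> algebra" "into_product L a \<notin> into_product L ` I"
    using mem by (auto simp: algebra_eq_image)
  from reduction_to_gap[OF assms(1) ideal_in_image[OF I] this]
  obtain x' y' w F where xy': "x' \<in> algebra" "y' \<in> algebra" and wF: "(w, F) \<in> gap_index"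
    "gap w F \<notin> into_product L ` I" "x' * into_product L a * y' - gap w F \<in> into_product L ` I" by blast
  moreover have "gap w F \<in> algebra" using wF(1) by (rule gap_algebra)
  ultimately obtain x y g where xyg: "x \<in> carrier L" "y \<in> carrier L" "g \<in> carrier L"
    "x' = into_product L x" "y' = into_product L y" "gap w F = into_product L g"
    unfolding algebra_eq_image by blast
  have "into_product L (g \<otimes>\<^bsub>L\<^esub> g) = into_product L g"
    using gap_idem[OF wF(1)] xyg by (simp add: P)
  then have "idempotent L g" using xyg L.mult_closed by (simp add: P(3) idempotent_def)
  moreover have "g \<notin> I" using wF(2) xyg by auto
  moreover have "x \<otimes>\<^bsub>L\<^esub> a \<otimes>\<^bsub>L\<^esub> y \<ominus>\<^bsub>L\<^esub> g \<in> I"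
    using wF(3) xyg a mem[of "x \<otimes>\<^bsub>L\<^esub> a \<otimes>\<^bsub>L\<^esub> y \<ominus>\<^bsub>L\<^esub> g"] by (simp add: P(1,2) L.mult_closed)
  ultimately show "\<exists>x \<in> carrier L. \<exists>y \<in> carrier L. \<exists>g \<in> carrier L.
      idempotent L g \<and> g \<notin> I \<and> x \<otimes>\<^bsub>L\<^esub> a \<otimes>\<^bsub>L\<^esub> y \<ominus>\<^bsub>L\<^esub> g \<in> I"
    using xyg by blast
qed

end

section \<open>Obstruction to both ring properties\<close>

text \<open>
  The intended operators are matrices over a domain, with rows and columns indexed by \<open>'q\<close>.
\<close>
locale ring_action = nonunital_ring R for R (structure) +
  fixes act :: "'a \<Rightarrow> ('q \<Rightarrow> 'd :: idom) \<Rightarrow> 'q \<Rightarrow> 'd"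
  assumes act_add: "\<lbrakk>x \<in> carrier R; y \<in> carrier R\<rbrakk> \<Longrightarrow> act (x \<oplus> y) f q = act x f q + act y f q"
    and act_mult: "\<lbrakk>x \<in> carrier R; y \<in> carrier R\<rbrakk> \<Longrightarrow> act (x \<otimes> y) f = act x (act y f)"
    and act_scale: "x \<in> carrier R \<Longrightarrow> act x (\<lambda>q. r * f q) q = r * act x f q"
begin

definition kernel :: "'a set" where
  "kernel = {x \<in> carrier R. \<forall>f q. act x f q = 0}"

lemma act_zero: "act \<zero> f q = 0"
  using act_add[of \<zero> \<zero> f q] by (metis add_cancel_left_right l_zero zero_closed)

lemma act_uminus: "x \<in> carrier R \<Longrightarrow> act (\<ominus> x) f q = - act x f q"
  using act_add[of "\<ominus> x" x f q] by (simp add: l_neg act_zero eq_neg_iff_add_eq_0)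

lemma act_minus: "\<lbrakk>x \<in> carrier R; y \<in> carrier R\<rbrakk> \<Longrightarrow> act (x \<ominus> y) f q = act x f q - act y f q"
  by (simp add: a_minus_def act_add act_uminus)

lemma kernel_ideal: "two_sided_ideal kernel R"
proof -
  have z: "act x (\<lambda>q. 0) q = 0" if "x \<in> carrier R" for x q
    using act_scale[OF that, of 0 "\<lambda>_. 0" q] by simp
  have "additive_subgroup kernel R"
    by (rule additive_subgroup_of_closed) (auto simp: kernel_def act_zero act_add act_uminus)
  moreover have "r \<otimes> x \<in> kernel \<and> x \<otimes> r \<in> kernel" if "r \<in> carrier R" "x \<in> kernel" for r x
  proof -
    have "x \<in> carrier R" "act x f = (\<lambda>q. 0)" for f using that by (auto simp: kernel_def)
    then show ?thesis using that z by (simp add: kernel_def act_mult mult_closed)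
  qed
  ultimately show ?thesis by (auto simp: two_sided_ideal_def left_ideal_def right_ideal_def)
qed

end

text \<open>
  In a domain, a non-unit \<open>d \<noteq> 0\<close> is not nilpotent, does not divide a nonzero idempotent and is not in
  the square of the ideal that it generates. As \<open>a\<close> acts as \<open>d\<close> on one coordinate and as zero
  elsewhere, it inherits these properties.
\<close>
locale ring_action_obstruction = ring_action R act
  for R (structure) and act :: "'a \<Rightarrow> ('q \<Rightarrow> 'd :: idom) \<Rightarrow> 'q \<Rightarrow> 'd" +
  fixes a :: 'a and pt :: 'q and d :: 'd
  assumes a: "a \<in> carrier R"
    and act_a: "act a f q = (if q = pt then d * f pt else 0)"
    and d: "d \<noteq> 0" "\<not> d dvd 1"
begin

abbreviation delta :: "'q \<Rightarrow> 'd" where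
  "delta \<equiv> \<lambda>q. if q = pt then 1 else 0"

lemma act_a_scale: "act a f = (\<lambda>q. d * f pt * delta q)"
  by (rule ext) (simp add: act_a)

text \<open>
  Let \<open>I = a R\<close>. The matrix coefficient at \<open>pt\<close> of a product \<open>(a x) (a y)\<close> is divisible by \<open>d\<^sup>2\<close>,
  but that of \<open>a \<in> I\<close> is \<open>d\<close>.
\<close>
lemma not_weakly_regular:
  assumes v: "v \<in> carrier R" "a \<otimes> v = a"
  shows "\<not> weakly_regular_ring R"
proof
  assume "weakly_regular_ring R"
  then interpret weakly_regular_ring R .
  define I where "I = {a \<otimes> x | x. x \<in> carrier R}"
  have I: "I \<subseteq> carrier R" using a by (auto simp: I_def mult_closed)
  have "additive_subgroup I R"
  proof (rule additive_subgroup_of_closed[OF I])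
    show "\<zero> \<in> I" unfolding I_def using a mult_zero(2)[of a] by (auto intro!: exI[of _ \<zero>])
    show "x \<oplus> y \<in> I" if "x \<in> I" "y \<in> I" for x y
      using that a unfolding I_def by (auto simp flip: r_distrib)
    show "\<ominus> x \<in> I" if "x \<in> I" for x
      using that a unfolding I_def by (auto simp flip: mult_minus(2))
  qed
  then have "right_ideal I R"
    unfolding right_ideal_def using a by (auto simp: I_def mult_assoc mult_closed)
  then have "ideal_prod R I I = I" using weakly_regular by blast
  moreover have "a \<in> I" using v by (auto simp: I_def intro!: exI[of _ v])
  moreover have "d * d dvd act x delta pt" if "x \<in> ideal_prod R I I" for x
    using that
  proof (induction rule: ideal_prod.induct)
    case (prod i j)
    then obtain x y where xy: "x \<in> carrier R" "y \<in> carrier R" and ij: "i = a \<otimes> x" "j = a \<otimes> y"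
      by (auto simp: I_def)
    have "act (i \<otimes> j) delta pt = d * act x (\<lambda>q. d * act y delta pt * delta q) pt"
      using a xy by (simp add: ij act_mult mult_closed act_a act_a_scale[of "act y delta"])
    also have "\<dots> = d * d * (act y delta pt * act x delta pt)"
      using act_scale[OF xy(1), of "d * act y delta pt" delta pt] by (simp add: mult.assoc)
    finally show ?case by simp
  next
    case (sum x y)
    then show ?case using ideal_prod_closed[OF I] by (simp add: act_add)
  qed
  ultimately have "d * d dvd act a delta pt" by blast
  then show False using d by (simp add: act_a)
qed

text \<open>
  The powers of \<open>a\<close> act by the nonzero scalars \<open>d\<^sup>n\<close> at \<open>pt\<close>. A product \<open>g = a b\<close> has rank at most
  one: it maps \<open>f\<close> to \<open>\<phi> f\<close> times the basis function \<open>delta\<close> of \<open>pt\<close>. If \<open>g\<close> is idempotent, then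
  \<open>\<phi> f * \<phi> delta = \<phi> f\<close>, where \<open>\<phi> delta\<close> is a multiple of \<open>d\<close> and so is not 1; hence \<open>\<phi> = 0\<close>.
\<close>
lemma not_zorn_quotient: "\<not> zorn_ring (R Quot kernel)"
proof
  assume "zorn_ring (R Quot kernel)"
  then interpret Q: zorn_ring "R Quot kernel" .
  note q = quotient_coset[OF kernel_ideal] and c = mult_closed
  let ?A = "kernel +> a"
  have "\<not> nilpotent (R Quot kernel) ?A"
  proof
    assume "nilpotent (R Quot kernel) ?A"
    then obtain n where n: "((\<lambda>x. x \<otimes>\<^bsub>R Quot kernel\<^esub> ?A) ^^ n) ?A = \<zero>\<^bsub>R Quot kernel\<^esub>"
      by (auto simp: nilpotent_def)
    have pow: "((\<lambda>x. x \<otimes> a) ^^ m) a \<in> carrier R \<and>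
        ((\<lambda>x. x \<otimes>\<^bsub>R Quot kernel\<^esub> ?A) ^^ m) ?A = kernel +> ((\<lambda>x. x \<otimes> a) ^^ m) a \<and>
        (\<forall>f. act (((\<lambda>x. x \<otimes> a) ^^ m) a) f pt = d ^ Suc m * f pt)" for m
      by (induction m) (auto simp: a act_a q c act_mult)
    have "((\<lambda>x. x \<otimes> a) ^^ n) a \<in> kernel" using n pow[of n] q(5) by simp
    then have "act (((\<lambda>x. x \<otimes> a) ^^ n) a) delta pt = 0" by (simp add: kernel_def)
    then show False using pow[of n] d by simp
  qed
  then obtain B where B: "B \<in> carrier (R Quot kernel)"
    "?A \<otimes>\<^bsub>R Quot kernel\<^esub> B \<noteq> \<zero>\<^bsub>R Quot kernel\<^esub>" "idempotent (R Quot kernel) (?A \<otimes>\<^bsub>R Quot kernel\<^esub> B)"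
    using Q.zorn[OF q(1)[OF a]] by blast
  obtain b where b: "b \<in> carrier R" "B = kernel +> b" using q(2)[OF B(1)] by blast
  define g where "g = a \<otimes> b"
  have g: "g \<in> carrier R" "g \<notin> kernel" "g \<otimes> g \<ominus> g \<in> kernel"
    using B b a by (auto simp: g_def q c idempotent_def ideal_coset_eq_iff[OF kernel_ideal])
  define \<phi> where "\<phi> f = d * act b f pt" for f
  have act_g: "act g f = (\<lambda>q. \<phi> f * delta q)" for f
    using a b by (simp add: g_def act_mult act_a_scale \<phi>_def)
  have "\<phi> f = 0" for f
  proof -
    have "act (g \<otimes> g \<ominus> g) f pt = 0" using g(3) by (simp add: kernel_def)
    then have "act g (act g f) pt = act g f pt" using g(1) by (simp add: act_minus act_mult c)
    moreover have "act g (act g f) pt = \<phi> f * act g delta pt"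
      using act_scale[OF g(1), of "\<phi> f" delta pt] by (simp add: act_g[of f])
    ultimately have "\<phi> f * \<phi> delta = \<phi> f" by (simp add: act_g)
    moreover have "\<phi> delta \<noteq> 1" using d(2) by (auto simp: \<phi>_def dvd_def)
    ultimately show ?thesis by simp
  qed
  then have "g \<in> kernel" using g(1) by (simp add: kernel_def act_g)
  then show False using g(2) by blast
qed

end

section \<open>Actions of non-commutative polynomials\<close>

locale letter_action =
  fixes \<rho> :: "'g \<Rightarrow> ('q \<Rightarrow> 'k :: field fps) \<Rightarrow> 'q \<Rightarrow> 'k fps"
  assumes \<rho>_add: "\<rho> x (\<lambda>q. f q + g q) q = \<rho> x f q + \<rho> x g q"
    and \<rho>_scale: "\<rho> x (\<lambda>q. r * f q) q = r * \<rho> x f q"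
begin

definition word_act :: "'g list \<Rightarrow> ('q \<Rightarrow> 'k fps) \<Rightarrow> 'q \<Rightarrow> 'k fps" where
  "word_act w = foldr \<rho> w"

definition poly_act :: "('g, 'k) ncpoly \<Rightarrow> ('q \<Rightarrow> 'k fps) \<Rightarrow> 'q \<Rightarrow> 'k fps" where
  "poly_act p f q = (\<Sum>w \<in> Poly_Mapping.keys p. fps_const (Poly_Mapping.lookup p w) * word_act (letters w) f q)"

lemma word_act_simps: "word_act [] f = f" "word_act (x # w) f = \<rho> x (word_act w f)"
  "word_act (v @ w) f = word_act v (word_act w f)"
  by (simp_all add: word_act_def)

lemma word_act_linear:
  "word_act w (\<lambda>q. f q + g q) q = word_act w f q + word_act w g q"
  "word_act w (\<lambda>q. r * f q) q = r * word_act w f q"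
proof -
  have "word_act w (\<lambda>q. f q + g q) = (\<lambda>q. word_act w f q + word_act w g q)"
    by (induction w) (simp_all add: word_act_simps \<rho>_add ext)
  then show "word_act w (\<lambda>q. f q + g q) q = word_act w f q + word_act w g q" by simp
  have "word_act w (\<lambda>q. r * f q) = (\<lambda>q. r * word_act w f q)"
    by (induction w) (simp_all add: word_act_simps \<rho>_scale ext)
  then show "word_act w (\<lambda>q. r * f q) q = r * word_act w f q" by simp
qed

lemma word_act_sum:
  "word_act w (\<lambda>q. \<Sum>i \<in> I. g i q) q = (\<Sum>i \<in> I. word_act w (g i) q)"
proof (induction I rule: infinite_finite_induct)
  case (insert i I)
  then show ?case by (simp add: word_act_linear)
qed (use word_act_linear(2)[of w 0 "\<lambda>_. 0"] in simp_all)

lemma poly_act_superset: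
  assumes "finite S" "Poly_Mapping.keys p \<subseteq> S"
  shows "poly_act p f q = (\<Sum>w \<in> S. fps_const (Poly_Mapping.lookup p w) * word_act (letters w) f q)"
  unfolding poly_act_def using assms
  by (intro sum.mono_neutral_left) (auto simp: in_keys_iff)

lemma poly_act_add: "poly_act (p + p') f q = poly_act p f q + poly_act p' f q"
proof -
  let ?S = "Poly_Mapping.keys p \<union> Poly_Mapping.keys p'"
  have "poly_act (p + p') f q =
      (\<Sum>w \<in> ?S. fps_const (Poly_Mapping.lookup (p + p') w) * word_act (letters w) f q)"
    using keys_add[of p p'] by (intro poly_act_superset) auto
  then show ?thesis
    by (simp add: poly_act_superset[of ?S p] poly_act_superset[of ?S p'] lookup_add distrib_right
        sum.distrib flip: fps_const_add)
qed

lemma poly_act_zero: "poly_act 0 f q = 0"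
  by (simp add: poly_act_def)

lemma poly_act_diff: "poly_act (p - p') f q = poly_act p f q - poly_act p' f q"
  using poly_act_add[of "p - p'" p' f q] by simp

lemma poly_act_sum: "poly_act (\<Sum>i \<in> I. p i) f q = (\<Sum>i \<in> I. poly_act (p i) f q)"
  by (induction I rule: infinite_finite_induct) (simp_all add: poly_act_add poly_act_zero)

lemma poly_act_single: "poly_act (Poly_Mapping.single w c) f q = fps_const c * word_act (letters w) f q"
  by (subst poly_act_superset[of "{w}"]) simp_all

lemma poly_act_scale_arg: "poly_act p (\<lambda>q. r * f q) q = r * poly_act p f q"
  by (simp add: poly_act_def word_act_linear sum_distrib_left mult.left_commute)

lemma poly_act_mult: "poly_act (p * p') f = poly_act p (poly_act p' f)"
proof
  fix q
  let ?s = "\<lambda>p w. Poly_Mapping.single w (Poly_Mapping.lookup p w)"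
  have "p * p' = (\<Sum>u \<in> Poly_Mapping.keys p. \<Sum>w \<in> Poly_Mapping.keys p'. ?s p u * ?s p' w)"
    by (simp add: poly_mapping_sum_singles flip: sum_product)
  then have "poly_act (p * p') f q = (\<Sum>u \<in> Poly_Mapping.keys p. \<Sum>w \<in> Poly_Mapping.keys p'.
      fps_const (Poly_Mapping.lookup p u) * (fps_const (Poly_Mapping.lookup p' w) *
        word_act (letters u) (word_act (letters w) f) q))"
    by (simp only: poly_act_sum)
      (simp add: poly_act_single mult_single plus_fword_def word_act_simps mult.assoc flip: fps_const_mult)
  also have "\<dots> = (\<Sum>u \<in> Poly_Mapping.keys p. fps_const (Poly_Mapping.lookup p u) *
      word_act (letters u) (\<lambda>q. \<Sum>w \<in> Poly_Mapping.keys p'. fps_const (Poly_Mapping.lookup p' w) *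
        word_act (letters w) f q) q)"
    by (simp add: word_act_sum word_act_linear flip: sum_distrib_left)
  also have "\<dots> = poly_act p (poly_act p' f) q"
    by (simp add: poly_act_def[of p] poly_act_def[of p' f, abs_def])
  finally show "poly_act (p * p') f q = poly_act p (poly_act p' f) q" .
qed

lemma poly_act_scale: "poly_act (scale c p) f q = fps_const c * poly_act p f q"
  by (simp add: scale_def poly_act_mult poly_act_single zero_fword_def word_act_simps)

end

section \<open>The representation attached to a unique first return\<close>

locale unique_return = leavitt E K for E :: "('v, 'e) pre_digraph" and K :: "'k :: field itself" +
  fixes v :: 'v and c :: "'e list"
  assumes ret: "first_return v c" and uniq: "first_return v d \<Longrightarrow> d = c"
begin

lemma ret_tail: "c = p @ f # r \<Longrightarrow> p \<noteq> [] \<Longrightarrow> tail E f \<noteq> v"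
proof
  assume c: "c = p @ f # r" "p \<noteq> []" and f: "tail E f = v"
  have "awalk v (p @ f # r) v" using ret c by (simp only: first_return_def)
  then obtain x where "awalk v p x" "awalk x (f # r) v" by (rule awalk_appendE)
  then have "awalk v p v" using f by (auto simp: awalk_Cons_iff)
  moreover have "strict_prefix p c" using c by (auto simp: strict_prefix_def prefix_def)
  ultimately show False using ret c(2) by (auto simp: first_return_def)
qed

text \<open>
  These walks to \<open>v\<close> form a basis that behaves like the set of infinite walks that end in
  \<open>c c c \<dots>\<close>, cut at the first visit of \<open>v\<close>: the empty walk stands for \<open>c c c \<dots>\<close> itself. So its
  first edge is that of \<open>c\<close>, and what follows this edge is the rest of \<open>c\<close>.
\<close>
definition paths :: "'e list set" where
  "paths = {q. awalk (awhd v q) q v \<and> (\<forall>f \<in> set q. tail E f \<noteq> v)}"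

definition first :: "'e list \<Rightarrow> 'e" where "first q = hd (if q = [] then c else q)"
definition rest :: "'e list \<Rightarrow> 'e list" where "rest q = tl (if q = [] then c else q)"
definition join :: "'e \<Rightarrow> 'e list \<Rightarrow> 'e list" where "join e q = (if tail E e = v then [] else e # q)"

text \<open>
  Each passage of the first edge of \<open>c\<close> is weighted with the unit \<open>1 + X\<close>. It separates \<open>v\<close> from \<open>c\<close>,
  while \<open>v - c\<close> becomes the non-unit \<open>- X\<close>.
\<close>
definition weight :: "'e list \<Rightarrow> 'k fps" where "weight q = (if q = [] then 1 + fps_X else 1)"

lemma start_eq_iff: "q \<in> paths \<Longrightarrow> awhd v q = v \<longleftrightarrow> q = []"
  by (cases q) (auto simp: paths_def)

lemma awhd_of: "awalk u q v \<Longrightarrow> awhd v q = u"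
  by (cases q) (auto simp: awalk_simps)

lemma ret_walk: "awalk v c v" "c \<noteq> []"
  using ret by (auto simp: first_return_def)

lemma Nil_paths: "[] \<in> paths"
  using ret_walk(1) by (auto simp: paths_def awalk_Nil_iff awalk_hd_in_verts)

lemma paths_split:
  assumes "q \<in> paths"
  shows "first q \<in> arcs E" "rest q \<in> paths" "awhd v (rest q) = head E (first q)"
    "tail E (first q) = awhd v q" "join (first q) (rest q) = q"
proof -
  obtain e r where q: "(if q = [] then c else q) = e # r"
    using ret_walk(2) by (cases "if q = [] then c else q") (auto split: if_splits)
  have fr: "first q = e" "rest q = r" unfolding first_def rest_def q by simp_all
  have w: "awalk (awhd v q) (e # r) v"
    using assms q ret_walk(1) by (auto simp: paths_def split: if_splits)
  then have e: "e \<in> arcs E" "tail E e = awhd v q" "awalk (head E e) r v"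
    by (auto simp: awalk_Cons_iff)
  have hr: "awhd v r = head E e" using e(3) by (rule awhd_of)
  have t: "tail E f \<noteq> v" if f: "f \<in> set r" for f
  proof (cases "q = []")
    case True
    obtain r1 r2 where "r = r1 @ f # r2" using f by (auto simp: in_set_conv_decomp)
    then have "c = (e # r1) @ f # r2" using q True by simp
    then show ?thesis using ret_tail by blast
  next
    case False
    then show ?thesis using assms q f by (auto simp: paths_def)
  qed
  show "first q \<in> arcs E" "awhd v (rest q) = head E (first q)" "tail E (first q) = awhd v q"
    using e hr by (simp_all add: fr)
  show "rest q \<in> paths" using t e(3) by (simp add: fr paths_def hr)
  have "join e r = q"
  proof (cases "q = []")
    case True
    then show ?thesis using e(2) by (simp add: join_def)
  next
    case False
    then have "q = e # r" using q by simp
    then show ?thesis using assms by (simp add: join_def paths_def)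
  qed
  then show "join (first q) (rest q) = q" by (simp only: fr)
qed

text \<open>
  Together with the previous lemma: an element of \<open>paths\<close> is the same as an edge followed by an
  element of \<open>paths\<close> that starts at the head of this edge. If the edge starts at \<open>v\<close>, the result
  is a first return at \<open>v\<close>, thus \<open>c\<close>, which is where uniqueness is used.
\<close>
lemma paths_join:
  assumes e: "e \<in> arcs E" and q: "q \<in> paths" "awhd v q = head E e"
  shows "join e q \<in> paths" "first (join e q) = e" "rest (join e q) = q"
proof -
  have w: "awalk (head E e) q v" using q by (simp add: paths_def)
  have eq: "e # q = c" if te: "tail E e = v"
  proof (rule uniq)
    have "\<not> awalk v b v" if b: "strict_prefix b (e # q)" "b \<noteq> []" for b
    proof
      assume bw: "awalk v b v"
      obtain r where r: "e # q = b @ r" "r \<noteq> []"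
        using b(1) by (auto simp: strict_prefix_def prefix_def)
      have "awalk v (e # q) v" using w e te by (simp add: awalk_Cons_iff)
      then have "awalk v (b @ r) v" by (simp only: r(1))
      then have rw: "awalk v r v" using awalk_cancel[OF bw] by blast
      obtain f r' where f: "r = f # r'" using r(2) by (cases r) auto
      then have "tail E f = v" using rw by (simp add: awalk_Cons_iff)
      moreover have "f \<in> set q" using r(1) b(2) f by (cases b) auto
      ultimately show False using q by (auto simp: paths_def)
    qed
    then show "first_return v (e # q)"
      using w e te by (auto simp: first_return_def awalk_Cons_iff)
  qed
  show "join e q \<in> paths"
    using w e q Nil_paths by (auto simp: join_def paths_def awalk_Cons_iff)
  show "first (join e q) = e" "rest (join e q) = q"
    using eq by (auto simp: join_def first_def rest_def)
qed

fun letter_act :: "('v, 'e) lpa_generator \<Rightarrow> ('e list \<Rightarrow> 'k fps) \<Rightarrow> 'e list \<Rightarrow> 'k fps" where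
  "letter_act (Vertex u) f q = (if q \<in> paths \<and> awhd v q = u then f q else 0)"
| "letter_act (Edge e) f q = (if q \<in> paths \<and> first q = e then weight q * f (rest q) else 0)"
| "letter_act (Ghost e) f q =
    (if q \<in> paths \<and> awhd v q = head E e then inverse (weight (join e q)) * f (join e q) else 0)"

sublocale letter_action letter_act
proof
  fix x :: "('v, 'e) lpa_generator" and f g :: "'e list \<Rightarrow> 'k fps" and q r
  show "letter_act x (\<lambda>q. f q + g q) q = letter_act x f q + letter_act x g q"
    by (cases x) (simp_all add: distrib_left)
  show "letter_act x (\<lambda>q. r * f q) q = r * letter_act x f q"
    by (cases x) (simp_all add: mult.left_commute)
qed

lemma weight_inverse: "inverse (weight q) * weight q = 1" "weight q * inverse (weight q) = 1"
proof -
  have "fps_nth (weight q) 0 \<noteq> 0" by (simp add: weight_def)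
  then show "inverse (weight q) * weight q = 1" by (rule inverse_mult_eq_1)
  then show "weight q * inverse (weight q) = 1" by (simp add: mult.commute)
qed

lemma gen_act: "poly_act (gen x) f = letter_act x f"
  by (rule ext) (simp add: poly_act_single word_act_simps)

lemma relator_act:
  assumes "p \<in> lpa_relators E" shows "poly_act p f q = 0"
  using assms
proof cases
  case (edge_range e)
  then show ?thesis using paths_split[of q] by (auto simp: poly_act_diff poly_act_mult gen_act)
next
  case (source_edge e)
  then show ?thesis using paths_split[of q] by (auto simp: poly_act_diff poly_act_mult gen_act)
next
  case (ghost_source e)
  then show ?thesis
    using paths_join[of e q] paths_split[of "join e q"] by (auto simp: poly_act_diff poly_act_mult gen_act)
next
  case (ghost_edge_same e)
  then show ?thesis
    using paths_join[of e q] weight_inverse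
    by (auto simp: poly_act_diff poly_act_mult gen_act simp flip: mult.assoc)
next
  case (ghost_edge_distinct e f)
  then show ?thesis using paths_join[of e q] by (auto simp: poly_act_mult gen_act)
next
  case (vertex_sum u)
  have eq: "poly_act (gen (Edge e) * gen (Ghost e)) f q = (if q \<in> paths \<and> first q = e then f q else 0)" for e
    using paths_split[of q] weight_inverse(2)[of q]
    by (auto simp: poly_act_mult gen_act simp flip: mult.assoc)
  have "(\<Sum>e \<in> out_arcs E u. if q \<in> paths \<and> first q = e then f q else 0) =
      (if q \<in> paths \<and> first q \<in> out_arcs E u then f q else 0)"
    using vertex_sum(2) by (cases "q \<in> paths") (simp_all add: regular_vertex_def)
  then show ?thesis
    using paths_split[of q] by (auto simp: vertex_sum(1) poly_act_diff poly_act_sum eq gen_act)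
qed (auto simp: poly_act_diff poly_act_mult gen_act)

lemma relation_act:
  assumes "p \<in> N" shows "poly_act p f q = 0"
proof -
  let ?I = "{p \<in> carrier F. \<forall>f q. poly_act p f q = 0}"
  have z: "poly_act p (\<lambda>q. 0) q = 0" for p q
    using poly_act_scale_arg[of p 0 "\<lambda>_. 0" q] by simp
  have neg: "- p \<in> carrier F" if "p \<in> carrier F" for p
    using F.a_inv_closed[OF that] that by (simp add: F_uminus)
  have "additive_subgroup ?I F"
    by (rule F.additive_subgroup_of_closed)
      (auto simp: F_uminus F_simps poly_act_add poly_act_zero poly_act_diff[of 0, simplified]
        dest: F.a_closed intro: neg F.zero_closed[unfolded F_simps])
  moreover have "r \<otimes>\<^bsub>F\<^esub> p \<in> ?I \<and> p \<otimes>\<^bsub>F\<^esub> r \<in> ?I" if "r \<in> carrier F" "p \<in> ?I" for r p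
  proof -
    have "poly_act p f = (\<lambda>q. 0)" for f using that by auto
    then show ?thesis
      using that F.mult_closed[of r p] F.mult_closed[of p r] by (simp add: F_simps poly_act_mult z)
  qed
  ultimately have "two_sided_ideal ?I F" by (auto simp: two_sided_ideal_def left_ideal_def right_ideal_def)
  moreover have "scale k p \<in> ?I" if "p \<in> ?I" for k p
  proof -
    have "scale k p \<in> carrier F"
      using that keys_mult[of "Poly_Mapping.single 0 k" p]
      by (fastforce simp: free_algebra_def scale_def split: if_splits)
    then show ?thesis using that by (simp add: poly_act_scale)
  qed
  moreover have "lpa_relators E \<subseteq> ?I"
    using relator_act lpa_relators_subset[OF wf_digraph_axioms] by blast
  ultimately have "N \<subseteq> ?I"
    unfolding algebra_ideal_generated_def by (intro Inter_lower) simp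
  then show ?thesis using assms by blast
qed

text \<open>
  The choice of the representative does not matter, because the relations act as zero.
\<close>
definition algebra_act :: "(('v, 'e) lpa_generator, 'k) ncpoly set \<Rightarrow> ('e list \<Rightarrow> 'k fps) \<Rightarrow> 'e list \<Rightarrow> 'k fps" where
  "algebra_act X = poly_act (SOME p. p \<in> carrier F \<and> X = rel_class p)"

lemma algebra_act_class:
  assumes "p \<in> carrier F" shows "algebra_act (rel_class p) = poly_act p"
proof -
  define p' where "p' = (SOME p'. p' \<in> carrier F \<and> rel_class p = rel_class p')"
  have "p' \<in> carrier F \<and> rel_class p = rel_class p'"
    unfolding p'_def
    by (rule someI[of "\<lambda>p'. p' \<in> carrier F \<and> rel_class p = rel_class p'" p]) (simp add: assms)
  then have "p - p' \<in> N" using rel_class(6) assms by blast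
  then have "poly_act (p - p') f q = 0" for f q by (rule relation_act)
  then show ?thesis
    unfolding algebra_act_def p'_def[symmetric] by (intro ext) (simp add: poly_act_diff)
qed

lemma path_act:
  "q \<in> paths \<Longrightarrow> word_act (map Edge q @ [Vertex v]) f x = (if x = q then f [] else 0)"
proof (induction q arbitrary: x)
  case Nil
  then show ?case using Nil_paths start_eq_iff[of x] by (auto simp: word_act_simps)
next
  case (Cons e q)
  have te: "tail E e \<noteq> v" and e: "e \<in> arcs E" "awalk (head E e) q v"
    using Cons.prems by (auto simp: paths_def awalk_Cons_iff)
  have q: "q \<in> paths" "awhd v q = head E e"
    using Cons.prems e awhd_of[OF e(2)] by (auto simp: paths_def)
  have j: "join e q = e # q" using te by (simp add: join_def)
  have "x \<in> paths \<and> first x = e \<and> rest x = q \<longleftrightarrow> x = e # q"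
    using paths_split(5)[of x] paths_join[OF e(1) q] j by auto
  then show ?case using Cons.IH[OF q(1)] by (auto simp: word_act_simps weight_def)
qed

lemma return_act:
  "word_act (map Edge c @ [Vertex v]) f x = (if x = [] then (1 + fps_X) * f [] else 0)"
proof -
  have c: "c = first [] # rest []" using ret_walk(2) by (simp add: first_def rest_def)
  note s = paths_split[OF Nil_paths]
  have "x \<in> paths \<and> first x = first [] \<and> rest x = rest [] \<longleftrightarrow> x = []"
    using paths_split(5)[of x] s(5) Nil_paths by auto
  then show ?thesis
    by (subst c) (auto simp: word_act_simps weight_def path_act[OF s(2), unfolded word_act_simps])
qed

text \<open>
  The element \<open>v - c\<close>. The word for \<open>c\<close> ends in \<open>v\<close>, so that it acts as a multiple of the
  projection onto the coordinate of the empty walk.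
\<close>
definition obstruction :: "(('v, 'e) lpa_generator, 'k) ncpoly" where
  "obstruction = word_elem [Vertex v] 1 - word_elem (map Edge c @ [Vertex v]) 1"

lemma words_F:
  "word_elem [Vertex v] 1 \<in> carrier F" "word_elem (map Edge c) 1 \<in> carrier F"
  "word_elem (map Edge c @ [Vertex v]) 1 \<in> carrier F" "obstruction \<in> carrier F"
proof -
  have v: "v \<in> verts E" and c: "set c \<subseteq> arcs E" "c \<noteq> []"
    using ret_walk by (auto simp: awalk_def)
  show 1: "word_elem [Vertex v] 1 \<in> carrier F" "word_elem (map Edge c) 1 \<in> carrier F"
    "word_elem (map Edge c @ [Vertex v]) 1 \<in> carrier F"
    using v c by (intro word_elem_F; auto simp: generators)+
  show "obstruction \<in> carrier F"
    using F.minus_closed[OF 1(1,3)] 1 by (simp add: obstruction_def F_minus)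
qed

lemma obstruction_act: "poly_act obstruction f q = (if q = [] then - fps_X * f [] else 0)"
  using return_act[of f q] path_act[OF Nil_paths, of f q]
  by (simp add: obstruction_def poly_act_diff word_elem_def poly_act_single distrib_right)

sublocale ring_action_obstruction L algebra_act "rel_class obstruction" "[]" "- fps_X"
proof
  fix X Y f q assume X: "X \<in> carrier L"
  obtain p where p: "p \<in> carrier F" "X = rel_class p" using rel_class(2)[OF X] by blast
  show "algebra_act X (\<lambda>q. r * f q) q = r * algebra_act X f q" for r
    by (simp add: p algebra_act_class poly_act_scale_arg)
  assume Y: "Y \<in> carrier L"
  obtain p' where p': "p' \<in> carrier F" "Y = rel_class p'" using rel_class(2)[OF Y] by blast
  have "p + p' \<in> carrier F" "p * p' \<in> carrier F"
    using F.a_closed[OF p(1) p'(1)] F.mult_closed[OF p(1) p'(1)] by (simp_all add: F_simps)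
  then show "algebra_act (X \<oplus>\<^bsub>L\<^esub> Y) f q = algebra_act X f q + algebra_act Y f q"
    "algebra_act (X \<otimes>\<^bsub>L\<^esub> Y) f = algebra_act X (algebra_act Y f)"
    using p p' by (simp_all add: rel_class(3,4) algebra_act_class poly_act_add poly_act_mult)
next
  fix f q
  show "rel_class obstruction \<in> carrier L" using words_F(4) by (rule rel_class(1))
  show "algebra_act (rel_class obstruction) f q = (if q = [] then - fps_X * f [] else 0)"
    using words_F(4) by (simp add: algebra_act_class obstruction_act)
  show "- fps_X \<noteq> (0 :: 'k fps)" by simp
  show "\<not> - fps_X dvd (1 :: 'k fps)"
  proof
    assume "- fps_X dvd (1 :: 'k fps)"
    then obtain g :: "'k fps" where "1 = - fps_X * g" by (auto simp: dvd_def)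
    then have "fps_nth (1 :: 'k fps) 0 = fps_nth (- fps_X * g) 0" by simp
    then show False by simp
  qed
qed

theorem not_weakly_regular_leavitt: "\<not> weakly_regular_ring L"
proof (rule not_weakly_regular)
  let ?v = "word_elem [Vertex v] 1" and ?r = "word_elem [Vertex v, Vertex v] 1 - word_elem [Vertex v] 1"
  have v: "v \<in> verts E" using ret_walk(1) by (rule awalk_hd_in_verts)
  show "rel_class ?v \<in> carrier L" using words_F(1) by (rule rel_class(1))
  have "obstruction * ?v - obstruction = ?r - word_elem (map Edge c) 1 * ?r"
    by (simp add: obstruction_def left_diff_distrib right_diff_distrib word_elem_simps)
  moreover have r: "?r \<in> N" using relator_words(1)[OF v] by (rule relator_N)
  moreover have "word_elem (map Edge c) 1 * ?r \<in> N"
    using N_ideal r words_F(2) by (simp add: two_sided_ideal_def left_ideal_def F_simps)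
  moreover have "x - y \<in> N" if "x \<in> N" "y \<in> N" for x y
  proof -
    have N: "additive_subgroup N F" using N_ideal by (simp add: two_sided_ideal_def left_ideal_def)
    have "x \<in> carrier F" "y \<in> carrier F" using that additive_subgroup.a_subset[OF N] by auto
    moreover have "x \<ominus>\<^bsub>F\<^esub> y \<in> N"
      using that additive_subgroup.a_closed[OF N] additive_subgroup.a_inv_closed[OF N] by (simp add: a_minus_def)
    ultimately show ?thesis by (simp add: F_minus)
  qed
  ultimately have "obstruction * ?v - obstruction \<in> N" by simp
  moreover have "obstruction * ?v \<in> carrier F"
    using F.mult_closed[OF words_F(4,1)] by (simp add: F_simps)
  ultimately show "rel_class obstruction \<otimes>\<^bsub>L\<^esub> rel_class ?v = rel_class obstruction"
    using words_F by (simp add: rel_class(3,6))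
qed

end

theorem proposition3:
  fixes E :: "('v, 'e) pre_digraph"
  assumes "wf_digraph E"
  shows "(\<forall>I. two_sided_ideal I (leavitt_path_algebra TYPE('k :: field) E) \<longrightarrow>
            zorn_ring (leavitt_path_algebra TYPE('k) E Quot I))
         \<longleftrightarrow> weakly_regular_ring (leavitt_path_algebra TYPE('k) E)"
proof -
  interpret leavitt E "TYPE('k)" using assms by (rule leavitt.intro)
  show ?thesis
  proof (cases condition_K)
    case True
    then show ?thesis using weakly_regular_of_condition_K zorn_quotients_of_condition_K by blast
  next
    case False
    then obtain v c where "first_return v c" "\<And>d. first_return v d \<Longrightarrow> d = c"
      unfolding condition_K_def by blast
    then interpret unique_return E "TYPE('k)" v c by unfold_locales
    show ?thesis using not_weakly_regular_leavitt not_zorn_quotient kernel_ideal by blast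
  qed
qed

end
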